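(* Let $d\in\mathbb N$, $n\ge2$, $\beta_1,\dots,\beta_n\ge-1$, with $\beta_1,\dots,\beta_n\ne-1$ if $d=1$. Let $\mathscr P=[X_1,\dots,X_n]\sim\mathrm{BetaPoly}(\mathbb R^d;\beta_1,\dots,\beta_n)$ and put $\gamma_i=\beta_i+\frac d2$. Let $k\in\{1,\dots,\min(d,n-1)\}$, let $K=\{i_1,\dots,i_k\}\subseteq\{1,\dots,n\}$ have $k$ elements, $K^c=\{1,\dots,n\}\setminus K$, and $F_K=[X_{i_1},\dots,X_{i_k}]$. Let $T(F_K,\mathscr P)$ be the tangent cone of $\mathscr P$ at $F_K$ (defined as $\mathbb R^d$ if $F_K$ is not a face of $\mathscr P$). Then $T(F_K,\mathscr P)$ is isometric to $$\mathbb R^{k-1}\oplus\mathrm{BetaCone}\Big(\mathbb R^{d-k+1};\ \Big(\sum_{i\in K}\gamma_i\Big)-\frac{d-k+1}2;\ \Big\{\gamma_i-\frac{d-k+1}2:i\in K^c\Big\}\Big).$$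
   Context: Beta distribution: for $d\in\mathbb N$ and $\beta>-1$, $f_{d,\beta}$ is the probability distribution on the unit ball $\mathbb B^d$ of $\mathbb R^d$ with Lebesgue density $c_{d,\beta}(1-\|x\|^2)^\beta\mathbf 1_{\{\|x\|<1\}}$, $c_{d,\beta}=\frac{\Gamma(\frac d2+\beta+1)}{\pi^{d/2}\Gamma(\beta+1)}$; $f_{d,-1}$ denotes the uniform distribution on the unit sphere $\mathbb S^{d-1}$. $\mathscr P=[X_1,\dots,X_n]\sim\mathrm{BetaPoly}(\mathbb R^d;\beta_1,\dots,\beta_n)$: convex hull of independent points $X_i\sim f_{d,\beta_i}$. $\mathrm{BetaCone}(\mathbb R^m;\beta;\beta_1,\dots,\beta_N)$ denotes a random cone distributed as $\mathrm{pos}(Z_1-Z,\dots,Z_N-Z)$ with independent $Z\sim f_{m,\beta}$, $Z_i\sim f_{m,\beta_i}$, where $\mathrm{pos}$ is the set of nonnegative linear combinations. $T(F,P)=\{x: v+\varepsilon x\in P\text{ for some }\varepsilon>0\}$, $v$ in the relative interior of the face $F$. $C_1\oplus C_2$ is the direct orthogonal sum $\{(x_1,x_2):x_1\in C_1,x_2\in C_2\}$. Two random closed convex cones are called isometric if they can be defined on the same probability space so that almost every pair of realizations is isometric. *)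

theory Defs
  imports "HOL-Probability.Probability"
begin

section \<open>Beta distributions\<close>

definition beta_const :: "nat \<Rightarrow> real \<Rightarrow> real" where
  "beta_const d \<beta> = Gamma (real d / 2 + \<beta> + 1) / (pi powr (real d / 2) * Gamma (\<beta> + 1))"

definition beta_density :: "real \<Rightarrow> 'a::euclidean_space \<Rightarrow> real" where
  "beta_density \<beta> x = beta_const DIM('a) \<beta> * (1 - (norm x)\<^sup>2) powr \<beta> * indicator {x. norm x < 1} x"

text \<open>The library has no surface measure. The uniform distribution on the unit sphere is the
  cone measure: the radial projection of the uniform distribution on the unit ball (the origin,
  where the projection is undefined, is a null set). In dimension one this is the uniform
  distribution on the two points \<open>-1\<close> and \<open>1\<close>.\<close>

definition uniform_sphere :: "'a::euclidean_space measure" where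
  "uniform_sphere = distr (uniform_measure lborel (ball 0 1)) borel (\<lambda>x. x /\<^sub>R norm x)"

text \<open>Meant for \<open>\<beta> \<ge> -1\<close> only.\<close>

definition beta_distr :: "real \<Rightarrow> 'a::euclidean_space measure" where
  "beta_distr \<beta> = (if \<beta> = -1 then uniform_sphere
     else density lborel (\<lambda>x. ennreal (beta_density \<beta> x)))"

lemma sets_beta_distr [simp, measurable_cong]: "sets (beta_distr \<beta>) = sets borel"
  by (simp add: beta_distr_def uniform_sphere_def)

lemma prob_space_uniform_sphere: "prob_space (uniform_sphere :: 'a::euclidean_space measure)"
  unfolding uniform_sphere_def
proof (rule prob_space.prob_space_distr)
  have "emeasure lborel (ball (0::'a) 1) \<noteq> 0"
    using content_ball_pos[of 1 "0::'a"] by (auto simp: measure_def)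
  then show "prob_space (uniform_measure lborel (ball (0::'a) 1))"
    by (intro prob_space_uniform_measure) (use emeasure_lborel_ball_finite[of "0::'a" 1] in auto)
qed simp


section \<open>Cones\<close>

definition pos :: "'i set \<Rightarrow> ('i \<Rightarrow> 'a::real_vector) \<Rightarrow> 'a set" where
  "pos I v = {\<Sum>i\<in>I. c i *\<^sub>R v i | c. \<forall>i\<in>I. 0 \<le> c i}"

text \<open>For a face \<open>F\<close> of \<open>P\<close>, the choice of \<open>v\<close> in the relative interior of \<open>F\<close> is immaterial,
  see \<open>tangent_cone_eq\<close> below.\<close>

definition tangent_cone :: "'a::euclidean_space set \<Rightarrow> 'a set \<Rightarrow> 'a set" where
  "tangent_cone F P = (if F face_of P
     then {x. \<exists>v\<in>rel_interior F. \<exists>\<epsilon>>0. v + \<epsilon> *\<^sub>R x \<in> P} else UNIV)"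

lemma tangent_cone_eq:
  fixes F P :: "'a::euclidean_space set"
  assumes "convex P" and F: "F face_of P" and v: "v \<in> rel_interior F"
  shows "tangent_cone F P = {x. \<exists>\<epsilon>>0. v + \<epsilon> *\<^sub>R x \<in> P}"
proof -
  have "\<exists>\<epsilon>>0. v + \<epsilon> *\<^sub>R x \<in> P"
    if w: "w \<in> rel_interior F" and e: "\<epsilon> > 0" "w + \<epsilon> *\<^sub>R x \<in> P" for w x \<epsilon>
  proof -
    have "convex F" "F \<subseteq> P" using F face_of_imp_convex face_of_imp_subset by blast+
    have "w \<in> F" using w rel_interior_subset by blast
    then obtain s where s: "s > 1" "(1 - s) *\<^sub>R w + s *\<^sub>R v \<in> F"
      using v convex_rel_interior_iff[OF \<open>convex F\<close>, of v] by auto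
    let ?u = "(1 - s) *\<^sub>R w + s *\<^sub>R v"
    have *: "inverse s + (1 - inverse s) = 1" "0 \<le> inverse s" "0 \<le> 1 - inverse s"
      using s by (auto simp: field_simps)
    have "inverse s *\<^sub>R ?u + (1 - inverse s) *\<^sub>R (w + \<epsilon> *\<^sub>R x) \<in> P"
      using convexD[OF \<open>convex P\<close>, of ?u "w + \<epsilon> *\<^sub>R x", OF _ e(2) *(2,3,1)] s \<open>F \<subseteq> P\<close> by blast
    moreover have "inverse s *\<^sub>R ?u + (1 - inverse s) *\<^sub>R (w + \<epsilon> *\<^sub>R x)
        = v + ((1 - inverse s) * \<epsilon>) *\<^sub>R x"
      using s by (simp add: algebra_simps)
    moreover have "(1 - inverse s) * \<epsilon> > 0" using s e by (simp add: field_simps)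
    ultimately show ?thesis by metis
  qed
  then show ?thesis using F v by (auto simp: tangent_cone_def)
qed

text \<open>Isometry through a linear isometry of the linear hulls. The linear map is defined on the
  whole ambient space, but its values off the span of \<open>C\<close> are irrelevant, so that cones in spaces
  of different dimensions can be compared.\<close>

definition isometric_cones :: "'a::euclidean_space set \<Rightarrow> 'b::euclidean_space set \<Rightarrow> bool" where
  "isometric_cones C D \<longleftrightarrow>
     (\<exists>f. linear f \<and> (\<forall>x\<in>span C. norm (f x) = norm x) \<and> f ` C = D)"


section \<open>Random closed convex cones\<close>

text \<open>The closed convex cones (with apex at the origin) with the \<open>\<sigma>\<close>-algebra generated by the
  events of hitting an open set; this is the Borel \<open>\<sigma>\<close>-algebra of the Fell topology.\<close>

definition cone_space :: "'a::euclidean_space set measure" where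
  "cone_space = sigma {C. closed C \<and> convex_cone C}
     ((\<lambda>U. {C. closed C \<and> convex_cone C \<and> C \<inter> U \<noteq> {}}) ` {U. open U})"

text \<open>The random cones \<open>C\<close> on \<open>M\<close> and \<open>D\<close> on \<open>N\<close> have copies \<open>C'\<close> and \<open>D'\<close> on a common probability
  space \<open>L\<close> that are almost surely isometric. HOL does not allow quantification over the type of
  the sample space of \<open>L\<close>, so it consists of pairs of sequences of vectors, which is large enough
  to carry any distribution on a standard Borel space.\<close>

definition isometric_random_cones ::
  "'w measure \<Rightarrow> ('w \<Rightarrow> 'a::euclidean_space set) \<Rightarrow> 'v measure \<Rightarrow> ('v \<Rightarrow> 'b::euclidean_space set) \<Rightarrow> bool"
  where
  "isometric_random_cones M C N D \<longleftrightarrow>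
     C \<in> measurable M cone_space \<and> D \<in> measurable N cone_space \<and>
     (\<exists>(L :: ((nat \<Rightarrow> 'a) \<times> (nat \<Rightarrow> 'b)) measure) C' D'.
        prob_space L \<and> C' \<in> measurable L cone_space \<and> D' \<in> measurable L cone_space \<and>
        distr L cone_space C' = distr M cone_space C \<and>
        distr L cone_space D' = distr N cone_space D \<and>
        (AE \<omega> in L. isometric_cones (C' \<omega>) (D' \<omega>)))"

text \<open>The distribution of a beta cone, for independent \<open>z\<close> and \<open>Z i\<close>, \<open>i \<in> I\<close>. The dimension is
  that of the type of vectors.\<close>

definition beta_cone :: "real \<Rightarrow> 'i set \<Rightarrow> ('i \<Rightarrow> real) \<Rightarrow> 'a::euclidean_space set measure" where
  "beta_cone \<beta> I \<beta>s = distr (beta_distr \<beta> \<Otimes>\<^sub>M (\<Pi>\<^sub>M i\<in>I. beta_distr (\<beta>s i))) cone_space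
     (\<lambda>(z, Z). pos I (\<lambda>i. Z i - z))"

lemma space_cone_space: "space cone_space = {C. closed C \<and> convex_cone C}"
  unfolding cone_space_def by (rule space_measure_of) auto

lemma closed_convex_cone_pos:
  fixes v :: "'i \<Rightarrow> 'a::euclidean_space"
  assumes I: "finite I"
  shows "closed (pos I v) \<and> convex_cone (pos I v)"
proof -
  have cc: "convex_cone (pos I v)"
    unfolding convex_cone_iff
  proof (intro conjI ballI allI impI)
    show "0 \<in> pos I v" unfolding pos_def by (auto intro!: exI[of _ "\<lambda>_. 0"])
  next
    fix x y assume "x \<in> pos I v" "y \<in> pos I v"
    then obtain c d where "x = (\<Sum>i\<in>I. c i *\<^sub>R v i)" "\<forall>i\<in>I. 0 \<le> c i"
      "y = (\<Sum>i\<in>I. d i *\<^sub>R v i)" "\<forall>i\<in>I. 0 \<le> d i" by (auto simp: pos_def)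
    then show "x + y \<in> pos I v" unfolding pos_def
      by (auto intro!: exI[of _ "\<lambda>i. c i + d i"] simp: scaleR_left_distrib sum.distrib)
  next
    fix x and t :: real assume "x \<in> pos I v" "0 \<le> t"
    then obtain c where "x = (\<Sum>i\<in>I. c i *\<^sub>R v i)" "\<forall>i\<in>I. 0 \<le> c i" by (auto simp: pos_def)
    then show "t *\<^sub>R x \<in> pos I v" unfolding pos_def using \<open>0 \<le> t\<close>
      by (auto intro!: exI[of _ "\<lambda>i. t * c i"] simp: scaleR_sum_right)
  qed
  have "v i \<in> pos I v" if "i \<in> I" for i
    unfolding pos_def using that I
    by (auto intro!: exI[of _ "\<lambda>j. if j = i then 1 else 0"] simp: if_distrib[of "\<lambda>c. c *\<^sub>R _"] cong: if_cong)
  then have "convex_cone hull (v ` I) \<subseteq> pos I v"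
    by (intro hull_minimal) (auto simp: cc)
  moreover have "pos I v \<subseteq> convex_cone hull (v ` I)"
  proof
    fix x assume "x \<in> pos I v"
    then obtain c where x: "x = (\<Sum>i\<in>I. c i *\<^sub>R v i)" and c: "\<forall>i\<in>I. 0 \<le> c i" by (auto simp: pos_def)
    have "(\<Sum>i\<in>J. c i *\<^sub>R v i) \<in> convex_cone hull (v ` I)" if "J \<subseteq> I" for J
      using finite_subset[OF that I] that
    proof (induction J rule: finite_induct)
      case empty then show ?case by (simp add: convex_cone_hull_contains_0)
    next
      case (insert j J)
      then have "c j *\<^sub>R v j \<in> convex_cone hull (v ` I)" using c
        by (intro convex_cone_hull_mul hull_inc) auto
      with insert show ?case by (simp add: convex_cone_hull_add)
    qed
    then show "x \<in> convex_cone hull (v ` I)" using x by blast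
  qed
  ultimately have "pos I v = convex_cone hull (v ` I)" by auto
  then show ?thesis using cc I by (metis polyhedron_convex_cone_hull finite_imageI polyhedron_imp_closed)
qed

text \<open>A beta cone is a random variable with values in \<open>cone_space\<close>.\<close>

lemma measurable_pos:
  fixes v :: "'w \<Rightarrow> 'i \<Rightarrow> 'a::euclidean_space"
  assumes I: "finite I" and v[measurable]: "\<And>i. i \<in> I \<Longrightarrow> (\<lambda>\<omega>. v \<omega> i) \<in> borel_measurable M"
  shows "(\<lambda>\<omega>. pos I (v \<omega>)) \<in> measurable M cone_space"
  unfolding cone_space_def
proof (rule measurable_measure_of)
  fix A :: "'a set set"
  assume "A \<in> (\<lambda>U. {C. closed C \<and> convex_cone C \<and> C \<inter> U \<noteq> {}}) ` {U. open U}"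
  then obtain U :: "'a set" where U: "open U" and A: "A = {C. closed C \<and> convex_cone C \<and> C \<inter> U \<noteq> {}}"
    by auto
  let ?Q = "PiE I (\<lambda>_. {q. 0 \<le> q \<and> q \<in> \<rat>}) :: ('i \<Rightarrow> real) set"
  have Q: "countable ?Q"
    by (rule countable_PiE[OF I]) (auto intro: countable_subset[OF _ countable_rat])
  have dense: "\<exists>q\<in>?Q. (\<Sum>i\<in>I. q i *\<^sub>R u i) \<in> U"
    if c: "\<forall>i\<in>I. 0 \<le> c i" and cU: "(\<Sum>i\<in>I. c i *\<^sub>R u i) \<in> U" for c u
  proof -
    have "\<exists>q. 0 \<le> q \<and> q \<in> \<rat> \<and> \<bar>q - c i\<bar> < inverse (real (Suc n))" if "i \<in> I" for i n
    proof -
      obtain r where "r \<in> \<rat>" "c i < r" "r < c i + inverse (real (Suc n))"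
        using Rats_dense_in_real[of "c i" "c i + inverse (real (Suc n))"] by auto
      then show ?thesis using c that by (intro exI[of _ r]) (force simp: abs_if)
    qed
    then obtain q where q: "\<And>i n. i \<in> I \<Longrightarrow> 0 \<le> q i n \<and> q i n \<in> \<rat> \<and> \<bar>q i n - c i\<bar> < inverse (real (Suc n))"
      by metis
    have lim: "(\<lambda>n. q i n) \<longlonglongrightarrow> c i" if "i \<in> I" for i
      using q[OF that] by (intro LIM_zero_cancel[of _ "c i"] Lim_null_comparison[OF _ LIMSEQ_inverse_real_of_nat])
        (auto intro!: always_eventually less_imp_le)
    have "(\<lambda>n. \<Sum>i\<in>I. q i n *\<^sub>R u i) \<longlonglongrightarrow> (\<Sum>i\<in>I. c i *\<^sub>R u i)"
      by (intro tendsto_sum tendsto_scaleR lim tendsto_const)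
    then have "\<forall>\<^sub>F n in sequentially. (\<Sum>i\<in>I. q i n *\<^sub>R u i) \<in> U"
      using U cU by (rule topological_tendstoD)
    then obtain n where "(\<Sum>i\<in>I. q i n *\<^sub>R u i) \<in> U" by (auto simp: eventually_sequentially)
    then show ?thesis using q by (intro bexI[of _ "restrict (\<lambda>i. q i n) I"]) auto
  qed
  have "(\<lambda>\<omega>. pos I (v \<omega>)) -` A \<inter> space M = {\<omega>\<in>space M. \<exists>q\<in>?Q. (\<Sum>i\<in>I. q i *\<^sub>R v \<omega> i) \<in> U}"
    (is "?l = ?r")
  proof
    show "?l \<subseteq> ?r"
    proof
      fix \<omega> assume "\<omega> \<in> ?l"
      then obtain c where "\<forall>i\<in>I. 0 \<le> c i" "(\<Sum>i\<in>I. c i *\<^sub>R v \<omega> i) \<in> U" "\<omega> \<in> space M"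
        unfolding A pos_def by auto
      then show "\<omega> \<in> ?r" using dense[of c "v \<omega>"] by simp
    qed
    show "?r \<subseteq> ?l"
    proof
      fix \<omega> assume "\<omega> \<in> ?r"
      then obtain q where q: "q \<in> ?Q" "(\<Sum>i\<in>I. q i *\<^sub>R v \<omega> i) \<in> U" and \<omega>: "\<omega> \<in> space M" by auto
      then have "(\<Sum>i\<in>I. q i *\<^sub>R v \<omega> i) \<in> pos I (v \<omega>)"
        unfolding pos_def by (auto simp: PiE_iff)
      then show "\<omega> \<in> ?l" using q \<omega> closed_convex_cone_pos[OF I, of "v \<omega>"] by (auto simp: A)
    qed
  qed
  also have "?r = (\<Union>q\<in>?Q. (\<lambda>\<omega>. \<Sum>i\<in>I. q i *\<^sub>R v \<omega> i) -` U \<inter> space M)"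
    by auto
  also have "\<dots> \<in> sets M"
    by (intro sets.countable_UN''[OF Q] measurable_sets[OF _ borel_open[OF U]] borel_measurable_sum
        borel_measurable_scaleR borel_measurable_const v)
  finally show "(\<lambda>\<omega>. pos I (v \<omega>)) -` A \<inter> space M \<in> sets M" .
qed (use closed_convex_cone_pos[OF I] in auto)

lemma measurable_beta_cone:
  assumes "finite I"
  shows "(\<lambda>(z, Z). pos I (\<lambda>i. Z i - z)) \<in> measurable
    (beta_distr \<beta> \<Otimes>\<^sub>M (\<Pi>\<^sub>M i\<in>I. beta_distr (\<beta>s i))) (cone_space :: 'a::euclidean_space set measure)"
  unfolding case_prod_beta by (rule measurable_pos[OF assms]) measurable

end

theory Submission
  imports Defs
begin

text \<open>Put \<open>\<gamma> = \<beta> + d / 2\<close>. The line through two independent beta points with parameters \<open>\<gamma>\<^sub>1\<close> and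
  \<open>\<gamma>\<^sub>2\<close> has a uniformly distributed direction \<open>u\<close>, and given \<open>u\<close> its point closest to the origin is
  distributed as the projection to the orthogonal complement of \<open>u\<close> of one beta point with parameter
  \<open>\<gamma>\<^sub>1 + \<gamma>\<^sub>2\<close>. For densities this follows from polar coordinates for the difference of the two points
  and from scaling along the line; the sphere, \<open>\<beta> = -1\<close>, is reached by weak limits in one variable at
  a time. Almost surely the tangent cone at \<open>F_K\<close> is the sum of the direction space of \<open>F_K\<close> and the
  positive hull of the vectors from a vertex of \<open>F_K\<close> to the other points; if \<open>F_K\<close> is not a face,
  general position makes this sum the whole space. So the vertices of \<open>F_K\<close> can be merged one by one
  into a single beta point, at the price of independent uniform directions \<open>u\<close>. Finally a product of
  Householder reflections, measurable in the directions, turns their span into a coordinate subspace,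
  and projecting beta points along this subspace preserves \<open>\<gamma>\<close>.\<close>


section \<open>Lebesgue integrals\<close>

text \<open>The parameters \<open>\<gamma>\<close> add because of a count of exponents. On a line at
  squared distance \<open>1 - S\<close> from the origin all lengths scale with
  \<open>sqrt S\<close>. For two points, their difference carries d dimensions and the position
  along the line one more, so the fibre integral is a multiple of \<open>S\<close> to the power
  \<open>\<beta>1 + \<beta>2 + (d + 1) / 2\<close>; for one point the power is
  \<open>\<beta>' + 1 / 2\<close>. Equality means
  \<open>\<beta>' = \<beta>1 + \<beta>2 + d / 2\<close>. The factors are never computed, since both
  sides have total mass 1. The limits towards the sphere go one variable at a time because the
  direction \<open>sgn (y - x)\<close> is discontinuous at \<open>x = y\<close>, and only
  integration against an atomless law removes this. That needs d at least 2, which is no loss: in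
  dimension one \<open>k = 1\<close> and nothing is merged. The directions are independent of all
  points, so the alignment may be treated as a fixed orthogonal map; by rotational invariance the
  law of the projected points is the same for all directions. Hence both cones of the coupling can
  be functions of one sample point.\<close>

lemma nn_integral_lborel_scaleR:
  fixes f :: "'a::euclidean_space \<Rightarrow> ennreal"
  assumes [measurable]: "f \<in> borel_measurable borel" and r: "r > 0"
  shows "(\<integral>\<^sup>+x. f x \<partial>lborel) = ennreal (r ^ DIM('a)) * (\<integral>\<^sup>+x. f (r *\<^sub>R x) \<partial>lborel)"
  using r by (subst lborel_affine[of r 0])
    (auto simp: nn_integral_density nn_integral_distr nn_integral_cmult)

lemma nn_integral_lborel_translate:
  fixes f :: "'a::euclidean_space \<Rightarrow> ennreal"
  assumes [measurable]: "f \<in> borel_measurable borel"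
  shows "(\<integral>\<^sup>+x. f (c + x) \<partial>lborel) = (\<integral>\<^sup>+x. f x \<partial>lborel)"
  by (subst (2) lborel_distr_plus[of c, symmetric]) (simp add: nn_integral_distr)

lemma AE_lborel_neq: "AE x in lborel. x \<noteq> (c :: 'a::euclidean_space)"
  using AE_lborel_singleton by blast

lemma emeasure_unit_ball:
  "emeasure lborel (ball (0::'a::euclidean_space) 1) = ennreal (unit_ball_vol (DIM('a)))"
  using emeasure_ball[of 1 "0::'a"] by simp

lemma nn_integral_uniform_sphere:
  fixes f :: "'a::euclidean_space \<Rightarrow> ennreal"
  assumes [measurable]: "f \<in> borel_measurable borel"
  shows "(\<integral>\<^sup>+u. f u \<partial>uniform_sphere) =
    (\<integral>\<^sup>+x. f (x /\<^sub>R norm x) * indicator (ball 0 1) x \<partial>lborel) / ennreal (unit_ball_vol (DIM('a)))"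
  unfolding uniform_sphere_def
  by (subst nn_integral_distr, simp_all) (subst nn_integral_uniform_measure, auto simp: emeasure_unit_ball)

lemma AE_uniform_sphere: "AE u in uniform_sphere. norm (u::'a::euclidean_space) = 1"
proof -
  have "AE x in uniform_measure lborel (ball (0::'a) 1). norm (x /\<^sub>R norm x) = 1"
    using AE_lborel_neq[of "0::'a"]
    by (intro AE_uniform_measureI) (auto elim!: eventually_mono)
  then show ?thesis unfolding uniform_sphere_def by (subst AE_distr_iff) auto
qed

lemma sets_uniform_sphere [simp, measurable_cong]: "sets uniform_sphere = sets borel"
  by (simp add: uniform_sphere_def)

interpretation uniform_sphere: prob_space "uniform_sphere :: 'a::euclidean_space measure"
  by (rule prob_space_uniform_sphere)

text \<open>Writing \<open>uniform_sphere\<close> as an average over the ball, the right-hand side is brought to the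
  form \<open>\<kappa> * (\<integral>\<^sup>+x. g x \<partial>lborel)\<close> by scaling alone; the constant is found by inserting the
  indicator of the ball.\<close>

lemma nn_integral_polar:
  fixes g :: "'a::euclidean_space \<Rightarrow> ennreal"
  assumes g[measurable]: "g \<in> borel_measurable borel"
  shows "(\<integral>\<^sup>+x. g x \<partial>lborel) = (\<integral>\<^sup>+u. (\<integral>\<^sup>+x. g (norm (x::'a) *\<^sub>R u) \<partial>lborel) \<partial>uniform_sphere)"
proof -
  let ?d = "DIM('a)"
  define V where "V = ennreal (unit_ball_vol (real ?d))"
  \<comment> \<open>Scaling \<open>x\<close> by \<open>norm v\<close>, then \<open>v\<close> by
    \<open>1 / norm x\<close>, then \<open>x\<close> by \<open>norm y\<close> leaves
    \<open>h y\<close> times this integral; the power \<open>2 * d\<close> collects the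
    Jacobians.\<close>
  define \<kappa> where "\<kappa> = (\<integral>\<^sup>+x. ennreal (1 / norm (x::'a) ^ (2 * ?d)) * indicator {x. 1 < norm x} x \<partial>lborel)"
  have V: "V \<noteq> 0" "V \<noteq> \<infinity>" using unit_ball_vol_pos[of "real ?d"] by (auto simp: V_def simp del: unit_ball_vol_pos)
  have *: "(\<integral>\<^sup>+u. (\<integral>\<^sup>+x. h (norm (x::'a) *\<^sub>R u) \<partial>lborel) \<partial>uniform_sphere) = (\<integral>\<^sup>+x. h x \<partial>lborel) * \<kappa> / V"
    if h[measurable]: "h \<in> borel_measurable borel" for h :: "'a \<Rightarrow> ennreal"
  proof -
    have "(\<integral>\<^sup>+u. (\<integral>\<^sup>+x. h (norm (x::'a) *\<^sub>R u) \<partial>lborel) \<partial>uniform_sphere)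
      = (\<integral>\<^sup>+v. (\<integral>\<^sup>+x. h (norm (x::'a) *\<^sub>R (v /\<^sub>R norm v)) \<partial>lborel) * indicator (ball 0 1) v \<partial>lborel) / V"
      unfolding V_def by (rule nn_integral_uniform_sphere[where f="\<lambda>u. \<integral>\<^sup>+x. h (norm (x::'a) *\<^sub>R u) \<partial>lborel"]) measurable
    also have "(\<integral>\<^sup>+v. (\<integral>\<^sup>+x. h (norm (x::'a) *\<^sub>R (v /\<^sub>R norm v)) \<partial>lborel) * indicator (ball 0 1) v \<partial>lborel)
      = (\<integral>\<^sup>+v. (\<integral>\<^sup>+x. ennreal (norm v ^ ?d) * indicator {v. norm v < 1} v * h (norm (x::'a) *\<^sub>R v) \<partial>lborel) \<partial>lborel)"
    proof (intro nn_integral_cong_AE eventually_mono[OF AE_lborel_neq[of 0]])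
      fix v :: 'a assume v: "v \<noteq> 0"
      have "(\<integral>\<^sup>+x. h (norm (x::'a) *\<^sub>R (v /\<^sub>R norm v)) \<partial>lborel)
         = ennreal (norm v ^ ?d) * (\<integral>\<^sup>+x. h (norm (norm v *\<^sub>R (x::'a)) *\<^sub>R (v /\<^sub>R norm v)) \<partial>lborel)"
        using v by (intro nn_integral_lborel_scaleR[where f="\<lambda>x. h (norm (x::'a) *\<^sub>R (v /\<^sub>R norm v))"]) auto
      also have "(\<lambda>x::'a. h (norm (norm v *\<^sub>R x) *\<^sub>R (v /\<^sub>R norm v))) = (\<lambda>x. h (norm (x::'a) *\<^sub>R v))"
        using v by (intro ext arg_cong[where f=h]) simp
      finally show "(\<integral>\<^sup>+x. h (norm (x::'a) *\<^sub>R (v /\<^sub>R norm v)) \<partial>lborel) * indicator (ball 0 1) v =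
        (\<integral>\<^sup>+x. ennreal (norm v ^ ?d) * indicator {v. norm v < 1} v * h (norm (x::'a) *\<^sub>R v) \<partial>lborel)"
        by (simp add: nn_integral_cmult mult.assoc ball_def) (simp add: mult_ac)
    qed
    also have "\<dots> = (\<integral>\<^sup>+x. (\<integral>\<^sup>+v. ennreal (norm v ^ ?d) * indicator {v. norm v < 1} v * h (norm (x::'a) *\<^sub>R v) \<partial>lborel) \<partial>lborel)"
      by (intro lborel_pair.Fubini') measurable
    also have "\<dots> = (\<integral>\<^sup>+x. (\<integral>\<^sup>+y. ennreal (norm y ^ ?d / norm x ^ (2 * ?d)) * indicator {x'. norm y < norm x'} x * h y \<partial>lborel) \<partial>(lborel :: 'a measure))"
    proof (rule nn_integral_cong_AE, rule eventually_mono[OF AE_lborel_neq[of 0]])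
      fix x :: 'a assume x: "x \<noteq> 0"
      have "(\<integral>\<^sup>+y. ennreal (norm y ^ ?d / norm x ^ (2 * ?d)) * indicator {x'. norm y < norm x'} x * h y \<partial>lborel)
        = ennreal (norm x ^ ?d) * (\<integral>\<^sup>+y. ennreal (norm (norm x *\<^sub>R (y::'a)) ^ ?d / norm x ^ (2 * ?d)) *
           indicator {x'. norm (norm x *\<^sub>R y) < norm x'} x * h (norm x *\<^sub>R y) \<partial>lborel)"
        using x by (intro nn_integral_lborel_scaleR[where
          f="\<lambda>y. ennreal (norm y ^ ?d / norm x ^ (2 * ?d)) * indicator {x'. norm y < norm x'} x * h y"]) auto
      also have "\<dots> = (\<integral>\<^sup>+y. ennreal (norm x ^ ?d) * (ennreal (norm (norm x *\<^sub>R (y::'a)) ^ ?d / norm x ^ (2 * ?d)) *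
           indicator {x'. norm (norm x *\<^sub>R y) < norm x'} x * h (norm x *\<^sub>R y)) \<partial>lborel)"
        by (rule nn_integral_cmult[symmetric]) measurable
      also have "\<dots> = (\<integral>\<^sup>+v. ennreal (norm v ^ ?d) * indicator {v. norm v < 1} v * h (norm (x::'a) *\<^sub>R v) \<partial>lborel)"
      proof (intro nn_integral_cong)
        fix y :: 'a
        have "ennreal (norm x ^ ?d) * ennreal (norm (norm x *\<^sub>R y) ^ ?d / norm x ^ (2 * ?d)) = ennreal (norm y ^ ?d)"
          using x by (simp add: ennreal_mult[symmetric] power_mult_distrib mult_2 power_add)
        then show "ennreal (norm x ^ ?d) * (ennreal (norm (norm x *\<^sub>R (y::'a)) ^ ?d / norm x ^ (2 * ?d)) *
           indicator {x'. norm (norm x *\<^sub>R y) < norm x'} x * h (norm x *\<^sub>R y))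
           = ennreal (norm y ^ ?d) * indicator {v. norm v < 1} y * h (norm x *\<^sub>R y)"
          using x by (auto simp: indicator_def mult.assoc[symmetric])
      qed
      finally show "(\<integral>\<^sup>+v. ennreal (norm v ^ ?d) * indicator {v. norm v < 1} v * h (norm (x::'a) *\<^sub>R v) \<partial>lborel) =
         (\<integral>\<^sup>+y. ennreal (norm y ^ ?d / norm x ^ (2 * ?d)) * indicator {x'. norm y < norm x'} x * h y \<partial>lborel)" ..
    qed
    also have "\<dots> = (\<integral>\<^sup>+y. (\<integral>\<^sup>+x. ennreal (norm y ^ ?d / norm x ^ (2 * ?d)) * indicator {x'. norm y < norm x'} x * h y \<partial>(lborel :: 'a measure)) \<partial>lborel)"
      by (intro lborel_pair.Fubini') measurable
    also have "\<dots> = (\<integral>\<^sup>+y. h y * \<kappa> \<partial>lborel)"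
    proof (intro nn_integral_cong_AE eventually_mono[OF AE_lborel_neq[of 0]])
      fix y :: 'a assume y: "y \<noteq> 0"
      have "(\<integral>\<^sup>+x. ennreal (norm y ^ ?d / norm x ^ (2 * ?d)) * indicator {x'. norm y < norm x'} x * h y \<partial>(lborel :: 'a measure))
        = ennreal (norm y ^ ?d) * (\<integral>\<^sup>+x. ennreal (norm y ^ ?d / norm (norm y *\<^sub>R x) ^ (2 * ?d)) * indicator {x. norm y < norm x} (norm y *\<^sub>R x) * h y \<partial>(lborel :: 'a measure))"
        using y by (intro nn_integral_lborel_scaleR[where
          f="\<lambda>x. ennreal (norm y ^ ?d / norm x ^ (2 * ?d)) * indicator {x'. norm y < norm x'} x * h y"]) auto
      also have "\<dots> = (\<integral>\<^sup>+x. ennreal (norm y ^ ?d) * (ennreal (norm y ^ ?d / norm (norm y *\<^sub>R x) ^ (2 * ?d)) * indicator {x. norm y < norm x} (norm y *\<^sub>R x) * h y) \<partial>(lborel :: 'a measure))"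
        by (rule nn_integral_cmult[symmetric]) measurable
      also have "\<dots> = (\<integral>\<^sup>+x. h y * (ennreal (1 / norm (x::'a) ^ (2 * ?d)) * indicator {x. 1 < norm x} x) \<partial>lborel)"
      proof (intro nn_integral_cong)
        fix x :: 'a
        have E: "ennreal (norm y ^ ?d) * ennreal (norm y ^ ?d / norm (norm y *\<^sub>R x) ^ (2 * ?d)) = ennreal (1 / norm (x::'a) ^ (2 * ?d))"
          using y by (simp add: ennreal_mult[symmetric] power_mult_distrib mult_2 power_add)
        have I: "indicator {x. norm y < norm x} (norm y *\<^sub>R x) = (indicator {x. 1 < norm x} x :: ennreal)"
          using y by (auto simp: indicator_def)
        show "ennreal (norm y ^ ?d) * (ennreal (norm y ^ ?d / norm (norm y *\<^sub>R x) ^ (2 * ?d)) * indicator {x. norm y < norm x} (norm y *\<^sub>R x) * h y)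
         = h y * (ennreal (1 / norm (x::'a) ^ (2 * ?d)) * indicator {x. 1 < norm x} x)"
          unfolding I E[symmetric] by (simp only: mult_ac)
      qed
      also have "\<dots> = h y * \<kappa>" unfolding \<kappa>_def by (rule nn_integral_cmult) measurable
      finally show "(\<integral>\<^sup>+x. ennreal (norm y ^ ?d / norm x ^ (2 * ?d)) * indicator {x'. norm y < norm x'} x * h y \<partial>(lborel :: 'a measure)) = h y * \<kappa>" .
    qed
    also have "\<dots> = (\<integral>\<^sup>+x. h x \<partial>lborel) * \<kappa>" by (simp add: nn_integral_multc)
    finally show ?thesis .
  qed
  have "V = (\<integral>\<^sup>+x. indicator (ball 0 1) (x::'a) \<partial>lborel)"
    unfolding V_def by (subst nn_integral_indicator) (auto simp: emeasure_unit_ball)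
  also have "\<dots> = (\<integral>\<^sup>+u. (\<integral>\<^sup>+x. indicator (ball (0::'a) 1) (norm (x::'a) *\<^sub>R u) \<partial>lborel) \<partial>uniform_sphere)"
    (is "?l = ?r")
  proof -
    have "?r = (\<integral>\<^sup>+u. ?l \<partial>(uniform_sphere :: 'a measure))"
      by (rule nn_integral_cong_AE, rule eventually_mono[OF AE_uniform_sphere], rule nn_integral_cong)
        (auto simp: indicator_def)
    then show ?thesis using uniform_sphere.emeasure_space_1[where ?'a='a] by simp
  qed
  also have "\<dots> = (\<integral>\<^sup>+x. indicator (ball (0::'a) 1) x \<partial>lborel) * \<kappa> / V"
    by (rule *[OF borel_measurable_indicator]) simp
  also have "(\<integral>\<^sup>+x. indicator (ball (0::'a) 1) x \<partial>lborel) = V"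
    unfolding V_def by (subst nn_integral_indicator) (auto simp: emeasure_unit_ball)
  finally have "V = \<kappa> * V / V" by (simp only: mult.commute)
  also have "\<dots> = \<kappa>" using V by (intro ennreal_mult_divide_eq) auto
  finally have "\<kappa> = V" ..
  with *[OF g] V show ?thesis by (simp add: ennreal_mult_divide_eq)
qed

section \<open>Normalization of the beta densities\<close>

text \<open>The condition \<open>norm x < 1\<close> of the density becomes positivity of the
  argument, so that scaling treats support and power at once.\<close>

definition rpow :: "real \<Rightarrow> real \<Rightarrow> real" where
  "rpow \<beta> t = (if 0 < t then t powr \<beta> else 0)"

lemma rpow_nonneg [simp]: "0 \<le> rpow \<beta> t"
  by (simp add: rpow_def)

lemma measurable_rpow [measurable]: "rpow \<beta> \<in> borel_measurable borel"
  unfolding rpow_def by measurable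

lemma rpow_mult: "s > 0 \<Longrightarrow> rpow \<beta> (s * t) = s powr \<beta> * rpow \<beta> t"
  by (auto simp: rpow_def powr_mult zero_less_mult_iff)

lemma beta_density_eq_rpow:
  "beta_density \<beta> (x::'a::euclidean_space) = beta_const DIM('a) \<beta> * rpow \<beta> (1 - (norm x)\<^sup>2)"
  by (simp add: beta_density_def rpow_def indicator_def abs_square_less_1)

lemma nn_integral_Gamma:
  assumes "s > 0"
  shows "(\<integral>\<^sup>+t. ennreal (exp (- t) * rpow (s - 1) t) \<partial>lborel) = ennreal (Gamma s)"
  unfolding Gamma_conv_nn_integral_real[OF assms]
  by (intro nn_integral_cong) (auto simp: rpow_def exp_minus field_simps indicator_def)

text \<open>Integrate \<open>exp (- \<bar>x\<bar>\<^sup>2 - t) * t powr \<beta>\<close> over \<open>x\<close> and \<open>t > 0\<close>, once as a product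
  and once with \<open>\<rho> = \<bar>x\<bar>\<^sup>2 + t\<close> in place of \<open>t\<close>.\<close>

lemma nn_integral_rpow_Gauss:
  assumes \<beta>: "\<beta> > -1"
  shows "(\<integral>\<^sup>+x. ennreal (rpow \<beta> (1 - (norm (x::'a::euclidean_space))\<^sup>2)) \<partial>lborel) * ennreal (Gamma (DIM('a) / 2 + \<beta> + 1))
    = (\<integral>\<^sup>+x. ennreal (exp (- (norm (x::'a))\<^sup>2)) \<partial>lborel) * ennreal (Gamma (\<beta> + 1))"
    (is "?I * _ = ?J * _")
proof -
  have "?J * ennreal (Gamma (\<beta> + 1)) =
      (\<integral>\<^sup>+x. ennreal (exp (- (norm (x::'a))\<^sup>2)) * (\<integral>\<^sup>+t. ennreal (exp (- t) * rpow \<beta> t) \<partial>lborel) \<partial>lborel)"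
    using nn_integral_Gamma[of "\<beta> + 1"] \<beta> by (simp add: nn_integral_multc)
  also have "\<dots> = (\<integral>\<^sup>+x. (\<integral>\<^sup>+t. ennreal (exp (- ((norm (x::'a))\<^sup>2 + t)) * rpow \<beta> ((norm x)\<^sup>2 + t - (norm x)\<^sup>2)) \<partial>lborel) \<partial>lborel)"
    by (subst nn_integral_cmult[symmetric]) (auto simp: ennreal_mult[symmetric] exp_add exp_diff exp_minus field_simps intro!: nn_integral_cong)
  also have "\<dots> = (\<integral>\<^sup>+x. (\<integral>\<^sup>+t. ennreal (exp (- t) * rpow \<beta> (t - (norm (x::'a))\<^sup>2)) \<partial>lborel) \<partial>lborel)"
    by (intro nn_integral_cong nn_integral_lborel_translate[where f="\<lambda>t. ennreal (exp (- t) * rpow \<beta> (t - _))"]) measurable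
  also have "\<dots> = (\<integral>\<^sup>+t. (\<integral>\<^sup>+x. ennreal (exp (- t) * rpow \<beta> (t - (norm (x::'a))\<^sup>2)) \<partial>lborel) \<partial>lborel)"
    by (intro lborel_pair.Fubini') measurable
  also have "\<dots> = (\<integral>\<^sup>+t. ennreal (exp (- t) * rpow (DIM('a) / 2 + \<beta>) t) * ?I \<partial>lborel)"
  proof (intro nn_integral_cong)
    fix t :: real
    show "(\<integral>\<^sup>+x. ennreal (exp (- t) * rpow \<beta> (t - (norm (x::'a))\<^sup>2)) \<partial>lborel) = ennreal (exp (- t) * rpow (DIM('a) / 2 + \<beta>) t) * ?I"
    proof (cases "t > 0")
      \<comment> \<open>Scaling \<open>x\<close> by \<open>sqrt t\<close> contributes the
        \<open>d / 2\<close> of the new exponent.\<close>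
      case True
      have "(\<integral>\<^sup>+x. ennreal (exp (- t) * rpow \<beta> (t - (norm (x::'a))\<^sup>2)) \<partial>lborel) =
        ennreal (sqrt t ^ DIM('a)) * (\<integral>\<^sup>+x. ennreal (exp (- t) * rpow \<beta> (t - (norm (sqrt t *\<^sub>R (x::'a)))\<^sup>2)) \<partial>lborel)"
        using True by (intro nn_integral_lborel_scaleR) auto
      also have "\<dots> = (\<integral>\<^sup>+x. ennreal (sqrt t ^ DIM('a)) * ennreal (exp (- t) * rpow \<beta> (t - (norm (sqrt t *\<^sub>R (x::'a)))\<^sup>2)) \<partial>lborel)"
        by (rule nn_integral_cmult[symmetric]) measurable
      also have "\<dots> = (\<integral>\<^sup>+x. ennreal (exp (- t) * rpow (DIM('a) / 2 + \<beta>) t) * ennreal (rpow \<beta> (1 - (norm (x::'a))\<^sup>2)) \<partial>lborel)"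
      proof (intro nn_integral_cong)
        fix x :: 'a
        have "t - (norm (sqrt t *\<^sub>R x))\<^sup>2 = t * (1 - (norm x)\<^sup>2)"
          using True by (simp add: power_mult_distrib algebra_simps)
        then have "rpow \<beta> (t - (norm (sqrt t *\<^sub>R x))\<^sup>2) = t powr \<beta> * rpow \<beta> (1 - (norm x)\<^sup>2)"
          by (simp add: rpow_mult[OF True])
        moreover have "sqrt t ^ DIM('a) = t powr (DIM('a) / 2)"
          using True by (simp add: powr_half_sqrt[symmetric] powr_realpow[symmetric] powr_powr)
        ultimately show "ennreal (sqrt t ^ DIM('a)) * ennreal (exp (- t) * rpow \<beta> (t - (norm (sqrt t *\<^sub>R (x::'a)))\<^sup>2))
          = ennreal (exp (- t) * rpow (DIM('a) / 2 + \<beta>) t) * ennreal (rpow \<beta> (1 - (norm (x::'a))\<^sup>2))"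
          using True by (simp add: ennreal_mult[symmetric] rpow_def[of "_ + _"] powr_add mult_ac)
      qed
      also have "\<dots> = ennreal (exp (- t) * rpow (DIM('a) / 2 + \<beta>) t) * ?I"
        by (rule nn_integral_cmult) measurable
      finally show ?thesis .
    next
      case False
      have "rpow \<beta> (t - (norm (x::'a))\<^sup>2) = 0" for x
        using False zero_le_power2[of "norm x"] unfolding rpow_def by (smt (verit))
      then show ?thesis using False by (simp add: rpow_def)
    qed
  qed
  also have "\<dots> = ?I * ennreal (Gamma (DIM('a) / 2 + \<beta> + 1))"
    using nn_integral_Gamma[of "DIM('a) / 2 + \<beta> + 1"] \<beta> by (simp add: nn_integral_multc nn_integral_cmult mult.commute add_pos_nonneg)
  finally show ?thesis ..
qed

lemma beta_const_pos: "\<beta> > -1 \<Longrightarrow> beta_const d \<beta> > 0"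
  unfolding beta_const_def by (intro divide_pos_pos mult_pos_pos Gamma_real_pos) auto

text \<open>For exponent 0 the integral of \<open>rpow\<close> is the volume of the unit ball, so
  \<open>nn_integral_rpow_Gauss\<close> gives the Gaussian integral as
  \<open>pi powr (d / 2)\<close>; the same identity then turns this into the integral for every
  \<open>\<beta>\<close>.\<close>

lemma nn_integral_beta_density:
  assumes \<beta>: "\<beta> > -1"
  shows "(\<integral>\<^sup>+x. ennreal (beta_density \<beta> (x::'a::euclidean_space)) \<partial>lborel) = 1"
proof -
  let ?d = "real DIM('a)"
  let ?I = "\<lambda>\<beta>. \<integral>\<^sup>+x. ennreal (rpow \<beta> (1 - (norm (x::'a))\<^sup>2)) \<partial>lborel"
  let ?J = "\<integral>\<^sup>+x. ennreal (exp (- (norm (x::'a))\<^sup>2)) \<partial>lborel"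
  have "?I 0 = (\<integral>\<^sup>+x. indicator (ball (0::'a) 1) x \<partial>lborel)"
    by (intro nn_integral_cong) (auto simp: rpow_def indicator_def abs_square_less_1 abs_square_eq_1)
  also have "\<dots> = ennreal (unit_ball_vol ?d)" using emeasure_unit_ball[where ?'a='a] by simp
  finally have "?J = ennreal (unit_ball_vol ?d) * ennreal (Gamma (?d / 2 + 1))"
    using nn_integral_rpow_Gauss[of 0, where ?'a='a] by simp
  also have "\<dots> = ennreal (pi powr (?d / 2))"
    using Gamma_real_pos[of "?d / 2 + 1"]
    by (simp add: ennreal_mult[symmetric] unit_ball_vol_def less_imp_neq[OF Gamma_real_pos, symmetric])
  finally have "?I \<beta> * ennreal (Gamma (?d / 2 + \<beta> + 1)) = ennreal (pi powr (?d / 2) * Gamma (\<beta> + 1))"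
    using nn_integral_rpow_Gauss[OF \<beta>, where ?'a='a] \<beta> by (simp add: ennreal_mult[symmetric])
  then have "ennreal (1 / (pi powr (?d / 2) * Gamma (\<beta> + 1))) * (?I \<beta> * ennreal (Gamma (?d / 2 + \<beta> + 1))) = 1"
    using less_imp_neq[OF Gamma_real_pos[of "\<beta> + 1"], symmetric] Gamma_real_pos[of "\<beta> + 1"] \<beta>
    by (simp add: ennreal_mult[symmetric])
  moreover have "ennreal (1 / (pi powr (?d / 2) * Gamma (\<beta> + 1))) * ennreal (Gamma (?d / 2 + \<beta> + 1)) = ennreal (beta_const DIM('a) \<beta>)"
    using Gamma_real_pos[of "\<beta> + 1"] Gamma_real_pos[of "?d / 2 + \<beta> + 1"] \<beta>
    by (simp add: ennreal_mult[symmetric] beta_const_def add_pos_nonneg)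
  ultimately have "ennreal (beta_const DIM('a) \<beta>) * ?I \<beta> = 1" by (metis mult.assoc mult.commute)
  then show ?thesis
    using beta_const_pos[OF \<beta>, of "DIM('a)"]
    by (simp add: beta_density_eq_rpow ennreal_mult nn_integral_cmult)
qed

lemma measurable_beta_density [measurable]: "beta_density \<beta> \<in> borel_measurable borel"
  unfolding beta_density_eq_rpow by measurable

lemma beta_distr_density:
  "\<beta> > -1 \<Longrightarrow> beta_distr \<beta> = density lborel (\<lambda>x. ennreal (beta_density \<beta> (x::'a::euclidean_space)))"
  by (simp add: beta_distr_def)

lemma space_beta_distr [simp]: "space (beta_distr \<beta>) = UNIV"
  using sets_eq_imp_space_eq[OF sets_beta_distr] by simp

lemma prob_space_beta_distr:
  assumes "\<beta> \<ge> -1"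
  shows "prob_space (beta_distr \<beta> :: 'a::euclidean_space measure)"
proof (cases "\<beta> = -1")
  case True then show ?thesis by (simp add: beta_distr_def uniform_sphere.prob_space_axioms)
next
  case False
  with assms show ?thesis
    by (intro prob_spaceI) (simp add: beta_distr_density emeasure_density nn_integral_beta_density)
qed

lemma nn_integral_beta_distr:
  assumes "\<beta> > -1" and [measurable]: "f \<in> borel_measurable borel"
  shows "(\<integral>\<^sup>+x. f x \<partial>beta_distr \<beta>) = (\<integral>\<^sup>+x. ennreal (beta_density \<beta> (x::'a::euclidean_space)) * f x \<partial>lborel)"
  using assms(1) by (simp add: beta_distr_density nn_integral_density)

section \<open>The line through two beta points\<close>

definition orth :: "'a::real_inner \<Rightarrow> 'a \<Rightarrow> 'a" where
  "orth u x = x - (x \<bullet> u) *\<^sub>R u"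

lemma measurable_orth [measurable (raw)]:
  fixes f g :: "'w \<Rightarrow> 'a::euclidean_space"
  assumes [measurable]: "f \<in> borel_measurable M" "g \<in> borel_measurable M"
  shows "(\<lambda>\<omega>. orth (f \<omega>) (g \<omega>)) \<in> borel_measurable M"
  unfolding orth_def by measurable

lemma measurable_sgn [measurable (raw)]:
  fixes f :: "'w \<Rightarrow> 'a::euclidean_space"
  assumes [measurable]: "f \<in> borel_measurable M"
  shows "(\<lambda>\<omega>. sgn (f \<omega>)) \<in> borel_measurable M"
  unfolding sgn_div_norm by measurable

lemma orth_add_scaleR [simp]: "norm u = 1 \<Longrightarrow> orth u (x + t *\<^sub>R u) = orth u x"
  by (simp add: orth_def algebra_simps norm_eq_1)

lemma inner_orth: "norm u = 1 \<Longrightarrow> orth u x \<bullet> u = 0"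
  by (simp add: orth_def algebra_simps norm_eq_1)

lemma norm_orth_add:
  assumes "norm u = 1" shows "(norm (orth u x + t *\<^sub>R u))\<^sup>2 = (norm (orth u x))\<^sup>2 + t\<^sup>2"
  using inner_orth[OF assms, of x] assms
  by (subst norm_add_Pythagorean) (auto simp: orthogonal_def)

text \<open>There is no Lebesgue measure on the hyperplane orthogonal to \<open>u\<close>; Lebesgue measure on the
  slab \<open>0 \<le> x \<bullet> u < 1\<close> takes its place.\<close>

lemma nn_integral_orth:
  fixes u :: "'a::euclidean_space" and f H :: "'a \<Rightarrow> ennreal"
  assumes u: "norm u = 1" and [measurable]: "f \<in> borel_measurable borel" "H \<in> borel_measurable borel"
  shows "(\<integral>\<^sup>+x. H (orth u x) * f x \<partial>lborel) =
    (\<integral>\<^sup>+x. H (orth u x) * indicator {0..<1} (x \<bullet> u) * (\<integral>\<^sup>+t. f (orth u x + t *\<^sub>R u) \<partial>lborel) \<partial>lborel)"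
proof -
  have "(\<integral>\<^sup>+x. H (orth u x) * indicator {0..<1} (x \<bullet> u) * (\<integral>\<^sup>+t. f (orth u x + t *\<^sub>R u) \<partial>lborel) \<partial>lborel)
    = (\<integral>\<^sup>+x. (\<integral>\<^sup>+t. H (orth u x) * indicator {0..<1} (x \<bullet> u) * f (x + t *\<^sub>R u) \<partial>lborel) \<partial>lborel)"
  proof (rule nn_integral_cong)
    \<comment> \<open>The inner integral runs over the whole line, so its origin may be moved from
      \<open>orth u x\<close> to \<open>x\<close>.\<close>
    fix x :: 'a
    have "(\<integral>\<^sup>+t. f (orth u x + t *\<^sub>R u) \<partial>lborel) = (\<integral>\<^sup>+t. f (orth u x + (x \<bullet> u + t) *\<^sub>R u) \<partial>lborel)"
      by (rule nn_integral_lborel_translate[symmetric]) measurable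
    also have "\<dots> = (\<integral>\<^sup>+t. f (x + t *\<^sub>R u) \<partial>lborel)"
      by (simp add: orth_def algebra_simps)
    finally show "H (orth u x) * indicator {0..<1} (x \<bullet> u) * (\<integral>\<^sup>+t. f (orth u x + t *\<^sub>R u) \<partial>lborel)
      = (\<integral>\<^sup>+t. H (orth u x) * indicator {0..<1} (x \<bullet> u) * f (x + t *\<^sub>R u) \<partial>lborel)"
      by (simp add: nn_integral_cmult)
  qed
  also have "\<dots> = (\<integral>\<^sup>+t. (\<integral>\<^sup>+x. H (orth u x) * indicator {0..<1} (x \<bullet> u) * f (x + t *\<^sub>R u) \<partial>lborel) \<partial>lborel)"
    by (intro lborel_pair.Fubini') measurable
  also have "\<dots> = (\<integral>\<^sup>+t. (\<integral>\<^sup>+x. H (orth u x) * indicator {0..<1} (x \<bullet> u - t) * f x \<partial>lborel) \<partial>lborel)"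
  proof (rule nn_integral_cong)
    fix t :: real
    have "(\<integral>\<^sup>+x. H (orth u x) * indicator {0..<1} (x \<bullet> u - t) * f x \<partial>lborel)
      = (\<integral>\<^sup>+x. H (orth u (t *\<^sub>R u + x)) * indicator {0..<1} ((t *\<^sub>R u + x) \<bullet> u - t) * f (t *\<^sub>R u + x) \<partial>lborel)"
      by (rule nn_integral_lborel_translate[symmetric]) measurable
    also have "\<dots> = (\<integral>\<^sup>+x. H (orth u x) * indicator {0..<1} (x \<bullet> u) * f (x + t *\<^sub>R u) \<partial>lborel)"
      using u by (simp add: add.commute[of "t *\<^sub>R u"] inner_add_left norm_eq_1)
    finally show "(\<integral>\<^sup>+x. H (orth u x) * indicator {0..<1} (x \<bullet> u) * f (x + t *\<^sub>R u) \<partial>lborel)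
      = (\<integral>\<^sup>+x. H (orth u x) * indicator {0..<1} (x \<bullet> u - t) * f x \<partial>lborel)" ..
  qed
  also have "\<dots> = (\<integral>\<^sup>+x. (\<integral>\<^sup>+t. H (orth u x) * indicator {0..<1} (x \<bullet> u - t) * f x \<partial>lborel) \<partial>lborel)"
    by (intro lborel_pair.Fubini'[symmetric]) measurable
  also have "\<dots> = (\<integral>\<^sup>+x. H (orth u x) * f x \<partial>lborel)"
  proof (rule nn_integral_cong)
    \<comment> \<open>The shifts \<open>t\<close> that bring \<open>x\<close> into the half-open
      slab form an interval of length exactly 1.\<close>
    fix x :: 'a
    have "(\<integral>\<^sup>+t. H (orth u x) * indicator {0..<1} (x \<bullet> u - t) * f x \<partial>lborel)
      = (\<integral>\<^sup>+t. H (orth u x) * f x * indicator {x \<bullet> u - 1<..x \<bullet> u} t \<partial>lborel)"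
      by (intro nn_integral_cong) (auto simp: indicator_def)
    also have "\<dots> = H (orth u x) * f x"
      by (subst nn_integral_cmult) auto
    finally show "(\<integral>\<^sup>+t. H (orth u x) * indicator {0..<1} (x \<bullet> u - t) * f x \<partial>lborel) = H (orth u x) * f x" .
  qed
  finally show ?thesis ..
qed

lemma rpow_minus_square_eq_0: "S \<le> 0 \<Longrightarrow> rpow \<beta> (S - t\<^sup>2) = 0"
  using zero_le_power2[of t] unfolding rpow_def by (smt (verit))

text \<open>Substituting \<open>sqrt S * t\<close> for \<open>t\<close> factors \<open>S\<close>
  out; the Jacobian is the extra \<open>1 / 2\<close> in the exponent. In the application
  \<open>S\<close> is one minus the squared distance of a line from the origin.\<close>

lemma nn_integral_rpow_scale:
  "(\<integral>\<^sup>+t. ennreal (rpow \<beta> (S - t\<^sup>2)) \<partial>lborel) =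
    ennreal (rpow (\<beta> + 1 / 2) S) * (\<integral>\<^sup>+t. ennreal (rpow \<beta> (1 - t\<^sup>2)) \<partial>lborel)"
proof (cases "S > 0")
  case True
  have "(\<integral>\<^sup>+t. ennreal (rpow \<beta> (S - t\<^sup>2)) \<partial>lborel) =
    ennreal (sqrt S) * (\<integral>\<^sup>+t. ennreal (rpow \<beta> (S - (sqrt S * t)\<^sup>2)) \<partial>lborel)"
    using nn_integral_lborel_scaleR[of "\<lambda>t. ennreal (rpow \<beta> (S - t\<^sup>2))" "sqrt S"] True by simp
  also have "\<dots> = ennreal (sqrt S) * (\<integral>\<^sup>+t. ennreal (S powr \<beta>) * ennreal (rpow \<beta> (1 - t\<^sup>2)) \<partial>lborel)"
    using True
    by (intro arg_cong2[of _ _ _ _ "(*)"] nn_integral_cong refl)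
      (simp add: power_mult_distrib ennreal_mult[symmetric] rpow_mult[symmetric] algebra_simps)
  also have "\<dots> = ennreal (sqrt S) * (ennreal (S powr \<beta>) * (\<integral>\<^sup>+t. ennreal (rpow \<beta> (1 - t\<^sup>2)) \<partial>lborel))"
    by (subst nn_integral_cmult) auto
  also have "\<dots> = ennreal (sqrt S * S powr \<beta>) * (\<integral>\<^sup>+t. ennreal (rpow \<beta> (1 - t\<^sup>2)) \<partial>lborel)"
    using True by (simp add: ennreal_mult mult.assoc)
  also have "sqrt S * S powr \<beta> = rpow (\<beta> + 1 / 2) S"
    using True by (simp add: rpow_def powr_add powr_half_sqrt)
  finally show ?thesis .
next
  case False
  then show ?thesis by (simp add: rpow_minus_square_eq_0 rpow_def[of _ S])
qed

text \<open>\<open>t\<close> and \<open>t + norm w\<close> are the positions of two points on a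
  line, \<open>w\<close> being their difference with its direction split off. Scaling
  \<open>w\<close> and \<open>t\<close> by \<open>sqrt S\<close> contributes d / 2 and 1 / 2 to the
  exponent.\<close>

lemma nn_integral_rpow_rpow_scale:
  "(\<integral>\<^sup>+w. (\<integral>\<^sup>+t. ennreal (rpow \<beta>1 (S - t\<^sup>2) * rpow \<beta>2 (S - (t + norm w)\<^sup>2)) \<partial>lborel) \<partial>(lborel :: 'a measure)) =
    ennreal (rpow (\<beta>1 + \<beta>2 + (DIM('a::euclidean_space) + 1) / 2) S) *
    (\<integral>\<^sup>+w. (\<integral>\<^sup>+t. ennreal (rpow \<beta>1 (1 - t\<^sup>2) * rpow \<beta>2 (1 - (t + norm w)\<^sup>2)) \<partial>lborel) \<partial>(lborel :: 'a measure))"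
proof (cases "S > 0")
  case True
  define F where "F S w t = ennreal (rpow \<beta>1 (S - t\<^sup>2) * rpow \<beta>2 (S - (t + norm w)\<^sup>2))" for S t and w :: 'a
  have [measurable]: "(\<lambda>(w, t). F S w t) \<in> borel_measurable (borel \<Otimes>\<^sub>M borel)" for S
    unfolding F_def by measurable
  have "(\<integral>\<^sup>+w. (\<integral>\<^sup>+t. F S w t \<partial>lborel) \<partial>lborel) =
      ennreal (sqrt S ^ DIM('a)) * (\<integral>\<^sup>+w. (\<integral>\<^sup>+t. F S (sqrt S *\<^sub>R w) t \<partial>lborel) \<partial>lborel)"
    using True by (intro nn_integral_lborel_scaleR[where f="\<lambda>w. \<integral>\<^sup>+t. F S w t \<partial>lborel"]) auto
  also have "(\<integral>\<^sup>+w. (\<integral>\<^sup>+t. F S (sqrt S *\<^sub>R w) t \<partial>lborel) \<partial>lborel) =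
    (\<integral>\<^sup>+w. ennreal (sqrt S * (S powr \<beta>1 * S powr \<beta>2)) * (\<integral>\<^sup>+t. F 1 w t \<partial>lborel) \<partial>lborel)"
  proof (rule nn_integral_cong)
    fix w :: 'a
    have eq: "F S (sqrt S *\<^sub>R w) (sqrt S * t) = ennreal (S powr \<beta>1 * S powr \<beta>2) * F 1 w t" for t
    proof -
      have 1: "S - (sqrt S * t)\<^sup>2 = S * (1 - t\<^sup>2)"
        using True by (simp add: power_mult_distrib algebra_simps)
      have "S - (sqrt S * t + norm (sqrt S *\<^sub>R w))\<^sup>2 = S - (sqrt S * (t + norm w))\<^sup>2"
        using True by (simp add: algebra_simps)
      also have "\<dots> = S * (1 - (t + norm w)\<^sup>2)"
        using True unfolding power_mult_distrib by (simp add: algebra_simps)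
      finally show ?thesis
        using True unfolding F_def 1 by (simp add: rpow_mult ennreal_mult[symmetric] mult_ac)
    qed
    have "(\<integral>\<^sup>+t. F S (sqrt S *\<^sub>R w) t \<partial>lborel) = ennreal (sqrt S) * (\<integral>\<^sup>+t. F S (sqrt S *\<^sub>R w) (sqrt S * t) \<partial>lborel)"
      using nn_integral_lborel_scaleR[of "F S (sqrt S *\<^sub>R w)" "sqrt S"] True by simp
    also have "\<dots> = ennreal (sqrt S) * (ennreal (S powr \<beta>1 * S powr \<beta>2) * (\<integral>\<^sup>+t. F 1 w t \<partial>lborel))"
      unfolding eq by (subst nn_integral_cmult) auto
    finally show "(\<integral>\<^sup>+t. F S (sqrt S *\<^sub>R w) t \<partial>lborel)
      = ennreal (sqrt S * (S powr \<beta>1 * S powr \<beta>2)) * (\<integral>\<^sup>+t. F 1 w t \<partial>lborel)"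
      using True by (simp add: ennreal_mult mult.assoc)
  qed
  also have "\<dots> = ennreal (sqrt S * (S powr \<beta>1 * S powr \<beta>2)) * (\<integral>\<^sup>+w. (\<integral>\<^sup>+t. F 1 w t \<partial>lborel) \<partial>lborel)"
    by (rule nn_integral_cmult) measurable
  also have "ennreal (sqrt S ^ DIM('a)) * \<dots> = ennreal (sqrt S ^ DIM('a) * (sqrt S * (S powr \<beta>1 * S powr \<beta>2))) *
      (\<integral>\<^sup>+w. (\<integral>\<^sup>+t. F 1 w t \<partial>lborel) \<partial>lborel)"
    using True by (simp add: ennreal_mult mult.assoc)
  also have "sqrt S ^ DIM('a) * (sqrt S * (S powr \<beta>1 * S powr \<beta>2)) = rpow (\<beta>1 + \<beta>2 + (DIM('a) + 1) / 2) S"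
  proof -
    have "sqrt S ^ DIM('a) = S powr (DIM('a) / 2)"
      using True by (simp add: powr_half_sqrt[symmetric] powr_realpow[symmetric] powr_powr)
    moreover have "sqrt S = S powr (1 / 2)" using True by (simp add: powr_half_sqrt)
    ultimately show ?thesis
      using True by (simp add: powr_add[symmetric] rpow_def add_divide_distrib algebra_simps)
  qed
  finally show ?thesis unfolding F_def .
next
  case False
  then show ?thesis by (simp add: rpow_minus_square_eq_0 rpow_def[of _ S])
qed

text \<open>Used with \<open>J\<close> the value of a functional at the constant 1: two multiples of
  one functional that both have mass 1 coincide. Since
  \<open>a = a * (b * J) = b * (a * J) = b\<close>, nothing has to be cancelled in
  \<open>ennreal\<close>.\<close>

lemma ennreal_proportional_eq:
  fixes a b J x :: ennreal
  assumes "a * J = 1" "b * J = 1" shows "a * x = b * x"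
  using assms by (metis mult.assoc mult.commute mult.left_neutral)

text \<open>Slicing along the direction turns both sides into multiples of the functional
  \<open>J h\<close> below. The exponents of \<open>rpow\<close> agree by the choice of the
  parameter on the right, and \<open>h = 1\<close> shows that the factors agree too.\<close>

lemma line_through_two_points_density:
  fixes h :: "'a::euclidean_space \<Rightarrow> 'a \<Rightarrow> ennreal"
  assumes h[measurable]: "(\<lambda>(u, x). h u x) \<in> borel_measurable (borel \<Otimes>\<^sub>M borel)"
    and \<beta>: "\<beta>1 > -1" "\<beta>2 > -1" and \<beta>': "\<beta>1 + \<beta>2 + DIM('a) / 2 > -1"
  shows "(\<integral>\<^sup>+x. (\<integral>\<^sup>+y. h (sgn (y - x)) (orth (sgn (y - x)) x) \<partial>beta_distr \<beta>2) \<partial>beta_distr \<beta>1) =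
    (\<integral>\<^sup>+u. (\<integral>\<^sup>+x. h u (orth u x) \<partial>beta_distr (\<beta>1 + \<beta>2 + DIM('a) / 2)) \<partial>uniform_sphere)"
proof -
  let ?\<beta>' = "\<beta>1 + \<beta>2 + DIM('a) / 2"
  let ?c = "beta_const DIM('a)"
  \<comment> \<open>\<open>A\<close> and \<open>B\<close> are the fibre integrals for lines through
    the origin, \<open>S = 1\<close>; \<open>r\<close> is the power of \<open>S\<close> that both
    sides share.\<close>
  define A where "A = ennreal (?c \<beta>1 * ?c \<beta>2) * (\<integral>\<^sup>+w. (\<integral>\<^sup>+t. ennreal (rpow \<beta>1 (1 - t\<^sup>2) * rpow \<beta>2 (1 - (t + norm w)\<^sup>2)) \<partial>lborel) \<partial>(lborel :: 'a measure))"
  define B where "B = ennreal (?c ?\<beta>') * (\<integral>\<^sup>+t. ennreal (rpow ?\<beta>' (1 - t\<^sup>2)) \<partial>lborel)"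
  define r where "r u x = rpow (?\<beta>' + 1 / 2) (1 - (norm (orth u x))\<^sup>2)" for u x :: 'a
  have [measurable]: "(\<lambda>(u, x). r u x) \<in> borel_measurable (borel \<Otimes>\<^sub>M borel)"
    unfolding r_def by measurable
  define J where "J h = (\<integral>\<^sup>+u. (\<integral>\<^sup>+x. h u (orth u x) * indicator {0..<1} (x \<bullet> u) * ennreal (r u x) \<partial>lborel) \<partial>uniform_sphere)"
    for h :: "'a \<Rightarrow> 'a \<Rightarrow> ennreal"
  interpret S: pair_sigma_finite "lborel :: 'a measure" "uniform_sphere :: 'a measure" ..
  have L: "(\<integral>\<^sup>+x. (\<integral>\<^sup>+y. h (sgn (y - x)) (orth (sgn (y - x)) x) \<partial>beta_distr \<beta>2) \<partial>beta_distr \<beta>1) = A * J h"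
    if h[measurable]: "(\<lambda>(u, x). h u x) \<in> borel_measurable (borel \<Otimes>\<^sub>M borel)" for h
  proof -
    define f where "f u w x = ennreal (beta_density \<beta>1 x * beta_density \<beta>2 (x + norm w *\<^sub>R u))" for u w x :: 'a
    have [measurable]: "(\<lambda>(u, w, x). f u w x) \<in> borel_measurable (borel \<Otimes>\<^sub>M borel \<Otimes>\<^sub>M borel)"
      unfolding f_def by measurable
    have "(\<integral>\<^sup>+x. (\<integral>\<^sup>+y. h (sgn (y - x)) (orth (sgn (y - x)) x) \<partial>beta_distr \<beta>2) \<partial>beta_distr \<beta>1)
      = (\<integral>\<^sup>+x. ennreal (beta_density \<beta>1 x) * (\<integral>\<^sup>+y. ennreal (beta_density \<beta>2 y) * h (sgn (y - x)) (orth (sgn (y - x)) x) \<partial>lborel) \<partial>lborel)"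
      using \<beta> by (subst nn_integral_beta_distr) (auto simp: nn_integral_beta_distr)
    also have "\<dots> = (\<integral>\<^sup>+x. (\<integral>\<^sup>+u. (\<integral>\<^sup>+w. h u (orth u x) * f u w x \<partial>lborel) \<partial>uniform_sphere) \<partial>lborel)"
    proof (rule nn_integral_cong)
      \<comment> \<open>\<open>y\<close> is shifted to \<open>w = y - x\<close>, and polar
        coordinates for \<open>w\<close> produce the uniform direction \<open>u\<close>.\<close>
      fix x :: 'a
      have "(\<integral>\<^sup>+y. ennreal (beta_density \<beta>2 y) * h (sgn (y - x)) (orth (sgn (y - x)) x) \<partial>lborel)
        = (\<integral>\<^sup>+w. ennreal (beta_density \<beta>2 (x + w)) * h (sgn (x + w - x)) (orth (sgn (x + w - x)) x) \<partial>lborel)"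
        by (rule nn_integral_lborel_translate[symmetric]) measurable
      also have "\<dots> = (\<integral>\<^sup>+u. (\<integral>\<^sup>+w. ennreal (beta_density \<beta>2 (x + norm (w::'a) *\<^sub>R u)) *
          h (sgn (x + norm w *\<^sub>R u - x)) (orth (sgn (x + norm w *\<^sub>R u - x)) x) \<partial>lborel) \<partial>uniform_sphere)"
        by (rule nn_integral_polar) measurable
      also have "\<dots> = (\<integral>\<^sup>+u. (\<integral>\<^sup>+w. ennreal (beta_density \<beta>2 (x + norm (w::'a) *\<^sub>R u)) * h u (orth u x) \<partial>lborel) \<partial>uniform_sphere)"
      proof (rule nn_integral_cong_AE, rule eventually_mono[OF AE_uniform_sphere],
          rule nn_integral_cong_AE, rule eventually_mono[OF AE_lborel_neq[of 0]])
        fix u w :: 'a assume "norm u = 1" "w \<noteq> 0"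
        then have "sgn (x + norm w *\<^sub>R u - x) = u" by (simp add: sgn_div_norm)
        then show "ennreal (beta_density \<beta>2 (x + norm w *\<^sub>R u)) *
            h (sgn (x + norm w *\<^sub>R u - x)) (orth (sgn (x + norm w *\<^sub>R u - x)) x)
          = ennreal (beta_density \<beta>2 (x + norm w *\<^sub>R u)) * h u (orth u x)" by simp
      qed
      finally have "(\<integral>\<^sup>+y. ennreal (beta_density \<beta>2 y) * h (sgn (y - x)) (orth (sgn (y - x)) x) \<partial>lborel) = \<dots>" .
      then have "ennreal (beta_density \<beta>1 x) * (\<integral>\<^sup>+y. ennreal (beta_density \<beta>2 y) * h (sgn (y - x)) (orth (sgn (y - x)) x) \<partial>lborel)
        = ennreal (beta_density \<beta>1 x) * \<dots>" by (rule arg_cong)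
      also have "\<dots> = (\<integral>\<^sup>+u. (\<integral>\<^sup>+w. ennreal (beta_density \<beta>1 x) * (ennreal (beta_density \<beta>2 (x + norm (w::'a) *\<^sub>R u)) * h u (orth u x)) \<partial>lborel) \<partial>uniform_sphere)"
        by (simp add: nn_integral_cmult)
      also have "\<dots> = (\<integral>\<^sup>+u. (\<integral>\<^sup>+w. h u (orth u x) * f u w x \<partial>lborel) \<partial>uniform_sphere)"
        using beta_const_pos[of \<beta>1 "DIM('a)"] beta_const_pos[of \<beta>2 "DIM('a)"] \<beta>
        by (intro nn_integral_cong) (simp add: f_def ennreal_mult beta_density_eq_rpow mult_ac)
      finally show "ennreal (beta_density \<beta>1 x) * (\<integral>\<^sup>+y. ennreal (beta_density \<beta>2 y) * h (sgn (y - x)) (orth (sgn (y - x)) x) \<partial>lborel)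
         = (\<integral>\<^sup>+u. (\<integral>\<^sup>+w. h u (orth u x) * f u w x \<partial>lborel) \<partial>uniform_sphere)" .
    qed
    \<comment> \<open>\<open>x\<close> becomes the innermost variable, so that for fixed
      \<open>u\<close> and \<open>w\<close> it can be sliced along \<open>u\<close>; afterwards
      \<open>w\<close> is integrated before \<open>x\<close>.\<close>
    also have "\<dots> = (\<integral>\<^sup>+u. (\<integral>\<^sup>+x. (\<integral>\<^sup>+w. h u (orth u x) * f u w x \<partial>lborel) \<partial>lborel) \<partial>uniform_sphere)"
      unfolding f_def by (intro S.Fubini'[symmetric]) measurable
    also have "\<dots> = (\<integral>\<^sup>+u. (\<integral>\<^sup>+w. (\<integral>\<^sup>+x. h u (orth u x) * f u w x \<partial>lborel) \<partial>lborel) \<partial>uniform_sphere)"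
      by (intro nn_integral_cong lborel_pair.Fubini') measurable
    also have "\<dots> = (\<integral>\<^sup>+u. (\<integral>\<^sup>+w. (\<integral>\<^sup>+x. h u (orth u x) * indicator {0..<1} (x \<bullet> u) * (\<integral>\<^sup>+t. f u w (orth u x + t *\<^sub>R u) \<partial>lborel) \<partial>lborel) \<partial>lborel) \<partial>uniform_sphere)"
    proof (rule nn_integral_cong_AE, rule eventually_mono[OF AE_uniform_sphere], rule nn_integral_cong)
      fix u w :: 'a assume "norm u = 1"
      then show "(\<integral>\<^sup>+x. h u (orth u x) * f u w x \<partial>lborel) =
        (\<integral>\<^sup>+x. h u (orth u x) * indicator {0..<1} (x \<bullet> u) * (\<integral>\<^sup>+t. f u w (orth u x + t *\<^sub>R u) \<partial>lborel) \<partial>lborel)"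
        by (rule nn_integral_orth) measurable
    qed
    also have "\<dots> = (\<integral>\<^sup>+u. (\<integral>\<^sup>+x. (\<integral>\<^sup>+w. h u (orth u x) * indicator {0..<1} (x \<bullet> u) * (\<integral>\<^sup>+t. f u w (orth u x + t *\<^sub>R u) \<partial>lborel) \<partial>lborel) \<partial>lborel) \<partial>uniform_sphere)"
      by (intro nn_integral_cong lborel_pair.Fubini') measurable
    also have "\<dots> = (\<integral>\<^sup>+u. (\<integral>\<^sup>+x. A * (h u (orth u x) * indicator {0..<1} (x \<bullet> u) * ennreal (r u x)) \<partial>lborel) \<partial>uniform_sphere)"
    proof (rule nn_integral_cong_AE, rule eventually_mono[OF AE_uniform_sphere], rule nn_integral_cong)
      fix u x :: 'a assume u: "norm u = 1"
      let ?S = "1 - (norm (orth u x))\<^sup>2"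
      have f: "f u w (orth u x + t *\<^sub>R u) = ennreal (?c \<beta>1 * ?c \<beta>2) *
         ennreal (rpow \<beta>1 (?S - t\<^sup>2) * rpow \<beta>2 (?S - (t + norm w)\<^sup>2))" for w t
      proof -
        have e: "orth u x + t *\<^sub>R u + norm w *\<^sub>R u = orth u x + (t + norm w) *\<^sub>R u"
          by (simp add: algebra_simps)
        show ?thesis
          unfolding f_def beta_density_eq_rpow e norm_orth_add[OF u]
          using beta_const_pos[of \<beta>1 "DIM('a)"] beta_const_pos[of \<beta>2 "DIM('a)"] \<beta>
          by (simp add: ennreal_mult[symmetric] diff_diff_eq mult_ac)
      qed
      have "(\<integral>\<^sup>+w. (\<integral>\<^sup>+t. f u w (orth u x + t *\<^sub>R u) \<partial>lborel) \<partial>lborel) = ennreal (r u x) * A"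
        unfolding f A_def
        by (simp add: nn_integral_cmult nn_integral_rpow_rpow_scale[where S="?S"])
          (simp add: r_def add_divide_distrib algebra_simps)
      then show "(\<integral>\<^sup>+w. h u (orth u x) * indicator {0..<1} (x \<bullet> u) * (\<integral>\<^sup>+t. f u w (orth u x + t *\<^sub>R u) \<partial>lborel) \<partial>lborel)
        = A * (h u (orth u x) * indicator {0..<1} (x \<bullet> u) * ennreal (r u x))"
        by (subst nn_integral_cmult) (auto simp: mult_ac)
    qed
    also have "\<dots> = A * J h"
      unfolding J_def by (simp add: nn_integral_cmult)
    finally show ?thesis .
  qed
  have R: "(\<integral>\<^sup>+u. (\<integral>\<^sup>+x. h u (orth u x) \<partial>beta_distr ?\<beta>') \<partial>uniform_sphere) = B * J h"
    if h[measurable]: "(\<lambda>(u, x). h u x) \<in> borel_measurable (borel \<Otimes>\<^sub>M borel)" for h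
  proof -
    have "(\<integral>\<^sup>+u. (\<integral>\<^sup>+x. h u (orth u x) \<partial>beta_distr ?\<beta>') \<partial>uniform_sphere)
      = (\<integral>\<^sup>+u. (\<integral>\<^sup>+x. h u (orth u x) * ennreal (beta_density ?\<beta>' x) \<partial>lborel) \<partial>uniform_sphere)"
      using \<beta>' by (subst nn_integral_beta_distr) (auto simp: mult.commute)
    also have "\<dots> = (\<integral>\<^sup>+u. (\<integral>\<^sup>+x. B * (h u (orth u x) * indicator {0..<1} (x \<bullet> u) * ennreal (r u x)) \<partial>lborel) \<partial>uniform_sphere)"
    proof (rule nn_integral_cong_AE, rule eventually_mono[OF AE_uniform_sphere])
      fix u :: 'a assume u: "norm u = 1"
      have "(\<integral>\<^sup>+x. h u (orth u x) * ennreal (beta_density ?\<beta>' x) \<partial>lborel) =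
        (\<integral>\<^sup>+x. h u (orth u x) * indicator {0..<1} (x \<bullet> u) * (\<integral>\<^sup>+t. ennreal (beta_density ?\<beta>' (orth u x + t *\<^sub>R u)) \<partial>lborel) \<partial>lborel)"
        by (rule nn_integral_orth[OF u]) measurable
      also have "\<dots> = (\<integral>\<^sup>+x. B * (h u (orth u x) * indicator {0..<1} (x \<bullet> u) * ennreal (r u x)) \<partial>lborel)"
      proof (rule nn_integral_cong)
        fix x
        let ?S = "1 - (norm (orth u x))\<^sup>2"
        have "ennreal (beta_density ?\<beta>' (orth u x + t *\<^sub>R u)) = ennreal (?c ?\<beta>') * ennreal (rpow ?\<beta>' (?S - t\<^sup>2))" for t
          unfolding beta_density_eq_rpow norm_orth_add[OF u]
          using beta_const_pos[OF \<beta>', of "DIM('a)"] by (simp add: ennreal_mult[symmetric] diff_diff_eq)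
        then have "(\<integral>\<^sup>+t. ennreal (beta_density ?\<beta>' (orth u x + t *\<^sub>R u)) \<partial>lborel) = B * ennreal (r u x)"
          by (simp add: nn_integral_cmult nn_integral_rpow_scale[where S="?S"] B_def r_def mult_ac)
        then show "h u (orth u x) * indicator {0..<1} (x \<bullet> u) * (\<integral>\<^sup>+t. ennreal (beta_density ?\<beta>' (orth u x + t *\<^sub>R u)) \<partial>lborel)
          = B * (h u (orth u x) * indicator {0..<1} (x \<bullet> u) * ennreal (r u x))" by (simp only: mult_ac)
      qed
      finally show "(\<integral>\<^sup>+x. h u (orth u x) * ennreal (beta_density ?\<beta>' x) \<partial>lborel) = \<dots>" .
    qed
    also have "\<dots> = B * J h"
      unfolding J_def by (simp add: nn_integral_cmult)
    finally show ?thesis .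
  qed
  have space: "prob_space (beta_distr \<beta>1 :: 'a measure)" "prob_space (beta_distr \<beta>2 :: 'a measure)" "prob_space (beta_distr ?\<beta>' :: 'a measure)"
    using \<beta> \<beta>' by (auto intro: prob_space_beta_distr)
  have "A * J (\<lambda>_ _. 1) = 1" "B * J (\<lambda>_ _. 1) = 1"
    using L[of "\<lambda>_ _. 1"] R[of "\<lambda>_ _. 1"] space[THEN prob_space.emeasure_space_1] uniform_sphere.emeasure_space_1[where ?'a='a] by auto
  with L[OF h] R[OF h] ennreal_proportional_eq show ?thesis by metis
qed

section \<open>Weak limits of beta distributions\<close>

text \<open>Test functions with values in [0, 1] are integrable for every probability measure and
  allow a free change between Bochner and nonnegative integrals.\<close>

lemma (in prob_space) unit_interval_integral:
  assumes [measurable]: "f \<in> borel_measurable M" and f: "\<And>x. 0 \<le> f x" "\<And>x. f x \<le> (1::real)"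
  shows integrable_unit_interval: "integrable M f"
    and nn_integral_unit_interval: "(\<integral>\<^sup>+x. ennreal (f x) \<partial>M) = ennreal (\<integral>x. f x \<partial>M)"
    and integral_unit_interval: "0 \<le> (\<integral>x. f x \<partial>M)" "(\<integral>x. f x \<partial>M) \<le> 1"
proof -
  show *: "integrable M f" using f by (intro integrable_const_bound[of _ 1]) auto
  show "(\<integral>\<^sup>+x. ennreal (f x) \<partial>M) = ennreal (\<integral>x. f x \<partial>M)"
    using f by (intro nn_integral_eq_integral *) auto
  show "0 \<le> (\<integral>x. f x \<partial>M)" using f by simp
  have "(\<integral>x. f x \<partial>M) \<le> (\<integral>x. 1 \<partial>M)" using f by (intro integral_mono *) auto
  then show "(\<integral>x. f x \<partial>M) \<le> 1" by (simp add: prob_space)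
qed

text \<open>The indicator of a closed set is the pointwise limit of the functions \<open>f n\<close>
  below, and the closed sets form an intersection-stable generator.\<close>

lemma prob_measure_eqI_continuous:
  fixes M N :: "'a::metric_space measure"
  assumes M: "prob_space M" "sets M = sets borel" and N: "prob_space N" "sets N = sets borel"
    and eq: "\<And>f. continuous_on UNIV f \<Longrightarrow> (\<And>x. 0 \<le> f x) \<Longrightarrow> (\<And>x. f x \<le> (1::real)) \<Longrightarrow>
      (\<integral>x. f x \<partial>M) = (\<integral>x. f x \<partial>N)"
  shows "M = N"
proof -
  have closed: "emeasure M A = emeasure N A" if A: "closed A" for A
  \<comment> \<open>\<open>infdist x {}\<close> is 0, so for the empty set the functions below would
    be constantly 1.\<close>
  proof (cases "A = {}")
    case False
    define f where "f n x = max 0 (1 - real n * infdist x A)" for n x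
    have f: "continuous_on UNIV (f n)" "0 \<le> f n x" "f n x \<le> 1" for n x
      unfolding f_def by (auto intro!: continuous_intros simp: infdist_nonneg)
    have lim: "(\<lambda>n. \<integral>x. f n x \<partial>P) \<longlonglongrightarrow> measure P A" if P: "prob_space P" and sets[measurable_cong]: "sets P = sets borel" for P
    proof -
      interpret prob_space P by fact
      have "(\<lambda>n. \<integral>x. f n x \<partial>P) \<longlonglongrightarrow> (\<integral>x. indicator A x \<partial>P)"
      proof (rule integral_dominated_convergence[where w="\<lambda>_. 1"])
        show "f n \<in> borel_measurable P" for n
          using borel_measurable_continuous_onI[OF f(1)] measurable_cong_sets[OF sets refl] by auto
        show "(indicator A :: _ \<Rightarrow> real) \<in> borel_measurable P"
          using A sets by (intro borel_measurable_indicator) auto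
        show "AE x in P. (\<lambda>n. f n x) \<longlonglongrightarrow> indicator A x"
        proof (rule AE_I2)
          fix x
          show "(\<lambda>n. f n x) \<longlonglongrightarrow> indicator A x"
          proof (cases "x \<in> A")
            case True then show ?thesis by (simp add: f_def)
          next
            case False
            then have pos: "infdist x A > 0"
              using A \<open>A \<noteq> {}\<close> by (simp add: infdist_pos_not_in_closed)
            obtain m :: nat where m: "1 / infdist x A < real m" using reals_Archimedean2 by blast
            have "f n x = 0" if "n \<ge> m" for n
            proof -
              have "real m * infdist x A \<le> real n * infdist x A"
                using that pos by (intro mult_right_mono) auto
              moreover have "1 < real m * infdist x A" using m pos by (simp add: field_simps)
              ultimately show ?thesis by (simp add: f_def)
            qed
            then have "eventually (\<lambda>n. f n x = 0) sequentially" by (auto simp: eventually_sequentially)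
            then show ?thesis using False by (simp add: tendsto_eventually)
          qed
        qed
      qed (use f in auto)
      then show ?thesis using A sets sets_eq_imp_space_eq[OF sets] by (simp add: Int_absorb1)
    qed
    have "measure M A = measure N A"
      using LIMSEQ_unique[OF lim[OF M]] lim[OF N] eq[OF f] by simp
    then show ?thesis
      using M N by (simp add: finite_measure.emeasure_eq_measure prob_space.finite_measure)
  qed simp
  show ?thesis
  proof (rule measure_eqI_generator_eq[where E="{A. closed A}" and \<Omega>=UNIV and A="\<lambda>_. UNIV"])
    show "Int_stable {A::'a set. closed A}" by (auto simp: Int_stable_def)
    show "sets M = sigma_sets UNIV {A. closed A}" "sets N = sigma_sets UNIV {A. closed A}"
      using M(2) N(2) by (auto simp: borel_eq_closed)
    show "emeasure M UNIV \<noteq> \<infinity>"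
      using M(1) by (simp add: finite_measure.emeasure_finite prob_space.finite_measure)
  qed (auto simp: closed)
qed

text \<open>\<open>rGamma\<close> is continuous also at 0, so the limit includes
  \<open>\<beta> = -1\<close>. There \<open>Gamma 0 = 0\<close> and division by zero make the
  constant 0; this is the true limit, and it drives the mass to the sphere.\<close>

lemma tendsto_beta_const:
  assumes "\<beta> \<ge> -1" "d > 0"
  shows "(\<lambda>n. beta_const d (\<beta> + inverse (real (Suc n)))) \<longlonglongrightarrow> beta_const d \<beta>"
proof -
  have lim: "(\<lambda>n. \<beta> + inverse (real (Suc n))) \<longlonglongrightarrow> \<beta>"
    using tendsto_add[OF tendsto_const LIMSEQ_inverse_real_of_nat, of \<beta>] by simp
  have "real d / 2 + \<beta> + 1 > 0" using assms by (simp add: add_pos_nonneg)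
  then have "(\<lambda>n. Gamma (real d / 2 + (\<beta> + inverse (real (Suc n))) + 1) * rGamma (\<beta> + inverse (real (Suc n)) + 1) / pi powr (real d / 2))
    \<longlonglongrightarrow> Gamma (real d / 2 + \<beta> + 1) * rGamma (\<beta> + 1) / pi powr (real d / 2)"
    by (intro tendsto_divide tendsto_mult tendsto_Gamma isCont_tendsto_compose[OF isCont_rGamma]
        tendsto_add tendsto_const lim continuous_ident) (auto elim!: nonpos_Ints_cases)
  then show ?thesis by (simp add: beta_const_def rGamma_inverse_Gamma field_simps)
qed

lemma integral_beta_distr:
  fixes G :: "'a::euclidean_space \<Rightarrow> real"
  assumes "\<beta> > -1" "G \<in> borel_measurable borel"
  shows "(\<integral>x. G x \<partial>beta_distr \<beta>) = beta_const DIM('a) \<beta> * (\<integral>x. rpow \<beta> (1 - (norm x)\<^sup>2) * G x \<partial>lborel)"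
proof -
  have "0 \<le> beta_density \<beta> x" for x :: 'a
    using beta_const_pos[OF assms(1), of "DIM('a)"] by (simp add: beta_density_eq_rpow)
  then have "(\<integral>x. G x \<partial>beta_distr \<beta>) = (\<integral>x. beta_density \<beta> x *\<^sub>R G x \<partial>lborel)"
    unfolding beta_distr_density[OF assms(1)] using assms(2) by (intro integral_density) simp_all
  then show ?thesis by (simp add: beta_density_eq_rpow mult.assoc)
qed

lemma AE_beta_distr_norm_less:
  assumes "\<beta> > -1"
  shows "AE x in beta_distr \<beta>. norm (x::'a::euclidean_space) < 1"
proof -
  have "AE x in density lborel (\<lambda>x::'a. ennreal (beta_density \<beta> x)). norm x < 1"
    by (simp add: AE_density beta_density_def indicator_def)
  then show ?thesis by (simp only: beta_distr_density[OF assms])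
qed

text \<open>The density is radial, so polar coordinates replace \<open>G\<close> by its means over
  spheres. This leaves one real variable, the radius, for the limit at
  \<open>\<beta> = -1\<close>.\<close>

lemma integral_beta_distr_radial:
  fixes G :: "'a::euclidean_space \<Rightarrow> real"
  assumes \<beta>: "\<beta> > -1" and G[measurable]: "G \<in> borel_measurable borel" and G01: "\<And>x. 0 \<le> G x" "\<And>x. G x \<le> 1"
  shows "(\<integral>x. G x \<partial>beta_distr \<beta>) = (\<integral>x. (\<integral>u. G (norm x *\<^sub>R u) \<partial>uniform_sphere) \<partial>(beta_distr \<beta> :: 'a measure))"
proof -
  interpret B: prob_space "beta_distr \<beta> :: 'a measure" using \<beta> by (simp add: prob_space_beta_distr)
  interpret S: pair_sigma_finite "lborel :: 'a measure" "uniform_sphere :: 'a measure" ..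
  note S = uniform_sphere.unit_interval_integral[where ?'a='a]
  have "ennreal (\<integral>x. G x \<partial>beta_distr \<beta>) = (\<integral>\<^sup>+x. ennreal (G x) \<partial>beta_distr \<beta>)"
    using G01 by (intro B.nn_integral_unit_interval[symmetric]) auto
  also have "\<dots> = (\<integral>\<^sup>+x. ennreal (beta_density \<beta> x) * ennreal (G x) \<partial>lborel)"
    using \<beta> by (rule nn_integral_beta_distr) measurable
  also have "\<dots> = (\<integral>\<^sup>+u. (\<integral>\<^sup>+x. ennreal (beta_density \<beta> (norm (x::'a) *\<^sub>R u)) * ennreal (G (norm x *\<^sub>R u)) \<partial>lborel) \<partial>uniform_sphere)"
    by (rule nn_integral_polar) measurable
  also have "\<dots> = (\<integral>\<^sup>+u. (\<integral>\<^sup>+x. ennreal (beta_density \<beta> (x::'a)) * ennreal (G (norm x *\<^sub>R u)) \<partial>lborel) \<partial>uniform_sphere)"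
    by (rule nn_integral_cong_AE, rule eventually_mono[OF AE_uniform_sphere])
      (simp add: beta_density_eq_rpow)
  also have "\<dots> = (\<integral>\<^sup>+x. (\<integral>\<^sup>+u. ennreal (beta_density \<beta> (x::'a)) * ennreal (G (norm x *\<^sub>R u)) \<partial>uniform_sphere) \<partial>lborel)"
    by (intro S.Fubini') measurable
  also have "\<dots> = (\<integral>\<^sup>+x. ennreal (beta_density \<beta> (x::'a)) * ennreal (\<integral>u. G (norm x *\<^sub>R u) \<partial>uniform_sphere) \<partial>lborel)"
    using G01 by (intro nn_integral_cong) (simp add: nn_integral_cmult S(2))
  also have "\<dots> = (\<integral>\<^sup>+x. ennreal (\<integral>u. G (norm x *\<^sub>R u) \<partial>uniform_sphere) \<partial>(beta_distr \<beta> :: 'a measure))"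
    using \<beta> by (rule nn_integral_beta_distr[symmetric]) measurable
  also have "\<dots> = ennreal (\<integral>x. (\<integral>u. G (norm x *\<^sub>R u) \<partial>uniform_sphere) \<partial>(beta_distr \<beta> :: 'a measure))"
    using G01 by (intro B.nn_integral_unit_interval S) auto
  finally show ?thesis
    using G01 by (subst (asm) ennreal_inj) (auto intro!: B.integral_unit_interval S)
qed

text \<open>For these exponents the density increases with the radius, and the power -1 bounds all
  of them at once. As \<open>\<beta>\<close> tends to -1 the constant tends to 0, so the mass leaves
  every smaller ball.\<close>

lemma measure_beta_distr_cball:
  assumes \<beta>: "\<beta> > -1" "\<beta> \<le> 0" and r: "0 \<le> r" "r < 1"
  shows "measure (beta_distr \<beta>) (cball (0::'a::euclidean_space) r) \<le>
    beta_const DIM('a) \<beta> * ((1 - r\<^sup>2) powr (-1) * unit_ball_vol (DIM('a)))"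
proof -
  interpret B: prob_space "beta_distr \<beta> :: 'a measure" using \<beta> by (simp add: prob_space_beta_distr)
  have r2: "r\<^sup>2 < 1" using r by (simp add: power_less_one_iff abs_square_less_1)
  have "emeasure (beta_distr \<beta>) (cball (0::'a) r) = (\<integral>\<^sup>+x. ennreal (beta_density \<beta> (x::'a)) * indicator (cball 0 r) x \<partial>lborel)"
    using \<beta> by (simp add: beta_distr_density emeasure_density)
  also have "\<dots> \<le> (\<integral>\<^sup>+x. ennreal (beta_const DIM('a) \<beta> * (1 - r\<^sup>2) powr (-1)) * indicator (ball (0::'a) 1) x \<partial>lborel)"
  proof (intro nn_integral_mono)
    fix x :: 'a
    have "beta_density \<beta> x \<le> beta_const DIM('a) \<beta> * (1 - r\<^sup>2) powr (-1)" if "norm x \<le> r"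
    proof -
      have "(norm x)\<^sup>2 \<le> r\<^sup>2" using that by (intro power_mono) auto
      then have "(1 - (norm x)\<^sup>2) powr \<beta> \<le> (1 - r\<^sup>2) powr \<beta>"
        using r2 \<beta> by (intro powr_mono2') auto
      also have "\<dots> \<le> (1 - r\<^sup>2) powr (-1)" using r2 \<beta> by (intro powr_mono') auto
      finally have "beta_const DIM('a) \<beta> * (1 - (norm x)\<^sup>2) powr \<beta> \<le> beta_const DIM('a) \<beta> * (1 - r\<^sup>2) powr (-1)"
        using beta_const_pos[OF \<beta>(1), of "DIM('a)"] by (intro mult_left_mono) auto
      then show ?thesis using that r unfolding beta_density_def by simp
    qed
    then show "ennreal (beta_density \<beta> x) * indicator (cball 0 r) x \<le> ennreal (beta_const DIM('a) \<beta> * (1 - r\<^sup>2) powr (-1)) * indicator (ball (0::'a) 1) x"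
      using r by (auto simp: indicator_def intro!: ennreal_leI)
  qed
  also have "\<dots> = ennreal (beta_const DIM('a) \<beta> * ((1 - r\<^sup>2) powr (-1) * unit_ball_vol (DIM('a))))"
    using beta_const_pos[OF \<beta>(1), of "DIM('a)"] emeasure_unit_ball[where ?'a='a]
    by (subst nn_integral_cmult_indicator) (auto simp: ennreal_mult[symmetric] mult.assoc)
  finally show ?thesis
    using beta_const_pos[OF \<beta>(1), of "DIM('a)"] by (simp add: B.emeasure_eq_measure)
qed

text \<open>The parameters approach \<open>\<beta>\<close> from above, where densities exist even if
  \<open>\<beta> = -1\<close>. For \<open>\<beta> > -1\<close> the limit density dominates, apart
  from the constants; for \<open>\<beta> = -1\<close> the spherical means are continuous at radius 1
  and the mass concentrates there.\<close>

lemma weak_limit_beta_distr: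
  fixes G :: "'a::euclidean_space \<Rightarrow> real"
  assumes \<beta>: "\<beta> \<ge> -1" and G: "continuous_on UNIV G" and G01: "\<And>x. 0 \<le> G x" "\<And>x. G x \<le> 1"
  shows "(\<lambda>n. \<integral>x. G x \<partial>beta_distr (\<beta> + inverse (real (Suc n)))) \<longlonglongrightarrow> (\<integral>x. G x \<partial>beta_distr \<beta>)"
proof -
  have [measurable]: "G \<in> borel_measurable borel" using G by (rule borel_measurable_continuous_onI)
  have \<beta>n: "\<beta> + inverse (real (Suc n)) > -1" for n
    using \<beta> inverse_positive_iff_positive[of "real (Suc n)"] by linarith
  note c = tendsto_beta_const[OF \<beta> DIM_positive[where ?'a='a]]
  have lim: "(\<lambda>n. \<beta> + inverse (real (Suc n))) \<longlonglongrightarrow> \<beta>"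
    using tendsto_add[OF tendsto_const LIMSEQ_inverse_real_of_nat, of \<beta>] by simp
  show ?thesis
  proof (cases "\<beta> = -1")
    case False
    then have \<beta>1: "\<beta> > -1" using \<beta> by simp
    have "(\<lambda>n. \<integral>x. rpow (\<beta> + inverse (real (Suc n))) (1 - (norm x)\<^sup>2) * G x \<partial>lborel) \<longlonglongrightarrow> (\<integral>x. rpow \<beta> (1 - (norm x)\<^sup>2) * G x \<partial>lborel)"
    proof (rule integral_dominated_convergence[where w="\<lambda>x. rpow \<beta> (1 - (norm x)\<^sup>2)"])
      have "integrable lborel (\<lambda>x::'a. beta_density \<beta> x)"
        using nn_integral_beta_density[OF \<beta>1, where ?'a='a] beta_const_pos[OF \<beta>1, of "DIM('a)"]
        by (intro integrableI_nonneg) (auto simp: beta_density_eq_rpow)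
      then show "integrable lborel (\<lambda>x::'a. rpow \<beta> (1 - (norm x)\<^sup>2))"
        using beta_const_pos[OF \<beta>1, of "DIM('a)"] by (simp add: beta_density_eq_rpow)
      show "AE x in lborel. (\<lambda>n. rpow (\<beta> + inverse (real (Suc n))) (1 - (norm x)\<^sup>2) * G x) \<longlonglongrightarrow> rpow \<beta> (1 - (norm x)\<^sup>2) * G x"
      proof (rule AE_I2)
        fix x :: 'a
        have "(\<lambda>n. rpow (\<beta> + inverse (real (Suc n))) (1 - (norm x)\<^sup>2)) \<longlonglongrightarrow> rpow \<beta> (1 - (norm x)\<^sup>2)"
          using lim by (cases "0 < 1 - (norm x)\<^sup>2") (auto simp: rpow_def intro!: tendsto_powr)
        then show "(\<lambda>n. rpow (\<beta> + inverse (real (Suc n))) (1 - (norm x)\<^sup>2) * G x) \<longlonglongrightarrow> rpow \<beta> (1 - (norm x)\<^sup>2) * G x"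
          by (intro tendsto_mult) auto
      qed
      show "AE x in lborel. norm (rpow (\<beta> + inverse (real (Suc n))) (1 - (norm x)\<^sup>2) * G x) \<le> rpow \<beta> (1 - (norm (x::'a))\<^sup>2)" for n
      proof (rule AE_I2)
        fix x :: 'a
        have "rpow (\<beta> + inverse (real (Suc n))) (1 - (norm x)\<^sup>2) \<le> rpow \<beta> (1 - (norm x)\<^sup>2)"
          by (auto simp: rpow_def intro!: powr_mono')
        then have "rpow (\<beta> + inverse (real (Suc n))) (1 - (norm x)\<^sup>2) * G x \<le> rpow \<beta> (1 - (norm x)\<^sup>2) * 1"
          using G01 by (intro mult_mono) auto
        then show "norm (rpow (\<beta> + inverse (real (Suc n))) (1 - (norm x)\<^sup>2) * G x) \<le> rpow \<beta> (1 - (norm x)\<^sup>2)"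
          using G01 by (simp add: abs_mult)
      qed
    qed measurable
    with c show ?thesis
      using \<beta>1 \<beta>n by (simp add: integral_beta_distr tendsto_mult)
  next
    case True
    let ?\<beta> = "\<lambda>n. -1 + inverse (real (Suc n))"
    define g where "g r = (\<integral>u. G (r *\<^sub>R u) \<partial>uniform_sphere)" for r :: real
    have g01: "0 \<le> g r" "g r \<le> 1" for r
      unfolding g_def using G01 by (auto intro!: uniform_sphere.integral_unit_interval)
    have "g \<midarrow>1\<rightarrow> g 1"
      unfolding tendsto_at_iff_sequentially comp_def
    proof (intro allI impI)
      fix X :: "nat \<Rightarrow> real" assume X: "X \<longlonglongrightarrow> 1"
      show "(\<lambda>n. g (X n)) \<longlonglongrightarrow> g 1"
        unfolding g_def
      proof (rule integral_dominated_convergence[where w="\<lambda>_. 1"])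
        show "AE u in uniform_sphere. (\<lambda>n. G (X n *\<^sub>R u)) \<longlonglongrightarrow> G (1 *\<^sub>R u)"
        proof (rule AE_I2)
          fix u :: 'a
          have "(\<lambda>n. X n *\<^sub>R u) \<longlonglongrightarrow> 1 *\<^sub>R u" by (intro tendsto_scaleR X tendsto_const)
          then show "(\<lambda>n. G (X n *\<^sub>R u)) \<longlonglongrightarrow> G (1 *\<^sub>R u)"
            by (rule continuous_on_tendsto_compose[OF G]) auto
        qed
      qed (use G01 in auto)
    qed
    have [measurable]: "g \<in> borel_measurable borel"
      unfolding g_def by measurable
    have "(\<lambda>n. \<integral>x. G x \<partial>beta_distr (?\<beta> n)) \<longlonglongrightarrow> g 1"
    proof (rule tendstoI)
      fix e :: real assume e: "e > 0"
      obtain \<delta> where \<delta>: "\<delta> > 0" "\<And>s. s \<noteq> 1 \<Longrightarrow> dist s 1 < \<delta> \<Longrightarrow> dist (g s) (g 1) < e / 2"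
        using LIM_D[OF \<open>g \<midarrow>1\<rightarrow> g 1\<close>, of "e / 2"] e by (auto simp: dist_norm)
      \<comment> \<open>For radii between \<open>r\<close> and 1 the means differ from
        \<open>g 1\<close> by less than \<open>e / 2\<close>; on the ball of radius \<open>r\<close>
        they differ by at most 1, and its mass is eventually below \<open>e / 2\<close>. The maximum
        keeps \<open>r\<close> nonnegative.\<close>
      define r where "r = max 0 (1 - \<delta> / 2)"
      have r: "0 \<le> r" "r < 1" using \<delta> by (auto simp: r_def)
      have gr: "\<bar>g s - g 1\<bar> < e / 2" if "r < s" "s < 1" for s
        using \<delta>(2)[of s] that \<delta>(1) by (auto simp: r_def dist_real_def)
      define K where "K = (1 - r\<^sup>2) powr (-1) * unit_ball_vol (DIM('a))"
      have "(\<lambda>n. beta_const DIM('a) (?\<beta> n) * K) \<longlonglongrightarrow> beta_const DIM('a) (-1) * K"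
        using c True by (intro tendsto_mult) auto
      then have "(\<lambda>n. beta_const DIM('a) (?\<beta> n) * K) \<longlonglongrightarrow> 0"
        by (simp add: beta_const_def)
      then have "eventually (\<lambda>n. beta_const DIM('a) (?\<beta> n) * K < e / 2) sequentially"
        using e by (intro order_tendstoD(2)) auto
      then show "eventually (\<lambda>n. dist (\<integral>x. G x \<partial>beta_distr (?\<beta> n)) (g 1) < e) sequentially"
      proof eventually_elim
        case (elim n)
        define b where "b = ?\<beta> n"
        have \<beta>n': "b > -1" "b \<le> 0" by (auto simp: b_def inverse_eq_divide)
        interpret B: prob_space "beta_distr (b) :: 'a measure" using \<beta>n' by (simp add: prob_space_beta_distr)
        have int: "integrable (beta_distr (b)) (\<lambda>x::'a. g (norm x))"
          using g01 by (intro B.integrable_unit_interval) auto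
        have ind: "integrable (beta_distr b) (indicat_real (cball (0::'a) r))"
          by (intro B.integrable_unit_interval borel_measurable_indicator) (auto simp: indicator_def)
        have "(\<integral>x. G x \<partial>beta_distr (b)) - g 1 = (\<integral>x. g (norm x) \<partial>(beta_distr (b) :: 'a measure)) - g 1"
          unfolding g_def by (subst integral_beta_distr_radial) (use \<beta>n' G01 in auto)
        also have "\<dots> = (\<integral>x. g (norm x) - g 1 \<partial>(beta_distr (b) :: 'a measure))"
          using int B.prob_space by simp
        finally have "\<bar>(\<integral>x. G x \<partial>beta_distr (b)) - g 1\<bar> \<le> (\<integral>x. \<bar>g (norm x) - g 1\<bar> \<partial>(beta_distr (b) :: 'a measure))"
          using integral_norm_bound[of "beta_distr (b)" "\<lambda>x::'a. g (norm x) - g 1"] by simp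
        also have "\<dots> \<le> (\<integral>x. e / 2 + indicator (cball 0 r) x \<partial>(beta_distr (b) :: 'a measure))"
        proof (rule integral_mono_AE)
          show "AE x in beta_distr (b). \<bar>g (norm x) - g 1\<bar> \<le> e / 2 + indicator (cball 0 r) (x::'a)"
            using AE_beta_distr_norm_less[OF \<beta>n'(1)]
          proof eventually_elim
            case (elim x)
            have "\<bar>g (norm x) - g 1\<bar> \<le> 1" using g01[of "norm x"] g01[of 1] by linarith
            then show ?case using gr[of "norm x"] elim e by (cases "norm x \<le> r") auto
          qed
        qed (use int ind in \<open>auto intro!: Bochner_Integration.integrable_add\<close>)
        also have "\<dots> = e / 2 + measure (beta_distr (b)) (cball (0::'a) r)"
          using B.prob_space ind by (subst Bochner_Integration.integral_add) auto
        also have "measure (beta_distr (b)) (cball (0::'a) r) \<le> beta_const DIM('a) (b) * K"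
          unfolding K_def using \<beta>n' r by (rule measure_beta_distr_cball)
        finally show ?case using elim unfolding b_def[symmetric] by (simp add: dist_real_def)
      qed
    qed
    then show ?thesis by (simp add: True g_def beta_distr_def)
  qed
qed

section \<open>Projections of beta distributions\<close>

text \<open>These maps are orthogonal projections onto a subspace followed by a linear isometry onto
  the target. The adjoint is the section that parametrizes the fibres: \<open>adjoint T z\<close> is
  the point of the fibre over \<open>z\<close> nearest to the origin.\<close>

definition coisometry :: "('a::euclidean_space \<Rightarrow> 'b::euclidean_space) \<Rightarrow> bool" where
  "coisometry T \<longleftrightarrow> linear T \<and> (\<forall>z. T (adjoint T z) = z)"

lemma norm_coisometry_adjoint:
  fixes T :: "'a::euclidean_space \<Rightarrow> 'b::euclidean_space"
  assumes "coisometry T"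
  shows "norm (adjoint T z) = norm z"
  using assms adjoint_works[of T "adjoint T z" z]
  by (simp add: coisometry_def norm_eq_sqrt_inner)

lemma measurable_coisometry:
  fixes T :: "'a::euclidean_space \<Rightarrow> 'b::euclidean_space"
  assumes "coisometry T" shows "T \<in> borel_measurable borel"
  using assms unfolding coisometry_def
  by (intro borel_measurable_continuous_onI linear_continuous_on) (simp add: linear_linear)

lemma norm_coisometry_Pythagoras:
  fixes T :: "'a::euclidean_space \<Rightarrow> 'b::euclidean_space"
  assumes T: "coisometry T"
  shows "(norm (x - adjoint T (T x) + adjoint T z))\<^sup>2 = (norm (x - adjoint T (T x)))\<^sup>2 + (norm z)\<^sup>2"
proof -
  have lin: "linear T" and TS: "T (adjoint T z) = z" for z using T by (auto simp: coisometry_def)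
  have "(x - adjoint T (T x)) \<bullet> adjoint T z = 0"
    using adjoint_works[OF lin, of "x - adjoint T (T x)" z] TS by (simp add: linear_diff[OF lin])
  then show ?thesis
    by (simp add: norm_add_Pythagorean orthogonal_def norm_coisometry_adjoint[OF T])
qed

lemma coisometry_DIM_le:
  fixes T :: "'a::euclidean_space \<Rightarrow> 'b::euclidean_space"
  assumes "coisometry T" shows "DIM('b) \<le> DIM('a)"
proof -
  have "linear T" "surj T" using assms unfolding coisometry_def surj_def by metis+
  then have "dim (T ` UNIV) \<le> dim (UNIV :: 'a set)" by (intro dim_image_le)
  then show ?thesis using \<open>surj T\<close> by simp
qed

text \<open>The window \<open>w z\<close> on the complement of the fibre may depend on the point \<open>z\<close>, which is
  what makes the fibre integrals computable by scaling of the whole space.\<close>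

lemma nn_integral_coisometry:
  fixes T :: "'a::euclidean_space \<Rightarrow> 'b::euclidean_space"
  assumes T: "coisometry T"
    and [measurable]: "f \<in> borel_measurable borel" "\<phi> \<in> borel_measurable borel"
      "(\<lambda>(z, y). w z y) \<in> borel_measurable (borel \<Otimes>\<^sub>M borel)"
    and w: "\<And>z. (\<integral>\<^sup>+y. w z y \<partial>lborel) = 1" "\<And>z y. w z (- y) = w z y"
  shows "(\<integral>\<^sup>+x. \<phi> (T x) * f x \<partial>lborel) =
    (\<integral>\<^sup>+z. \<phi> z * (\<integral>\<^sup>+x. f (x - adjoint T (T x) + adjoint T z) * w z (T x) \<partial>lborel) \<partial>lborel)"
proof -
  let ?S = "adjoint T"
  have lin: "linear T" and TS: "T (?S z) = z" for z using T by (auto simp: coisometry_def)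
  have linS: "linear ?S" using lin by (rule adjoint_linear)
  have [measurable]: "T \<in> borel_measurable borel" "?S \<in> borel_measurable borel"
    using lin linS by (auto intro!: borel_measurable_continuous_onI linear_continuous_on simp: linear_linear)
  have "(\<integral>\<^sup>+z. \<phi> z * (\<integral>\<^sup>+x. f (x - ?S (T x) + ?S z) * w z (T x) \<partial>lborel) \<partial>lborel)
    = (\<integral>\<^sup>+z. (\<integral>\<^sup>+x. \<phi> z * (f (x - ?S (T x) + ?S z) * w z (T x)) \<partial>lborel) \<partial>lborel)"
    by (simp add: nn_integral_cmult)
  also have "\<dots> = (\<integral>\<^sup>+x. (\<integral>\<^sup>+z. \<phi> z * (f (x - ?S (T x) + ?S z) * w z (T x)) \<partial>lborel) \<partial>lborel)"
    by (intro lborel_pair.Fubini') measurable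
  also have "\<dots> = (\<integral>\<^sup>+x. (\<integral>\<^sup>+z. \<phi> (T x + z) * (f (x + ?S z) * w (T x + z) (T x)) \<partial>lborel) \<partial>lborel)"
  proof (rule nn_integral_cong)
    fix x
    have "(\<integral>\<^sup>+z. \<phi> z * (f (x - ?S (T x) + ?S z) * w z (T x)) \<partial>lborel)
      = (\<integral>\<^sup>+z. \<phi> (T x + z) * (f (x - ?S (T x) + ?S (T x + z)) * w (T x + z) (T x)) \<partial>lborel)"
      by (rule nn_integral_lborel_translate[symmetric]) measurable
    then show "(\<integral>\<^sup>+z. \<phi> z * (f (x - ?S (T x) + ?S z) * w z (T x)) \<partial>lborel) =
      (\<integral>\<^sup>+z. \<phi> (T x + z) * (f (x + ?S z) * w (T x + z) (T x)) \<partial>lborel)"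
      by (simp add: linear_add[OF linS] algebra_simps)
  qed
  also have "\<dots> = (\<integral>\<^sup>+z. (\<integral>\<^sup>+x. \<phi> (T x + z) * (f (x + ?S z) * w (T x + z) (T x)) \<partial>lborel) \<partial>lborel)"
    by (intro lborel_pair.Fubini') measurable
  also have "\<dots> = (\<integral>\<^sup>+z. (\<integral>\<^sup>+x. \<phi> (T x) * (f x * w (T x) (T x - z)) \<partial>lborel) \<partial>lborel)"
  proof (rule nn_integral_cong)
    fix z
    have "(\<integral>\<^sup>+x. \<phi> (T x) * (f x * w (T x) (T x - z)) \<partial>lborel)
      = (\<integral>\<^sup>+x. \<phi> (T (?S z + x)) * (f (?S z + x) * w (T (?S z + x)) (T (?S z + x) - z)) \<partial>lborel)"
      by (rule nn_integral_lborel_translate[symmetric]) measurable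
    then show "(\<integral>\<^sup>+x. \<phi> (T x + z) * (f (x + ?S z) * w (T x + z) (T x)) \<partial>lborel) =
      (\<integral>\<^sup>+x. \<phi> (T x) * (f x * w (T x) (T x - z)) \<partial>lborel)"
      by (simp add: linear_add[OF lin] TS add.commute)
  qed
  also have "\<dots> = (\<integral>\<^sup>+x. (\<integral>\<^sup>+z. \<phi> (T x) * (f x * w (T x) (T x - z)) \<partial>lborel) \<partial>lborel)"
    by (intro lborel_pair.Fubini') measurable
  also have "\<dots> = (\<integral>\<^sup>+x. \<phi> (T x) * f x \<partial>lborel)"
  proof (rule nn_integral_cong)
    \<comment> \<open>The window is even, so \<open>T x - z\<close> may be replaced by
      \<open>z - T x\<close>; a translation then gives total mass 1.\<close>
    fix x
    have "(\<integral>\<^sup>+z. w (T x) (T x - z) \<partial>lborel) = (\<integral>\<^sup>+z. w (T x) (- T x + z) \<partial>lborel)"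
      by (intro nn_integral_cong) (metis minus_diff_eq uminus_add_conv_diff w(2))
    also have "\<dots> = 1"
      using w(1) by (subst nn_integral_lborel_translate) auto
    finally show "(\<integral>\<^sup>+z. \<phi> (T x) * (f x * w (T x) (T x - z)) \<partial>lborel) = \<phi> (T x) * f x"
      by (simp add: nn_integral_cmult)
  qed
  finally show ?thesis ..
qed

text \<open>With \<open>\<sigma>\<close> one minus the squared norm of \<open>z\<close>, the fibre
  over \<open>z\<close> is a copy of the fibre over 0 scaled by \<open>sqrt \<sigma>\<close>. The
  Jacobian of the whole space gives as many factors \<open>sqrt \<sigma>\<close> as the source has
  dimensions, and the normalization of the window takes back those of the target.\<close>

lemma distr_coisometry_beta_density:
  fixes T :: "'a::euclidean_space \<Rightarrow> 'b::euclidean_space"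
  assumes T: "coisometry T" and \<beta>: "\<beta> > -1"
  shows "distr (beta_distr \<beta>) borel T = beta_distr (\<beta> + (real DIM('a) - real DIM('b)) / 2)"
proof -
  let ?S = "adjoint T"
  let ?\<beta>' = "\<beta> + (real DIM('a) - real DIM('b)) / 2"
  have lin: "linear T" and TS: "T (?S z) = z" for z using T by (auto simp: coisometry_def)
  have linS: "linear ?S" using lin by (rule adjoint_linear)
  have [measurable]: "T \<in> borel_measurable borel" "?S \<in> borel_measurable borel"
    using lin linS by (auto intro!: borel_measurable_continuous_onI linear_continuous_on simp: linear_linear)
  have "(real DIM('a) - real DIM('b)) / 2 \<ge> 0"
    using coisometry_DIM_le[OF T] by (intro divide_nonneg_nonneg) auto
  then have \<beta>': "?\<beta>' > -1" using \<beta> by linarith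
  define V where "V = unit_ball_vol (DIM('b))"
  have V: "V > 0" using unit_ball_vol_pos[of "real DIM('b)"] by (simp add: V_def del: unit_ball_vol_pos)
  \<comment> \<open>The window at \<open>z\<close> is the uniform density on the ball of radius
    \<open>s z\<close>, which scales together with the fibre. Outside the unit ball, where the
    density vanishes on the fibre, the value 1 keeps \<open>w z\<close> a probability
    density.\<close>
  define s where "s z = (if norm z < 1 then sqrt (1 - (norm z)\<^sup>2) else 1)" for z :: 'b
  have s: "s z > 0" for z
    by (auto simp: s_def abs_square_less_1)
  have [measurable]: "s \<in> borel_measurable borel" unfolding s_def by measurable
  define w where "w z y = ennreal (1 / (s z ^ DIM('b) * V)) * indicator {y. norm y < s z} y" for z y :: 'b
  have w_measurable[measurable]: "(\<lambda>(z, y). w z y) \<in> borel_measurable (borel \<Otimes>\<^sub>M borel)"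
    unfolding w_def by measurable
  have "(\<integral>\<^sup>+y. w z y \<partial>lborel) = 1" for z
  proof -
    have "(\<integral>\<^sup>+y. w z y \<partial>lborel) = ennreal (1 / (s z ^ DIM('b) * V)) * emeasure lborel (ball (0::'b) (s z))"
      unfolding w_def by (subst nn_integral_cmult_indicator) (auto simp: ball_def)
    also have "\<dots> = 1"
      using s[of z] V less_imp_neq[OF V, symmetric, unfolded V_def] emeasure_ball[of "s z" "0::'b"] by (simp add: V_def ennreal_mult[symmetric] mult.commute)
    finally show ?thesis .
  qed
  note w = this
  have w_minus: "w z (- y) = w z y" for z y by (simp add: w_def indicator_def)
  define K where "K = ennreal (1 / V) * (\<integral>\<^sup>+x. ennreal (beta_const DIM('a) \<beta> * rpow \<beta> (1 - (norm (x - ?S (T x)))\<^sup>2)) * indicator {y. norm y < 1} (T x) \<partial>lborel)"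
  define J where "J \<phi> = (\<integral>\<^sup>+z. \<phi> z * ennreal (rpow ?\<beta>' (1 - (norm (z::'b))\<^sup>2)) \<partial>lborel)" for \<phi>
  have L: "(\<integral>\<^sup>+x. \<phi> (T x) \<partial>beta_distr \<beta>) = K * J \<phi>" if [measurable]: "\<phi> \<in> borel_measurable borel" for \<phi>
  proof -
    have "(\<integral>\<^sup>+x. \<phi> (T x) \<partial>beta_distr \<beta>) = (\<integral>\<^sup>+x. \<phi> (T x) * ennreal (beta_density \<beta> x) \<partial>lborel)"
      using \<beta> by (subst nn_integral_beta_distr) (auto simp: mult.commute)
    also have "\<dots> = (\<integral>\<^sup>+z. \<phi> z * (\<integral>\<^sup>+x. ennreal (beta_density \<beta> (x - ?S (T x) + ?S z)) * w z (T x) \<partial>lborel) \<partial>lborel)"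
      using T by (rule nn_integral_coisometry) (use w w_minus in auto)
    also have "\<dots> = (\<integral>\<^sup>+z. K * (\<phi> z * ennreal (rpow ?\<beta>' (1 - (norm z)\<^sup>2))) \<partial>lborel)"
    proof (rule nn_integral_cong)
      fix z :: 'b
      have "(\<integral>\<^sup>+x. ennreal (beta_density \<beta> (x - ?S (T x) + ?S z)) * w z (T x) \<partial>lborel) = K * ennreal (rpow ?\<beta>' (1 - (norm z)\<^sup>2))"
      proof (cases "norm z < 1")
        case True
        define \<sigma> where "\<sigma> = 1 - (norm z)\<^sup>2"
        have \<sigma>: "\<sigma> > 0" "s z = sqrt \<sigma>" using True by (auto simp: \<sigma>_def s_def abs_square_less_1)
        have "(\<integral>\<^sup>+x. ennreal (beta_density \<beta> (x - ?S (T x) + ?S z)) * w z (T x) \<partial>lborel)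
          = ennreal (sqrt \<sigma> ^ DIM('a)) * (\<integral>\<^sup>+x. ennreal (beta_density \<beta> (sqrt \<sigma> *\<^sub>R x - ?S (T (sqrt \<sigma> *\<^sub>R x)) + ?S z)) * w z (T (sqrt \<sigma> *\<^sub>R x)) \<partial>lborel)"
          using \<sigma> by (intro nn_integral_lborel_scaleR[where f="\<lambda>x. ennreal (beta_density \<beta> (x - ?S (T x) + ?S z)) * w z (T x)"]) auto
        also have "(\<lambda>x. ennreal (beta_density \<beta> (sqrt \<sigma> *\<^sub>R x - ?S (T (sqrt \<sigma> *\<^sub>R x)) + ?S z)) * w z (T (sqrt \<sigma> *\<^sub>R x)))
          = (\<lambda>x. ennreal (\<sigma> powr \<beta> / (sqrt \<sigma> ^ DIM('b) * V)) * (ennreal (beta_const DIM('a) \<beta> * rpow \<beta> (1 - (norm (x - ?S (T x)))\<^sup>2)) * indicator {y. norm y < 1} (T x)))"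
        proof
          fix x
          let ?N = "x - ?S (T x)"
          have "sqrt \<sigma> *\<^sub>R x - ?S (T (sqrt \<sigma> *\<^sub>R x)) = sqrt \<sigma> *\<^sub>R ?N"
            by (simp add: linear_scale[OF lin] linear_scale[OF linS] algebra_simps)
          then have "(norm (sqrt \<sigma> *\<^sub>R x - ?S (T (sqrt \<sigma> *\<^sub>R x)) + ?S z))\<^sup>2 = \<sigma> * (norm ?N)\<^sup>2 + (norm z)\<^sup>2"
            using norm_coisometry_Pythagoras[OF T, of "sqrt \<sigma> *\<^sub>R x" z] \<sigma> by (simp add: power_mult_distrib)
          then have "1 - (norm (sqrt \<sigma> *\<^sub>R x - ?S (T (sqrt \<sigma> *\<^sub>R x)) + ?S z))\<^sup>2 = \<sigma> * (1 - (norm ?N)\<^sup>2)"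
            by (simp add: \<sigma>_def algebra_simps)
          then have b: "beta_density \<beta> (sqrt \<sigma> *\<^sub>R x - ?S (T (sqrt \<sigma> *\<^sub>R x)) + ?S z) = \<sigma> powr \<beta> * (beta_const DIM('a) \<beta> * rpow \<beta> (1 - (norm ?N)\<^sup>2))"
            by (simp add: beta_density_eq_rpow rpow_mult[OF \<sigma>(1)])
          have i: "w z (T (sqrt \<sigma> *\<^sub>R x)) = ennreal (1 / (sqrt \<sigma> ^ DIM('b) * V)) * indicator {y. norm y < 1} (T x)"
            using \<sigma> by (simp add: w_def indicator_def linear_scale[OF lin])
          have e: "ennreal (\<sigma> powr \<beta> / (sqrt \<sigma> ^ DIM('b) * V)) = ennreal (\<sigma> powr \<beta>) * ennreal (1 / (sqrt \<sigma> ^ DIM('b) * V))"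
            using \<sigma> V by (simp add: ennreal_mult[symmetric])
          show "ennreal (beta_density \<beta> (sqrt \<sigma> *\<^sub>R x - ?S (T (sqrt \<sigma> *\<^sub>R x)) + ?S z)) * w z (T (sqrt \<sigma> *\<^sub>R x)) =
            ennreal (\<sigma> powr \<beta> / (sqrt \<sigma> ^ DIM('b) * V)) * (ennreal (beta_const DIM('a) \<beta> * rpow \<beta> (1 - (norm ?N)\<^sup>2)) * indicator {y. norm y < 1} (T x))"
            unfolding b i e using beta_const_pos[OF \<beta>, of "DIM('a)"] by (simp add: ennreal_mult mult_ac)
        qed
        also have "(\<integral>\<^sup>+x. ennreal (\<sigma> powr \<beta> / (sqrt \<sigma> ^ DIM('b) * V)) * (ennreal (beta_const DIM('a) \<beta> * rpow \<beta> (1 - (norm (x - ?S (T x)))\<^sup>2)) * indicator {y. norm y < 1} (T x)) \<partial>lborel)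
          = ennreal (\<sigma> powr \<beta> / (sqrt \<sigma> ^ DIM('b) * V)) * (\<integral>\<^sup>+x. ennreal (beta_const DIM('a) \<beta> * rpow \<beta> (1 - (norm (x - ?S (T x)))\<^sup>2)) * indicator {y. norm y < 1} (T x) \<partial>lborel)"
          by (rule nn_integral_cmult) measurable
        also have "ennreal (sqrt \<sigma> ^ DIM('a)) * \<dots> = ennreal (sqrt \<sigma> ^ DIM('a) * (\<sigma> powr \<beta> / sqrt \<sigma> ^ DIM('b))) * K"
        proof -
          have "ennreal (sqrt \<sigma> ^ DIM('a)) * ennreal (\<sigma> powr \<beta> / (sqrt \<sigma> ^ DIM('b) * V)) =
              ennreal (sqrt \<sigma> ^ DIM('a) * (\<sigma> powr \<beta> / sqrt \<sigma> ^ DIM('b))) * ennreal (1 / V)"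
            using \<sigma> V by (simp add: ennreal_mult[symmetric])
          then show ?thesis unfolding K_def by (simp only: mult.assoc[symmetric])
        qed
        also have "sqrt \<sigma> ^ DIM('a) * (\<sigma> powr \<beta> / sqrt \<sigma> ^ DIM('b)) = rpow ?\<beta>' \<sigma>"
        proof -
          have p: "sqrt \<sigma> ^ n = \<sigma> powr (n / 2)" for n :: nat
            using \<sigma> by (simp add: powr_half_sqrt[symmetric] powr_realpow[symmetric] powr_powr)
          show ?thesis unfolding p
            using \<sigma> by (simp add: rpow_def powr_add[symmetric] powr_diff[symmetric] diff_divide_distrib algebra_simps)
        qed
        finally show ?thesis by (simp add: \<sigma>_def mult.commute)
      next
        case False
        have "1 \<le> (norm (x - ?S (T x) + ?S z))\<^sup>2" for x
        proof -
          have "1\<^sup>2 \<le> (norm z)\<^sup>2" using False by (intro power_mono) auto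
          then show ?thesis unfolding norm_coisometry_Pythagoras[OF T] by (simp add: add_increasing)
        qed
        then have "beta_density \<beta> (x - ?S (T x) + ?S z) = 0" for x
          by (simp add: beta_density_eq_rpow rpow_def leD)
        moreover have "rpow ?\<beta>' (1 - (norm z)\<^sup>2) = 0"
          using False by (simp add: rpow_def abs_square_less_1)
        ultimately show ?thesis by simp
      qed
      then show "\<phi> z * (\<integral>\<^sup>+x. ennreal (beta_density \<beta> (x - ?S (T x) + ?S z)) * w z (T x) \<partial>lborel) = K * (\<phi> z * ennreal (rpow ?\<beta>' (1 - (norm z)\<^sup>2)))"
        by (simp only: mult_ac)
    qed
    also have "\<dots> = K * J \<phi>" unfolding J_def by (rule nn_integral_cmult) measurable
    finally show ?thesis .
  qed
  have R: "(\<integral>\<^sup>+x. \<phi> x \<partial>beta_distr ?\<beta>') = ennreal (beta_const DIM('b) ?\<beta>') * J \<phi>" if [measurable]: "\<phi> \<in> borel_measurable borel" for \<phi>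
    using \<beta>' beta_const_pos[OF \<beta>', of "DIM('b)"] unfolding J_def
    by (subst nn_integral_beta_distr)
      (auto simp: nn_integral_cmult[symmetric] beta_density_eq_rpow ennreal_mult mult_ac intro!: nn_integral_cong)
  have "prob_space (beta_distr \<beta> :: 'a measure)" "prob_space (beta_distr ?\<beta>' :: 'b measure)"
    using \<beta> \<beta>' by (auto intro: prob_space_beta_distr)
  note this[THEN prob_space.emeasure_space_1]
  then have 1: "K * J (\<lambda>_. 1) = 1" "ennreal (beta_const DIM('b) ?\<beta>') * J (\<lambda>_. 1) = 1"
    using L[of "\<lambda>_. 1"] R[of "\<lambda>_. 1"] by auto
  show ?thesis
  proof (rule measure_eqI)
    fix A assume "A \<in> sets (distr (beta_distr \<beta>) borel T)"
    then have A[measurable]: "A \<in> sets borel" by simp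
    have "emeasure (distr (beta_distr \<beta>) borel T) A = (\<integral>\<^sup>+x. indicator A x \<partial>distr (beta_distr \<beta>) borel T)"
      by simp
    also have "\<dots> = (\<integral>\<^sup>+x. indicator A (T x) \<partial>beta_distr \<beta>)"
      by (subst nn_integral_distr) auto
    also have "\<dots> = (\<integral>\<^sup>+x. indicator A x \<partial>beta_distr ?\<beta>')"
      using L[of "indicator A"] R[of "indicator A"] ennreal_proportional_eq[OF 1] by simp
    finally show "emeasure (distr (beta_distr \<beta>) borel T) A = emeasure (beta_distr ?\<beta>') A" by simp
  qed simp
qed

text \<open>Adding the same null sequence to both parameters gives the case with densities; since
  \<open>T\<close> is continuous, both sides pass to the weak limit.\<close>

lemma distr_coisometry_beta_distr:
  fixes T :: "'a::euclidean_space \<Rightarrow> 'b::euclidean_space"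
  assumes T: "coisometry T" and \<beta>: "\<beta> \<ge> -1"
  shows "distr (beta_distr \<beta>) borel T = beta_distr (\<beta> + (real DIM('a) - real DIM('b)) / 2)"
proof (rule prob_measure_eqI_continuous)
  let ?\<beta>' = "\<beta> + (real DIM('a) - real DIM('b)) / 2"
  have "linear T" using T by (simp add: coisometry_def)
  then have cont: "continuous_on UNIV T" by (intro linear_continuous_on) (simp add: linear_linear)
  have T_measurable[measurable]: "T \<in> borel_measurable borel"
    using cont by (rule borel_measurable_continuous_onI)
  have "(real DIM('a) - real DIM('b)) / 2 \<ge> 0"
    using coisometry_DIM_le[OF T] by (intro divide_nonneg_nonneg) auto
  then have \<beta>': "?\<beta>' \<ge> -1" using \<beta> by linarith
  show "prob_space (distr (beta_distr \<beta>) borel T)"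
    using prob_space_beta_distr[OF \<beta>] by (rule prob_space.prob_space_distr) simp
  show "prob_space (beta_distr ?\<beta>' :: 'b measure)" using \<beta>' by (rule prob_space_beta_distr)
  fix f :: "'b \<Rightarrow> real" assume f: "continuous_on UNIV f" "\<And>x. 0 \<le> f x" "\<And>x. f x \<le> 1"
  have [measurable]: "f \<in> borel_measurable borel" using f(1) by (rule borel_measurable_continuous_onI)
  let ?b = "\<lambda>n. \<beta> + inverse (real (Suc n))"
  have "(\<integral>x. f (T x) \<partial>beta_distr (?b n)) = (\<integral>x. f x \<partial>beta_distr (?\<beta>' + inverse (real (Suc n))))" for n
  proof -
    have "?b n > -1" using \<beta> inverse_positive_iff_positive[of "real (Suc n)"] by linarith
    from distr_coisometry_beta_density[OF T this]
    have "beta_distr (?\<beta>' + inverse (real (Suc n))) = distr (beta_distr (?b n)) borel T"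
      by (simp add: algebra_simps)
    then show ?thesis by (simp add: integral_distr)
  qed
  moreover have "(\<lambda>n. \<integral>x. f (T x) \<partial>beta_distr (?b n)) \<longlonglongrightarrow> (\<integral>x. f (T x) \<partial>beta_distr \<beta>)"
    using f by (intro weak_limit_beta_distr \<beta> continuous_on_compose2[OF f(1) cont]) auto
  moreover have "(\<lambda>n. \<integral>x. f x \<partial>beta_distr (?\<beta>' + inverse (real (Suc n)))) \<longlonglongrightarrow> (\<integral>x. f x \<partial>beta_distr ?\<beta>')"
    using f by (intro weak_limit_beta_distr \<beta>') auto
  ultimately have "(\<integral>x. f (T x) \<partial>beta_distr \<beta>) = (\<integral>x. f x \<partial>beta_distr ?\<beta>')"
    using LIMSEQ_unique by simp
  then show "(\<integral>x. f x \<partial>distr (beta_distr \<beta>) borel T) = (\<integral>x. f x \<partial>beta_distr ?\<beta>')"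
    by (simp add: integral_distr)
qed simp_all

text \<open>The inner product with \<open>sgn a\<close> is a coisometry to the real line. The image
  law has parameter \<open>\<beta> + (d - 1) / 2\<close>, which exceeds -1 because the two-point law
  in dimension one is excluded, so it has a density and no atoms.\<close>

lemma AE_beta_distr_hyperplane:
  fixes a :: "'a::euclidean_space"
  assumes \<beta>: "\<beta> \<ge> -1" "DIM('a) = 1 \<longrightarrow> \<beta> \<noteq> -1" and a: "a \<noteq> 0"
  shows "AE x in beta_distr \<beta>. x \<bullet> a \<noteq> c"
proof -
  define T where "T x = x \<bullet> sgn a" for x
  have lin: "linear T" unfolding T_def by (rule linearI) (auto simp: inner_add_left)
  have "adjoint T = (\<lambda>t. t *\<^sub>R sgn a)"
    by (rule adjoint_unique) (auto simp: T_def)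
  moreover have "sgn a \<bullet> sgn a = 1" using a by (simp add: norm_eq_1[symmetric] norm_sgn)
  ultimately have T: "coisometry T" using lin by (simp add: coisometry_def) (simp add: T_def)
  have [measurable]: "T \<in> borel_measurable borel" unfolding T_def by measurable
  have "\<beta> + (real DIM('a) - 1) / 2 > -1"
  proof (cases "DIM('a) = 1")
    case False
    then have "real DIM('a) > 1" using DIM_positive[where ?'a='a] by linarith
    then have "(real DIM('a) - 1) / 2 > 0" by (intro divide_pos_pos) auto
    then show ?thesis using \<beta> by linarith
  qed (use \<beta> in auto)
  then have \<beta>': "\<beta> + (real DIM('a) - real DIM(real)) / 2 > -1" by simp
  have "AE t in beta_distr (\<beta> + (real DIM('a) - real DIM(real)) / 2). t \<noteq> c / norm a"
    unfolding beta_distr_density[OF \<beta>']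
    using AE_lborel_neq[of "c / norm a"] by (subst AE_density) (auto elim: eventually_mono)
  then have "AE t in distr (beta_distr \<beta>) borel T. t \<noteq> c / norm a"
    unfolding distr_coisometry_beta_distr[OF T \<beta>(1)] .
  then have "AE x in beta_distr \<beta>. T x \<noteq> c / norm a"
    by (subst (asm) AE_distr_iff) auto
  then show ?thesis
    using a by (auto elim!: eventually_mono simp: T_def sgn_div_norm field_simps)
qed

section \<open>Two points on the sphere\<close>

lemma AE_beta_distr_neq:
  fixes a :: "'a::euclidean_space"
  assumes "\<beta> \<ge> -1" "DIM('a) = 1 \<longrightarrow> \<beta> \<noteq> -1"
  shows "AE x in beta_distr \<beta>. x \<noteq> a"
proof -
  obtain b :: 'a where "b \<in> Basis" using nonempty_Basis by blast
  then have "b \<noteq> 0" by auto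
  from AE_beta_distr_hyperplane[OF assms this, of "a \<bullet> b"] show ?thesis
    by (rule eventually_mono) auto
qed

lemma nn_integral_iterated_unit_interval:
  fixes M :: "'a::euclidean_space measure" and N :: "'b::euclidean_space measure"
  assumes M: "prob_space M" "sets M = sets borel" and N: "prob_space N" "sets N = sets borel"
    and F[measurable]: "(\<lambda>(x, y). F x y) \<in> borel_measurable (borel \<Otimes>\<^sub>M borel)"
    and F01: "\<And>x y. 0 \<le> F x y" "\<And>x y. F x y \<le> (1::real)"
  shows "(\<integral>\<^sup>+x. (\<integral>\<^sup>+y. ennreal (F x y) \<partial>N) \<partial>M) = ennreal (\<integral>x. (\<integral>y. F x y \<partial>N) \<partial>M)"
proof -
  interpret M: prob_space M by fact
  interpret N: prob_space N by fact
  note [measurable_cong] = M(2) N(2)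
  have "(\<integral>\<^sup>+x. (\<integral>\<^sup>+y. ennreal (F x y) \<partial>N) \<partial>M) = (\<integral>\<^sup>+x. ennreal (\<integral>y. F x y \<partial>N) \<partial>M)"
    using F01 by (intro nn_integral_cong N.nn_integral_unit_interval) measurable
  also have "\<dots> = ennreal (\<integral>x. (\<integral>y. F x y \<partial>N) \<partial>M)"
    using F01 by (intro M.nn_integral_unit_interval N.integral_unit_interval) measurable
  finally show ?thesis .
qed

lemma iterated_integral_swap_unit_interval:
  fixes M :: "'a::euclidean_space measure" and N :: "'b::euclidean_space measure"
  assumes M: "prob_space M" "sets M = sets borel" and N: "prob_space N" "sets N = sets borel"
    and F[measurable]: "(\<lambda>(x, y). F x y) \<in> borel_measurable (borel \<Otimes>\<^sub>M borel)"
    and F01: "\<And>x y. 0 \<le> F x y" "\<And>x y. F x y \<le> (1::real)"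
  shows "(\<integral>x. (\<integral>y. F x y \<partial>N) \<partial>M) = (\<integral>y. (\<integral>x. F x y \<partial>M) \<partial>N)"
proof -
  interpret M: prob_space M by fact
  interpret N: prob_space N by fact
  note [measurable_cong] = M(2) N(2)
  interpret P: pair_sigma_finite M N ..
  have F'[measurable]: "(\<lambda>(y, x). F x y) \<in> borel_measurable (borel \<Otimes>\<^sub>M borel)" by measurable
  have "(\<integral>\<^sup>+x. (\<integral>\<^sup>+y. ennreal (F x y) \<partial>N) \<partial>M) = (\<integral>\<^sup>+y. (\<integral>\<^sup>+x. ennreal (F x y) \<partial>M) \<partial>N)"
    by (intro P.Fubini'[symmetric]) measurable
  then show ?thesis
    unfolding nn_integral_iterated_unit_interval[OF M N F F01] nn_integral_iterated_unit_interval[OF N M F' F01]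
    using F01 by (subst (asm) ennreal_inj) (auto intro!: integral_nonneg)
qed

text \<open>The direction jumps only where \<open>x = y\<close>. In dimension at least 2 this is a
  null event for either point with the other one fixed, so integrating out one point leaves a
  bounded continuous function of the other, to which the weak limit applies.\<close>

lemma line_through_two_points_continuous:
  fixes f :: "'a::euclidean_space \<times> 'a \<Rightarrow> real"
  assumes d: "2 \<le> DIM('a)" and f: "continuous_on UNIV f" and f01: "\<And>x. 0 \<le> f x" "\<And>x. f x \<le> 1"
    and \<beta>: "\<beta>1 \<ge> -1" "\<beta>2 \<ge> -1"
  shows "(\<integral>x. (\<integral>y. f (sgn (y - x), orth (sgn (y - x)) x) \<partial>beta_distr \<beta>2) \<partial>beta_distr \<beta>1) =
    (\<integral>u. (\<integral>x. f (u, orth u x) \<partial>beta_distr (\<beta>1 + \<beta>2 + DIM('a) / 2)) \<partial>uniform_sphere)"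
proof -
  have d2: "real DIM('a) / 2 \<ge> 1" using d by simp
  have inv: "inverse (real (Suc n)) > 0" for n by simp
  have f_measurable[measurable]: "f \<in> borel_measurable (borel \<Otimes>\<^sub>M borel)"
    using borel_measurable_continuous_onI[OF f] by (simp add: borel_prod)
  note prob = prob_space_beta_distr[where ?'a='a] sets_beta_distr[where ?'a='a]
    prob_space_uniform_sphere[where ?'a='a] sets_uniform_sphere[where ?'a='a]
  define F where "F x y = f (sgn (y - x), orth (sgn (y - x)) x)" for x y
  have F[measurable]: "(\<lambda>(x, y). F x y) \<in> borel_measurable (borel \<Otimes>\<^sub>M borel)"
    unfolding F_def by measurable
  have F': "(\<lambda>(y, x). F x y) \<in> borel_measurable (borel \<Otimes>\<^sub>M borel)" by measurable
  have F01: "0 \<le> F x y" "F x y \<le> 1" for x y using f01 by (auto simp: F_def)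
  define G where "G u x = f (u, orth u x)" for u x
  have G[measurable]: "(\<lambda>(u, x). G u x) \<in> borel_measurable (borel \<Otimes>\<^sub>M borel)"
    unfolding G_def by measurable
  have G01: "0 \<le> G u x" "G u x \<le> 1" for u x using f01 by (auto simp: G_def)
  define E where "E \<beta> \<beta>' = (\<integral>x. (\<integral>y. F x y \<partial>beta_distr \<beta>') \<partial>beta_distr \<beta>)" for \<beta> \<beta>'
  define E' where "E' \<beta> = (\<integral>x. (\<integral>u. G u x \<partial>uniform_sphere) \<partial>beta_distr \<beta>)" for \<beta>
  have E_swap: "E b b' = (\<integral>y. (\<integral>x. F x y \<partial>beta_distr b) \<partial>beta_distr b')" if "b \<ge> -1" "b' \<ge> -1" for b b'
    unfolding E_def using that F F01 by (intro iterated_integral_swap_unit_interval prob)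
  have E'_swap: "E' b = (\<integral>u. (\<integral>x. G u x \<partial>beta_distr b) \<partial>uniform_sphere)" if "b \<ge> -1" for b
    unfolding E'_def using that G G01 by (intro iterated_integral_swap_unit_interval[symmetric] prob)
  have lim: "(\<lambda>n. F (X n) (Y n)) \<longlonglongrightarrow> F x y" if "X \<longlonglongrightarrow> x" "Y \<longlonglongrightarrow> y" "y \<noteq> x" for X Y x y
  proof -
    have "(\<lambda>n. sgn (Y n - X n)) \<longlonglongrightarrow> sgn (y - x)"
      using that by (intro tendsto_sgn tendsto_diff) auto
    then have "(\<lambda>n. (sgn (Y n - X n), orth (sgn (Y n - X n)) (X n))) \<longlonglongrightarrow> (sgn (y - x), orth (sgn (y - x)) x)"
      unfolding orth_def using that by (intro tendsto_intros) auto
    then show ?thesis unfolding F_def by (rule continuous_on_tendsto_compose[OF f]) auto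
  qed
  have nonatomic: "AE y in beta_distr b. y \<noteq> x" if "b \<ge> -1" for b and x :: 'a
    using that d by (intro AE_beta_distr_neq) auto
  have cont1: "continuous_on UNIV (\<lambda>x. \<integral>y. F x y \<partial>beta_distr b)" if b: "b \<ge> -1" for b
  proof (rule continuous_on_sequentiallyI)
    interpret prob_space "beta_distr b :: 'a measure" using b by (rule prob)
    fix X and x :: 'a assume X: "X \<longlonglongrightarrow> x"
    show "(\<lambda>n. \<integral>y. F (X n) y \<partial>beta_distr b) \<longlonglongrightarrow> (\<integral>y. F x y \<partial>beta_distr b)"
    proof (rule integral_dominated_convergence[where w="\<lambda>_. 1"])
      show "AE y in beta_distr b. (\<lambda>n. F (X n) y) \<longlonglongrightarrow> F x y"
        using nonatomic[OF b, of x] by eventually_elim (intro lim X tendsto_const)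
    qed (use F01 in auto)
  qed
  have cont2: "continuous_on UNIV (\<lambda>y. \<integral>x. F x y \<partial>beta_distr b)" if b: "b \<ge> -1" for b
  proof (rule continuous_on_sequentiallyI)
    interpret prob_space "beta_distr b :: 'a measure" using b by (rule prob)
    fix Y and y :: 'a assume Y: "Y \<longlonglongrightarrow> y"
    show "(\<lambda>n. \<integral>x. F x (Y n) \<partial>beta_distr b) \<longlonglongrightarrow> (\<integral>x. F x y \<partial>beta_distr b)"
    proof (rule integral_dominated_convergence[where w="\<lambda>_. 1"])
      show "AE x in beta_distr b. (\<lambda>n. F x (Y n)) \<longlonglongrightarrow> F x y"
        using nonatomic[OF b, of y] by eventually_elim (intro lim Y tendsto_const, simp)
    qed (use F01 in auto)
  qed
  have cont3: "continuous_on UNIV (\<lambda>x. \<integral>u. G u x \<partial>uniform_sphere)"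
  proof (rule continuous_on_sequentiallyI)
    fix X and x :: 'a assume X: "X \<longlonglongrightarrow> x"
    show "(\<lambda>n. \<integral>u. G u (X n) \<partial>uniform_sphere) \<longlonglongrightarrow> (\<integral>u. G u x \<partial>uniform_sphere)"
    proof (rule integral_dominated_convergence[where w="\<lambda>_. 1"])
      show "AE u in uniform_sphere. (\<lambda>n. G u (X n)) \<longlonglongrightarrow> G u x"
      proof (rule AE_I2)
        fix u :: 'a
        have "(\<lambda>n. (u, orth u (X n))) \<longlonglongrightarrow> (u, orth u x)"
          unfolding orth_def using X by (intro tendsto_intros)
        then show "(\<lambda>n. G u (X n)) \<longlonglongrightarrow> G u x"
          unfolding G_def by (rule continuous_on_tendsto_compose[OF f]) auto
      qed
    qed (use G01 in auto)
  qed
  have density: "E b b' = E' (b + b' + DIM('a) / 2)" if b: "b > -1" "b' > -1" for b b'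
  proof -
    let ?b = "b + b' + DIM('a) / 2"
    have b'': "?b > -1" using b d2 by linarith
    have "ennreal (E b b') = (\<integral>\<^sup>+x. (\<integral>\<^sup>+y. ennreal (F x y) \<partial>beta_distr b') \<partial>beta_distr b)"
      unfolding E_def using b F F01 by (intro nn_integral_iterated_unit_interval[symmetric] prob) auto
    also have "\<dots> = (\<integral>\<^sup>+u. (\<integral>\<^sup>+x. ennreal (G u x) \<partial>beta_distr ?b) \<partial>uniform_sphere)"
      unfolding F_def G_def using b b''
      by (intro line_through_two_points_density[where h="\<lambda>u x. ennreal (f (u, x))"]) auto
    also have "\<dots> = ennreal (\<integral>u. (\<integral>x. G u x \<partial>beta_distr ?b) \<partial>uniform_sphere)"
      using b'' G G01 by (intro nn_integral_iterated_unit_interval prob) auto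
    also have "\<dots> = ennreal (E' ?b)"
      using b'' by (simp add: E'_swap)
    finally show ?thesis
      using F01 G01 unfolding E_def E'_def by (subst (asm) ennreal_inj) (auto intro!: integral_nonneg)
  qed
  have E'_lim: "(\<lambda>n. E' (b + inverse (real (Suc n)))) \<longlonglongrightarrow> E' b" if "b \<ge> -1" for b
    unfolding E'_def using that G01
    by (intro weak_limit_beta_distr cont3 uniform_sphere.integral_unit_interval) auto
  \<comment> \<open>First \<open>\<beta>1\<close> passes to the limit with \<open>\<beta>2\<close>
    still above -1; then the integrals are exchanged and \<open>\<beta>2\<close> follows. The
    right-hand side depends on the sum alone, so the same shift appears there.\<close>
  have half: "E b b' = E' (b + b' + DIM('a) / 2)" if b: "b \<ge> -1" "b' > -1" for b b'
  proof -
    interpret prob_space "beta_distr b' :: 'a measure" using b by (intro prob) auto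
    have "(\<lambda>n. E (b + inverse (real (Suc n))) b') \<longlonglongrightarrow> E b b'"
      unfolding E_def using b F01 by (intro weak_limit_beta_distr cont1 integral_unit_interval) auto
    moreover have "E (b + inverse (real (Suc n))) b' = E' (b + b' + DIM('a) / 2 + inverse (real (Suc n)))" for n
    proof -
      have "b + inverse (real (Suc n)) > -1" using b inv[of n] by linarith
      then show ?thesis using density[of "b + inverse (real (Suc n))" b'] b by (simp add: add_ac)
    qed
    moreover have "b + b' + DIM('a) / 2 \<ge> -1" using b d2 by linarith
    ultimately show ?thesis using E'_lim LIMSEQ_unique by fastforce
  qed
  have "E \<beta>1 \<beta>2 = E' (\<beta>1 + \<beta>2 + DIM('a) / 2)"
  proof -
    interpret prob_space "beta_distr \<beta>1 :: 'a measure" using \<beta> by (intro prob) auto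
    have "(\<lambda>n. \<integral>y. (\<integral>x. F x y \<partial>beta_distr \<beta>1) \<partial>beta_distr (\<beta>2 + inverse (real (Suc n)))) \<longlonglongrightarrow> E \<beta>1 \<beta>2"
      unfolding E_swap[OF \<beta>] using \<beta> F01 by (intro weak_limit_beta_distr cont2 integral_unit_interval) auto
    moreover have "(\<integral>y. (\<integral>x. F x y \<partial>beta_distr \<beta>1) \<partial>beta_distr (\<beta>2 + inverse (real (Suc n)))) =
        E' (\<beta>1 + \<beta>2 + DIM('a) / 2 + inverse (real (Suc n)))" for n
    proof -
      have "\<beta>2 + inverse (real (Suc n)) > -1" using \<beta> inv[of n] by linarith
      then show ?thesis
        using half[OF \<beta>(1), of "\<beta>2 + inverse (real (Suc n))"] E_swap[OF \<beta>(1), of "\<beta>2 + inverse (real (Suc n))"]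
        by (simp add: add_ac)
    qed
    moreover have "\<beta>1 + \<beta>2 + DIM('a) / 2 \<ge> -1" using \<beta> d2 by linarith
    ultimately show ?thesis using E'_lim LIMSEQ_unique by fastforce
  qed
  moreover have "\<beta>1 + \<beta>2 + DIM('a) / 2 \<ge> -1" using \<beta> d2 by linarith
  ultimately show ?thesis unfolding E'_swap E_def F_def G_def by (simp add: E'_swap G_def)
qed

text \<open>Continuous test functions on pairs determine the joint law of direction and nearest
  point, hence the identity extends to all measurable \<open>h\<close>.\<close>

lemma line_through_two_points:
  fixes h :: "'a::euclidean_space \<Rightarrow> 'a \<Rightarrow> ennreal"
  assumes d: "2 \<le> DIM('a)" and h[measurable]: "(\<lambda>(u, x). h u x) \<in> borel_measurable (borel \<Otimes>\<^sub>M borel)"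
    and \<beta>: "\<beta>1 \<ge> -1" "\<beta>2 \<ge> -1"
  shows "(\<integral>\<^sup>+x. (\<integral>\<^sup>+y. h (sgn (y - x)) (orth (sgn (y - x)) x) \<partial>beta_distr \<beta>2) \<partial>beta_distr \<beta>1) =
    (\<integral>\<^sup>+u. (\<integral>\<^sup>+x. h u (orth u x) \<partial>beta_distr (\<beta>1 + \<beta>2 + DIM('a) / 2)) \<partial>uniform_sphere)"
proof -
  let ?\<beta>' = "\<beta>1 + \<beta>2 + DIM('a) / 2"
  have "real DIM('a) / 2 \<ge> 1" using d by simp
  then have \<beta>': "?\<beta>' \<ge> -1" using \<beta> by linarith
  interpret B1: prob_space "beta_distr \<beta>1 :: 'a measure" using \<beta> by (intro prob_space_beta_distr)
  interpret B2: prob_space "beta_distr \<beta>2 :: 'a measure" using \<beta> by (intro prob_space_beta_distr)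
  interpret B': prob_space "beta_distr ?\<beta>' :: 'a measure" using \<beta>' by (intro prob_space_beta_distr)
  interpret P: pair_prob_space "beta_distr \<beta>1 :: 'a measure" "beta_distr \<beta>2 :: 'a measure" ..
  interpret Q: pair_prob_space "uniform_sphere :: 'a measure" "beta_distr ?\<beta>' :: 'a measure" ..
  define p where "p = (\<lambda>(x::'a, y). (sgn (y - x), orth (sgn (y - x)) x))"
  define q where "q = (\<lambda>(u::'a, x). (u, orth u x))"
  have p[measurable]: "p \<in> (beta_distr \<beta>1 \<Otimes>\<^sub>M beta_distr \<beta>2) \<rightarrow>\<^sub>M borel"
    unfolding p_def borel_prod[symmetric] by measurable
  have q[measurable]: "q \<in> (uniform_sphere \<Otimes>\<^sub>M beta_distr ?\<beta>') \<rightarrow>\<^sub>M borel"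
    unfolding q_def borel_prod[symmetric] by measurable
  have h'[measurable]: "(\<lambda>z. h (fst z) (snd z)) \<in> borel_measurable borel"
    using h unfolding borel_prod by (simp add: case_prod_beta')
  have "distr (beta_distr \<beta>1 \<Otimes>\<^sub>M beta_distr \<beta>2) borel p = distr (uniform_sphere \<Otimes>\<^sub>M beta_distr ?\<beta>') borel q"
  proof (rule prob_measure_eqI_continuous)
    show "prob_space (distr (beta_distr \<beta>1 \<Otimes>\<^sub>M beta_distr \<beta>2) borel p)"
      using p by (rule P.prob_space_distr)
    show "prob_space (distr (uniform_sphere \<Otimes>\<^sub>M beta_distr ?\<beta>') borel q)"
      using q by (rule Q.prob_space_distr)
    fix f :: "'a \<times> 'a \<Rightarrow> real" assume f: "continuous_on UNIV f" "\<And>x. 0 \<le> f x" "\<And>x. f x \<le> 1"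
    have f_measurable[measurable]: "f \<in> borel_measurable borel"
      using borel_measurable_continuous_onI[OF f(1)] .
    have "(\<integral>z. f z \<partial>distr (beta_distr \<beta>1 \<Otimes>\<^sub>M beta_distr \<beta>2) borel p) =
        (\<integral>z. f (p z) \<partial>(beta_distr \<beta>1 \<Otimes>\<^sub>M beta_distr \<beta>2))"
      by (rule integral_distr) measurable
    also have "\<dots> = (\<integral>x. (\<integral>y. f (p (x, y)) \<partial>beta_distr \<beta>2) \<partial>beta_distr \<beta>1)"
      using f by (intro P.integral_fst'[symmetric] P.integrable_unit_interval) auto
    also have "\<dots> = (\<integral>u. (\<integral>x. f (q (u, x)) \<partial>beta_distr ?\<beta>') \<partial>uniform_sphere)"
      unfolding p_def q_def using line_through_two_points_continuous[OF d f \<beta>] by simp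
    also have "\<dots> = (\<integral>z. f (q z) \<partial>(uniform_sphere \<Otimes>\<^sub>M beta_distr ?\<beta>'))"
      using f by (intro Q.integral_fst' Q.integrable_unit_interval) auto
    also have "\<dots> = (\<integral>z. f z \<partial>distr (uniform_sphere \<Otimes>\<^sub>M beta_distr ?\<beta>') borel q)"
      by (rule integral_distr[symmetric]) measurable
    finally show "(\<integral>z. f z \<partial>distr (beta_distr \<beta>1 \<Otimes>\<^sub>M beta_distr \<beta>2) borel p) = \<dots>" .
  qed simp_all
  then have "(\<integral>\<^sup>+z. h (fst z) (snd z) \<partial>distr (beta_distr \<beta>1 \<Otimes>\<^sub>M beta_distr \<beta>2) borel p) =
      (\<integral>\<^sup>+z. h (fst z) (snd z) \<partial>distr (uniform_sphere \<Otimes>\<^sub>M beta_distr ?\<beta>') borel q)" by simp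
  then have "(\<integral>\<^sup>+z. h (fst (p z)) (snd (p z)) \<partial>(beta_distr \<beta>1 \<Otimes>\<^sub>M beta_distr \<beta>2)) =
      (\<integral>\<^sup>+z. h (fst (q z)) (snd (q z)) \<partial>(uniform_sphere \<Otimes>\<^sub>M beta_distr ?\<beta>'))"
    by (simp add: nn_integral_distr)
  then show ?thesis
    by (simp add: B2.nn_integral_fst[symmetric] B'.nn_integral_fst[symmetric] p_def q_def case_prod_beta')
qed

section \<open>Cones with lines\<close>

text \<open>The form that the tangent cone keeps under merging: \<open>a\<close> spans the
  directions of the face, \<open>v\<close> consists of the vectors from the base point to the other
  vertices.\<close>

definition ruled_cone :: "'i set \<Rightarrow> ('i \<Rightarrow> 'a::real_vector) \<Rightarrow> 'j set \<Rightarrow> ('j \<Rightarrow> 'a) \<Rightarrow> 'a set" where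
  "ruled_cone I a J v = {x + y | x y. x \<in> span (a ` I) \<and> y \<in> pos J v}"

lemma ruled_cone_subset:
  assumes "finite J" "\<And>i. i \<in> I \<Longrightarrow> a i \<in> span S" "\<And>j. j \<in> J \<Longrightarrow> v j - w j \<in> span S"
  shows "ruled_cone I a J v \<subseteq> {x + y | x y. x \<in> span S \<and> y \<in> pos J w}"
proof
  fix z assume "z \<in> ruled_cone I a J v"
  then obtain x c where x: "x \<in> span (a ` I)" and c: "\<forall>j\<in>J. 0 \<le> c j" and z: "z = x + (\<Sum>j\<in>J. c j *\<^sub>R v j)"
    unfolding ruled_cone_def pos_def by auto
  have "span (a ` I) \<subseteq> span S" using assms(2) by (intro span_minimal) (auto simp: subspace_span)
  moreover have "(\<Sum>j\<in>J. c j *\<^sub>R (v j - w j)) \<in> span S"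
    using assms(3) by (intro span_sum span_scale) auto
  ultimately have "x + (\<Sum>j\<in>J. c j *\<^sub>R (v j - w j)) \<in> span S" using x by (intro span_add) auto
  moreover have "z = (x + (\<Sum>j\<in>J. c j *\<^sub>R (v j - w j))) + (\<Sum>j\<in>J. c j *\<^sub>R w j)"
    by (simp add: z scaleR_diff_right sum_subtractf)
  ultimately show "z \<in> {x + y | x y. x \<in> span S \<and> y \<in> pos J w}"
    using c unfolding pos_def by blast
qed

text \<open>Replacing \<open>v j\<close> by \<open>w j\<close> changes a combination by multiples of
  elements of the span, which the linear part absorbs.\<close>

lemma ruled_cone_cong:
  assumes J: "finite J" and span: "span (a ` I) = span (b ` I')" and "\<And>j. j \<in> J \<Longrightarrow> v j - w j \<in> span (b ` I')"
  shows "ruled_cone I a J v = ruled_cone I' b J w"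
proof
  have "a i \<in> span (b ` I')" if "i \<in> I" for i using span span_base[of "a i" "a ` I"] that by auto
  then show "ruled_cone I a J v \<subseteq> ruled_cone I' b J w"
    using ruled_cone_subset[OF J, of I a "b ` I'" v w] assms(3) unfolding ruled_cone_def[of I'] by auto
  have "b i \<in> span (a ` I)" if "i \<in> I'" for i using span span_base[of "b i" "b ` I'"] that by auto
  moreover have "w j - v j \<in> span (a ` I)" if "j \<in> J" for j
    using assms(3)[OF that] unfolding span by (metis minus_diff_eq span_neg)
  ultimately show "ruled_cone I' b J w \<subseteq> ruled_cone I a J v"
    using ruled_cone_subset[OF J, of I' b "a ` I" w v] unfolding ruled_cone_def[of I] by auto
qed

lemma span_family:
  assumes I: "finite I"
  shows "span (a ` I) = {\<Sum>i\<in>I. e i *\<^sub>R a i | e. True}"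
proof
  have "a i \<in> {\<Sum>i\<in>I. e i *\<^sub>R a i | e. True}" if "i \<in> I" for i
    using that I by (auto intro!: exI[of _ "\<lambda>j. if j = i then 1 else 0"] simp: if_distrib[of "\<lambda>c. c *\<^sub>R _"] cong: if_cong)
  moreover have "subspace {\<Sum>i\<in>I. e i *\<^sub>R a i | e. True}"
    unfolding subspace_def
  proof (intro conjI ballI allI)
    show "0 \<in> {\<Sum>i\<in>I. e i *\<^sub>R a i | e. True}" by (auto intro!: exI[of _ "\<lambda>_. 0"])
  next
    fix x y assume "x \<in> {\<Sum>i\<in>I. e i *\<^sub>R a i | e. True}" "y \<in> {\<Sum>i\<in>I. e i *\<^sub>R a i | e. True}"
    then obtain e f where "x = (\<Sum>i\<in>I. e i *\<^sub>R a i)" "y = (\<Sum>i\<in>I. f i *\<^sub>R a i)" by auto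
    then show "x + y \<in> {\<Sum>i\<in>I. e i *\<^sub>R a i | e. True}"
      by (auto intro!: exI[of _ "\<lambda>i. e i + f i"] simp: scaleR_left_distrib sum.distrib)
  next
    fix c x assume "x \<in> {\<Sum>i\<in>I. e i *\<^sub>R a i | e. True}"
    then obtain e where "x = (\<Sum>i\<in>I. e i *\<^sub>R a i)" by auto
    then show "c *\<^sub>R x \<in> {\<Sum>i\<in>I. e i *\<^sub>R a i | e. True}"
      by (auto intro!: exI[of _ "\<lambda>i. c * e i"] simp: scaleR_sum_right)
  qed
  ultimately show "span (a ` I) \<subseteq> {\<Sum>i\<in>I. e i *\<^sub>R a i | e. True}"
    by (intro span_minimal) auto
  show "{\<Sum>i\<in>I. e i *\<^sub>R a i | e. True} \<subseteq> span (a ` I)"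
    by (auto intro!: span_sum span_scale intro: span_base)
qed

text \<open>A subspace is the positive hull of a spanning family and its negatives. This carries the
  measurability of \<open>pos\<close> over to cones with lines.\<close>

lemma ruled_cone_eq_pos:
  assumes I: "finite I" and J: "finite J"
  shows "ruled_cone I a J v = pos (I <+> (I <+> J)) (case_sum a (case_sum (\<lambda>i. - a i) v))"
proof
  show "ruled_cone I a J v \<subseteq> pos (I <+> (I <+> J)) (case_sum a (case_sum (\<lambda>i. - a i) v))"
  proof
    fix z assume "z \<in> ruled_cone I a J v"
    then obtain e c where c: "\<forall>j\<in>J. 0 \<le> c j" and z: "z = (\<Sum>i\<in>I. e i *\<^sub>R a i) + (\<Sum>j\<in>J. c j *\<^sub>R v j)"
      unfolding ruled_cone_def pos_def span_family[OF I] by auto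
    let ?c = "case_sum (\<lambda>i. max (e i) 0) (case_sum (\<lambda>i. max (- e i) 0) c)"
    have "e i *\<^sub>R a i = max (e i) 0 *\<^sub>R a i + max (- e i) 0 *\<^sub>R (- a i)" for i
      by (simp add: max_def)
    then have "z = (\<Sum>k\<in>I <+> (I <+> J). ?c k *\<^sub>R case_sum a (case_sum (\<lambda>i. - a i) v) k)"
      using I J by (simp add: z sum.Plus sum.distrib[symmetric] add.assoc[symmetric])
    moreover have "\<forall>k\<in>I <+> (I <+> J). 0 \<le> ?c k" using c by auto
    ultimately show "z \<in> pos (I <+> (I <+> J)) (case_sum a (case_sum (\<lambda>i. - a i) v))"
      unfolding pos_def by blast
  qed
  show "pos (I <+> (I <+> J)) (case_sum a (case_sum (\<lambda>i. - a i) v)) \<subseteq> ruled_cone I a J v"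
  proof
    fix z assume "z \<in> pos (I <+> (I <+> J)) (case_sum a (case_sum (\<lambda>i. - a i) v))"
    then obtain c where c: "\<forall>k\<in>I <+> (I <+> J). 0 \<le> c k"
      and z: "z = (\<Sum>k\<in>I <+> (I <+> J). c k *\<^sub>R case_sum a (case_sum (\<lambda>i. - a i) v) k)"
      unfolding pos_def by auto
    have z': "z = (\<Sum>i\<in>I. (c (Inl i) - c (Inr (Inl i))) *\<^sub>R a i) + (\<Sum>j\<in>J. c (Inr (Inr j)) *\<^sub>R v j)"
      using I J by (simp add: z sum.Plus sum.distrib[symmetric] add.assoc[symmetric] scaleR_diff_left)
    show "z \<in> ruled_cone I a J v"
      unfolding ruled_cone_def
    proof (intro CollectI exI conjI)
      show "z = (\<Sum>i\<in>I. (c (Inl i) - c (Inr (Inl i))) *\<^sub>R a i) + (\<Sum>j\<in>J. c (Inr (Inr j)) *\<^sub>R v j)" by fact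
      show "(\<Sum>i\<in>I. (c (Inl i) - c (Inr (Inl i))) *\<^sub>R a i) \<in> span (a ` I)"
        by (intro span_sum span_scale span_base imageI)
      show "(\<Sum>j\<in>J. c (Inr (Inr j)) *\<^sub>R v j) \<in> pos J v"
        using c unfolding pos_def by (intro CollectI exI[of _ "\<lambda>j. c (Inr (Inr j))"]) auto
    qed
  qed
qed

lemma measurable_ruled_cone:
  fixes a :: "'w \<Rightarrow> 'i \<Rightarrow> 'a::euclidean_space"
  assumes I: "finite I" and J: "finite J"
    and a: "\<And>i. i \<in> I \<Longrightarrow> (\<lambda>\<omega>. a \<omega> i) \<in> borel_measurable M"
    and v: "\<And>j. j \<in> J \<Longrightarrow> (\<lambda>\<omega>. v \<omega> j) \<in> borel_measurable M"
  shows "(\<lambda>\<omega>. ruled_cone I (a \<omega>) J (v \<omega>)) \<in> measurable M cone_space"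
  unfolding ruled_cone_eq_pos[OF I J]
  by (rule measurable_pos) (use I J a v in auto)

section \<open>Merging points\<close>

lemma sgn_mult_norm: "norm x *\<^sub>R sgn x = (x :: 'a::real_normed_vector)"
  by (cases "x = 0") (auto simp: sgn_div_norm)

text \<open>\<open>a k\<close> is one of the spanning directions, so moving the base point along it
  changes all differences by an element of the span only.\<close>

lemma ruled_cone_move_base:
  assumes J: "finite J" and k: "k \<in> I0"
  shows "ruled_cone (I0 \<union> I) (\<lambda>i. if i \<in> I0 then a i else f i - (x + t *\<^sub>R a k)) J (\<lambda>j. y j - (x + t *\<^sub>R a k)) =
    ruled_cone (I0 \<union> I) (\<lambda>i. if i \<in> I0 then a i else f i - x) J (\<lambda>j. y j - x)"
proof (rule ruled_cone_cong[OF J])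
  define p where "p = (\<lambda>i. if i \<in> I0 then a i else f i - (x + t *\<^sub>R a k))"
  define q where "q = (\<lambda>i. if i \<in> I0 then a i else f i - x)"
  have "p k = a k" "q k = a k" using k by (auto simp: p_def q_def)
  then have base: "t *\<^sub>R a k \<in> span (p ` (I0 \<union> I))" "t *\<^sub>R a k \<in> span (q ` (I0 \<union> I))"
    using k by (metis UnI1 imageI span_base span_scale)+
  have pq: "p i = q i \<or> p i = q i - t *\<^sub>R a k" "q i = p i \<or> q i = p i + t *\<^sub>R a k" for i
    by (auto simp: p_def q_def)
  have "p i \<in> span (q ` (I0 \<union> I))" "q i \<in> span (p ` (I0 \<union> I))" if "i \<in> I0 \<union> I" for i
  proof -
    have "q i \<in> span (q ` (I0 \<union> I))" "p i \<in> span (p ` (I0 \<union> I))"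
      using that by (auto intro: span_base)
    then show "p i \<in> span (q ` (I0 \<union> I))" "q i \<in> span (p ` (I0 \<union> I))"
      using pq[of i] base span_diff span_add by metis+
  qed
  then show "span (p ` (I0 \<union> I)) = span (q ` (I0 \<union> I))"
    unfolding span_eq by blast
  show "y j - (x + t *\<^sub>R a k) - (y j - x) \<in> span (q ` (I0 \<union> I))" for j
    using span_neg[OF base(2)] by simp
qed

lemma ruled_cone_orth:
  assumes J: "finite J" and k: "k \<in> I0" "a k = u"
  shows "ruled_cone (I0 \<union> I) (\<lambda>i. if i \<in> I0 then a i else f i - orth u x) J (\<lambda>j. y j - orth u x) =
    ruled_cone (I0 \<union> I) (\<lambda>i. if i \<in> I0 then a i else f i - x) J (\<lambda>j. y j - x)"
proof -
  have "x + (- (x \<bullet> u)) *\<^sub>R a k = orth u x" by (simp add: k orth_def)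
  from ruled_cone_move_base[OF J k(1), where a=a and t="- (x \<bullet> u)" and x=x, unfolded this] show ?thesis .
qed

text \<open>The points with indices in \<open>K\<close> are merged into the base point \<open>x\<close> one by one: a point \<open>f k\<close>
  is traded for the direction of the line through \<open>x\<close> and \<open>f k\<close>, and \<open>x\<close> is moved along this line
  to the point closest to the origin.\<close>

lemma merge_points:
  fixes g :: "'a::euclidean_space set \<Rightarrow> ennreal" and a :: "'i \<Rightarrow> 'a"
  defines "B \<equiv> \<lambda>c. beta_distr (c - real DIM('a) / 2) :: 'a measure"
  assumes g[measurable]: "g \<in> borel_measurable cone_space" and J: "finite J"
    and "finite K" "finite K0" "K0 \<inter> K = {}"
    and d: "K = {} \<or> 2 \<le> DIM('a)"
    and "\<gamma>0 \<ge> real DIM('a) / 2 - 1" "\<And>i. i \<in> K \<Longrightarrow> \<gamma> i \<ge> real DIM('a) / 2 - 1"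
  shows "(\<integral>\<^sup>+x. (\<integral>\<^sup>+f. g (ruled_cone (K0 \<union> K) (\<lambda>i. if i \<in> K0 then a i else f i - x) J (\<lambda>j. y j - x)) \<partial>PiM K (\<lambda>i. B (\<gamma> i))) \<partial>B \<gamma>0) =
    (\<integral>\<^sup>+x. (\<integral>\<^sup>+u. g (ruled_cone (K0 \<union> K) (\<lambda>i. if i \<in> K0 then a i else u i) J (\<lambda>j. y j - x)) \<partial>PiM K (\<lambda>_. uniform_sphere)) \<partial>B (\<gamma>0 + (\<Sum>i\<in>K. \<gamma> i)))"
  using \<open>finite K\<close> \<open>finite K0\<close> \<open>K0 \<inter> K = {}\<close> d assms(8,9)
\<comment> \<open>\<open>K0\<close> collects the indices already traded for directions
  \<open>a\<close>; the step moves \<open>k\<close> from \<open>K\<close> to \<open>K0\<close> and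
  adds \<open>\<gamma> k\<close> to \<open>\<gamma>0\<close>.\<close>
proof (induction K arbitrary: K0 a \<gamma>0 rule: finite_induct)
  case empty
  have "ruled_cone K0 (\<lambda>i. if i \<in> K0 then a i else f i) J v = ruled_cone K0 a J v" for f v
    unfolding ruled_cone_def by (auto cong: image_cong)
  moreover have "emeasure (PiM {} N) (space (PiM {} N)) = 1" for N :: "'i \<Rightarrow> 'a measure"
    by (intro prob_space.emeasure_space_1 prob_space_PiM) simp
  ultimately show ?case by simp
next
  case (insert k K)
  let ?d = "real DIM('a)"
  have d2: "2 \<le> DIM('a)" using insert.prems by auto
  then have d1: "?d / 2 \<ge> 1" by simp
  have \<gamma>: "\<gamma>0 - ?d / 2 \<ge> -1" "\<gamma> k - ?d / 2 \<ge> -1" "\<And>i. i \<in> K \<Longrightarrow> \<gamma> i - ?d / 2 \<ge> -1"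
    using insert.prems by (auto simp: algebra_simps)
  have fin: "finite (K0 \<union> insert k K)" using insert by auto
  have sets[measurable_cong, simp]: "sets (B c) = sets borel" for c by (simp add: B_def)
  \<comment> \<open>The product locale wants a sigma-finite measure at every index; indices outside
    \<open>insert k K\<close> get the uniform distribution as a default.\<close>
  interpret K: product_sigma_finite "\<lambda>i. if i \<in> insert k K then B (\<gamma> i) else uniform_sphere"
    using \<gamma> by (intro product_sigma_finite.intro prob_space_imp_sigma_finite)
      (auto simp: B_def intro: prob_space_beta_distr prob_space_uniform_sphere)
  interpret S: product_prob_space "\<lambda>_. uniform_sphere :: 'a measure"
    by (intro product_prob_spaceI prob_space_uniform_sphere)
  have PiM: "PiM I (\<lambda>i. if i \<in> insert k K then B (\<gamma> i) else uniform_sphere) = PiM I (\<lambda>i. B (\<gamma> i))"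
    if "I \<subseteq> insert k K" for I
    using that by (intro PiM_cong) auto
  interpret PK: prob_space "PiM K (\<lambda>i. B (\<gamma> i))"
    using \<gamma> by (intro prob_space_PiM) (auto simp: B_def intro: prob_space_beta_distr)
  \<comment> \<open>The remaining integral once index \<open>k\<close> carries the fixed direction
    \<open>u\<close> and the base point is \<open>x\<close>.\<close>
  define \<Psi> where "\<Psi> u x = (\<integral>\<^sup>+f. g (ruled_cone (insert k K0 \<union> K)
      (\<lambda>i. if i \<in> insert k K0 then (a(k := u)) i else f i - x) J (\<lambda>j. y j - x)) \<partial>PiM K (\<lambda>i. B (\<gamma> i)))" for u x
  have meas: "(\<lambda>z. ruled_cone (insert k K0 \<union> K) (\<lambda>i. if i \<in> insert k K0 then (a(k := fst (fst z))) i else snd z i - snd (fst z)) J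
       (\<lambda>j. y j - snd (fst z))) \<in> (borel \<Otimes>\<^sub>M borel) \<Otimes>\<^sub>M PiM K (\<lambda>i. B (\<gamma> i)) \<rightarrow>\<^sub>M cone_space"
    using insert.hyps insert.prems(1) J
  proof (intro measurable_ruled_cone)
    fix i assume "i \<in> insert k K0 \<union> K"
    then show "(\<lambda>z. if i \<in> insert k K0 then (a(k := fst (fst z))) i else snd z i - snd (fst z))
      \<in> borel_measurable ((borel \<Otimes>\<^sub>M borel) \<Otimes>\<^sub>M PiM K (\<lambda>i. B (\<gamma> i)))"
      by (cases "i = k"; cases "i \<in> K0") auto
  qed auto
  have \<Psi>[measurable]: "(\<lambda>(u, x). \<Psi> u x) \<in> borel_measurable (borel \<Otimes>\<^sub>M borel)"
    unfolding \<Psi>_def case_prod_beta'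
    by (rule PK.borel_measurable_nn_integral) (use measurable_compose[OF meas g] in \<open>simp add: case_prod_beta'\<close>)
  have "k \<notin> K0" using insert.prems by auto
  have 1: "(\<integral>\<^sup>+f. g (ruled_cone (K0 \<union> insert k K) (\<lambda>i. if i \<in> K0 then a i else f i - x) J (\<lambda>j. y j - x)) \<partial>PiM (insert k K) (\<lambda>i. B (\<gamma> i)))
     = (\<integral>\<^sup>+z. \<Psi> (sgn (z - x)) (orth (sgn (z - x)) x) \<partial>B (\<gamma> k))" (is "(\<integral>\<^sup>+f. ?F f \<partial>_) = _") for x
  proof -
    have F: "?F \<in> borel_measurable (PiM (insert k K) (\<lambda>i. if i \<in> insert k K then B (\<gamma> i) else uniform_sphere))"
    proof (intro measurable_compose[OF measurable_ruled_cone g] fin J)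
      fix i assume "i \<in> K0 \<union> insert k K"
      then show "(\<lambda>f. if i \<in> K0 then a i else f i - x) \<in> borel_measurable (PiM (insert k K) (\<lambda>i. if i \<in> insert k K then B (\<gamma> i) else uniform_sphere))"
        by (cases "i \<in> K0") (auto intro!: borel_measurable_diff measurable_PiM_component_rev measurable_component_singleton[THEN measurable_compose])
    qed auto
    have "(\<integral>\<^sup>+f. ?F f \<partial>PiM (insert k K) (\<lambda>i. B (\<gamma> i))) = (\<integral>\<^sup>+z. (\<integral>\<^sup>+f. ?F (f(k := z)) \<partial>PiM K (\<lambda>i. B (\<gamma> i))) \<partial>B (\<gamma> k))"
      using K.product_nn_integral_insert_rev[OF insert.hyps F] unfolding PiM[OF order_refl] PiM[OF subset_insertI] by simp
    also have "\<dots> = (\<integral>\<^sup>+z. \<Psi> (sgn (z - x)) (orth (sgn (z - x)) x) \<partial>B (\<gamma> k))"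
      unfolding \<Psi>_def
    proof (intro nn_integral_cong arg_cong[where f=g])
      fix z f
      define u where "u = sgn (z - x)"
      define p where "p = (\<lambda>i. if i \<in> K0 then a i else (f(k := z)) i - x)"
      define q where "q = (\<lambda>i. if i \<in> insert k K0 then (a(k := u)) i else f i - x)"
      have pq: "p i = q i" if "i \<noteq> k" for i using that by (auto simp: p_def q_def)
      \<comment> \<open>A difference and its direction are multiples of each other; for
        \<open>z = x\<close> both are 0, as \<open>sgn 0 = 0\<close> and
        \<open>inverse 0 = 0\<close>.\<close>
      have pk: "p k = norm (z - x) *\<^sub>R q k"
        using \<open>k \<notin> K0\<close> by (simp add: p_def q_def u_def sgn_mult_norm)
      have qk: "q k = inverse (norm (z - x)) *\<^sub>R p k"
        using \<open>k \<notin> K0\<close> by (simp add: p_def q_def u_def sgn_div_norm)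
      have "p i \<in> span (q ` (insert k K0 \<union> K))" "q i \<in> span (p ` (K0 \<union> insert k K))" if i: "i \<in> K0 \<union> insert k K" for i
      proof -
        have "p i \<in> span (p ` (K0 \<union> insert k K))" "q i \<in> span (q ` (insert k K0 \<union> K))"
          using i by (auto intro: span_base)
        then show "p i \<in> span (q ` (insert k K0 \<union> K))" "q i \<in> span (p ` (K0 \<union> insert k K))"
          using pk qk pq[of i] span_scale by metis+
      qed
      then have "span (p ` (K0 \<union> insert k K)) = span (q ` (insert k K0 \<union> K))"
        unfolding span_eq by blast
      then have "ruled_cone (K0 \<union> insert k K) p J (\<lambda>j. y j - x) = ruled_cone (insert k K0 \<union> K) q J (\<lambda>j. y j - x)"
        using J by (intro ruled_cone_cong) (auto simp: span_0)
      also have "\<dots> = ruled_cone (insert k K0 \<union> K) (\<lambda>i. if i \<in> insert k K0 then (a(k := u)) i else f i - orth u x) J (\<lambda>j. y j - orth u x)"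
        unfolding q_def by (rule ruled_cone_orth[symmetric, OF J, of k]) auto
      finally show "ruled_cone (K0 \<union> insert k K) (\<lambda>i. if i \<in> K0 then a i else (f(k := z)) i - x) J (\<lambda>j. y j - x) = ruled_cone (insert k K0 \<union> K)
         (\<lambda>i. if i \<in> insert k K0 then (a(k := sgn (z - x))) i else f i - orth (sgn (z - x)) x) J (\<lambda>j. y j - orth (sgn (z - x)) x)"
        unfolding u_def p_def .
    qed
    finally show ?thesis .
  qed
  have "(\<integral>\<^sup>+x. (\<integral>\<^sup>+f. g (ruled_cone (K0 \<union> insert k K) (\<lambda>i. if i \<in> K0 then a i else f i - x) J (\<lambda>j. y j - x)) \<partial>PiM (insert k K) (\<lambda>i. B (\<gamma> i))) \<partial>B \<gamma>0)
    = (\<integral>\<^sup>+x. (\<integral>\<^sup>+z. \<Psi> (sgn (z - x)) (orth (sgn (z - x)) x) \<partial>B (\<gamma> k)) \<partial>B \<gamma>0)"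
    by (intro nn_integral_cong 1)
  also have "\<dots> = (\<integral>\<^sup>+u. (\<integral>\<^sup>+x. \<Psi> u (orth u x) \<partial>B (\<gamma>0 + \<gamma> k)) \<partial>uniform_sphere)"
    using line_through_two_points[OF d2 \<Psi> \<gamma>(1,2)] unfolding B_def by (simp add: algebra_simps)
  \<comment> \<open>Since \<open>u\<close> is now among the spanning directions, projecting the base
    point along \<open>u\<close> leaves the cone unchanged.\<close>
  also have "\<dots> = (\<integral>\<^sup>+u. (\<integral>\<^sup>+x. \<Psi> u x \<partial>B (\<gamma>0 + \<gamma> k)) \<partial>uniform_sphere)"
  proof (intro nn_integral_cong)
    fix u x
    show "\<Psi> u (orth u x) = \<Psi> u x"
      unfolding \<Psi>_def
      by (intro nn_integral_cong arg_cong[where f=g] ruled_cone_orth[OF J, of k]) auto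
  qed
  also have "\<dots> = (\<integral>\<^sup>+u. (\<integral>\<^sup>+x. (\<integral>\<^sup>+u'. g (ruled_cone (insert k K0 \<union> K) (\<lambda>i. if i \<in> insert k K0 then (a(k := u)) i else u' i) J (\<lambda>j. y j - x)) \<partial>PiM K (\<lambda>_. uniform_sphere)) \<partial>B (\<gamma>0 + \<gamma> k + (\<Sum>i\<in>K. \<gamma> i))) \<partial>uniform_sphere)"
  proof (rule nn_integral_cong)
    fix u :: 'a
    show "(\<integral>\<^sup>+x. \<Psi> u x \<partial>B (\<gamma>0 + \<gamma> k)) = (\<integral>\<^sup>+x. (\<integral>\<^sup>+u'. g (ruled_cone (insert k K0 \<union> K) (\<lambda>i. if i \<in> insert k K0 then (a(k := u)) i else u' i) J (\<lambda>j. y j - x)) \<partial>PiM K (\<lambda>_. uniform_sphere)) \<partial>B (\<gamma>0 + \<gamma> k + (\<Sum>i\<in>K. \<gamma> i)))"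
      unfolding \<Psi>_def
    proof (rule insert.IH)
      \<comment> \<open>Dimension at least 2 makes \<open>\<gamma> k\<close> nonnegative.\<close>
      show "?d / 2 - 1 \<le> \<gamma>0 + \<gamma> k" using \<gamma>(1,2) d1 by linarith
    qed (use insert.prems insert.hyps d2 in auto)
  qed
  also have "\<dots> = (\<integral>\<^sup>+x. (\<integral>\<^sup>+u. g (ruled_cone (K0 \<union> insert k K) (\<lambda>i. if i \<in> K0 then a i else u i) J (\<lambda>j. y j - x)) \<partial>PiM (insert k K) (\<lambda>_. uniform_sphere)) \<partial>B (\<gamma>0 + (\<Sum>i\<in>insert k K. \<gamma> i)))"
    (is "?l = _")
  proof -
    define \<gamma>' where "\<gamma>' = \<gamma>0 + \<gamma> k + (\<Sum>i\<in>K. \<gamma> i)"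
    have "(\<Sum>i\<in>K. \<gamma> i) \<ge> (\<Sum>i\<in>K. 0)"
      using \<gamma>(3) d1 by (intro sum_mono) force
    then have \<gamma>': "\<gamma>' - ?d / 2 \<ge> -1" using \<gamma>(1,2) d1 by (simp add: \<gamma>'_def)
    interpret B': prob_space "B \<gamma>'" using \<gamma>' by (simp add: B_def prob_space_beta_distr)
    interpret P: pair_sigma_finite "B \<gamma>'" "uniform_sphere :: 'a measure" ..
    interpret PS: prob_space "PiM K (\<lambda>_. uniform_sphere :: 'a measure)"
      by (intro prob_space_PiM prob_space_uniform_sphere)
    let ?G = "\<lambda>x u. g (ruled_cone (K0 \<union> insert k K) (\<lambda>i. if i \<in> K0 then a i else u i) J (\<lambda>j. y j - x))"
    have G: "?G x \<in> borel_measurable (PiM (insert k K) (\<lambda>_. uniform_sphere))" for x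
    proof (intro measurable_compose[OF measurable_ruled_cone g] fin J)
      fix i assume "i \<in> K0 \<union> insert k K"
      then show "(\<lambda>f. if i \<in> K0 then a i else f i) \<in> borel_measurable (PiM (insert k K) (\<lambda>_. uniform_sphere))"
        by (cases "i \<in> K0") auto
    qed auto
    have G': "(\<lambda>z. ?G (fst (fst z)) ((snd z)(k := snd (fst z)))) \<in> borel_measurable ((borel \<Otimes>\<^sub>M borel) \<Otimes>\<^sub>M PiM K (\<lambda>_. uniform_sphere))"
    proof (intro measurable_compose[OF measurable_ruled_cone g] fin J)
      fix i assume "i \<in> K0 \<union> insert k K"
      then show "(\<lambda>z. if i \<in> K0 then a i else ((snd z)(k := snd (fst z))) i) \<in> borel_measurable ((borel \<Otimes>\<^sub>M borel) \<Otimes>\<^sub>M PiM K (\<lambda>_. uniform_sphere))"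
        by (cases "i \<in> K0"; cases "i = k") auto
    qed auto
    have e: "(\<lambda>i. if i \<in> insert k K0 then (a(k := u)) i else u' i) = (\<lambda>i. if i \<in> K0 then a i else (u'(k := u)) i)" for u u'
      using \<open>k \<notin> K0\<close> by auto
    have "?l = (\<integral>\<^sup>+u. (\<integral>\<^sup>+x. (\<integral>\<^sup>+u'. ?G x (u'(k := u)) \<partial>PiM K (\<lambda>_. uniform_sphere)) \<partial>B \<gamma>') \<partial>uniform_sphere)"
      unfolding e \<gamma>'_def by simp
    also have "\<dots> = (\<integral>\<^sup>+x. (\<integral>\<^sup>+u. (\<integral>\<^sup>+u'. ?G x (u'(k := u)) \<partial>PiM K (\<lambda>_. uniform_sphere)) \<partial>uniform_sphere) \<partial>B \<gamma>')"
    proof (rule P.Fubini')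
      have "(\<lambda>z. \<integral>\<^sup>+u'. ?G (fst z) (u'(k := snd z)) \<partial>PiM K (\<lambda>_. uniform_sphere)) \<in> borel_measurable (borel \<Otimes>\<^sub>M borel)"
        by (rule PS.borel_measurable_nn_integral) (use G' in \<open>simp add: case_prod_beta'\<close>)
      then show "(\<lambda>(x, u). \<integral>\<^sup>+u'. ?G x (u'(k := u)) \<partial>PiM K (\<lambda>_. uniform_sphere)) \<in> borel_measurable (B \<gamma>' \<Otimes>\<^sub>M uniform_sphere)"
        by (simp add: case_prod_beta' cong: measurable_cong_sets sets_pair_measure_cong)
    qed
    also have "\<dots> = (\<integral>\<^sup>+x. (\<integral>\<^sup>+u. ?G x u \<partial>PiM (insert k K) (\<lambda>_. uniform_sphere)) \<partial>B \<gamma>')"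
      by (intro nn_integral_cong S.product_nn_integral_insert_rev[symmetric] insert.hyps G)
    finally show ?thesis
      using insert.hyps by (simp add: \<gamma>'_def add.assoc)
  qed
  finally show ?case .
qed

section \<open>Measurable alignment of subspaces\<close>

text \<open>The Householder reflection in the hyperplane orthogonal to \<open>w\<close>. For
  \<open>w = 0\<close> division by zero makes it the identity, which is right when the two vectors
  to be exchanged are equal.\<close>

definition reflection :: "'a::euclidean_space \<Rightarrow> 'a \<Rightarrow> 'a" where
  "reflection w x = x - (2 * (w \<bullet> x) / (w \<bullet> w)) *\<^sub>R w"

lemma orthogonal_transformation_reflection: "orthogonal_transformation (reflection w)"
  unfolding orthogonal_transformation
proof
  show "linear (reflection w)"
    by (rule linearI) (auto simp: reflection_def algebra_simps add_divide_distrib)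
  show "\<forall>x. norm (reflection w x) = norm x"
  proof
    fix x
    have "reflection w x \<bullet> reflection w x = x \<bullet> x"
      by (cases "w = 0") (auto simp: reflection_def inner_diff_left inner_diff_right inner_commute field_simps power2_eq_square)
    then show "norm (reflection w x) = norm x" by (simp add: norm_eq_sqrt_inner)
  qed
qed

lemma reflection_swap: "norm a = norm b \<Longrightarrow> reflection (a - b) a = b"
proof (cases "a = b")
  case False
  assume "norm a = norm b"
  then have "b \<bullet> b = a \<bullet> a" by (simp add: norm_eq)
  then have "2 * ((a - b) \<bullet> a) = (a - b) \<bullet> (a - b)"
    by (simp add: inner_diff_left inner_diff_right inner_commute)
  moreover have "(a - b) \<bullet> (a - b) \<noteq> 0" using False by simp
  ultimately show ?thesis by (simp add: reflection_def)
qed (simp add: reflection_def)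

lemma reflection_orthogonal: "w \<bullet> x = 0 \<Longrightarrow> reflection w x = x"
  by (simp add: reflection_def)

text \<open>An unnormalized Gram-Schmidt step: for orthonormal \<open>e\<close> this is the
  component of \<open>y\<close> orthogonal to \<open>e 0\<close>, ...,
  \<open>e (i - 1)\<close>.\<close>

definition perp :: "(nat \<Rightarrow> 'a::euclidean_space) \<Rightarrow> nat \<Rightarrow> 'a \<Rightarrow> 'a" where
  "perp e i y = y - (\<Sum>l<i. (y \<bullet> e l) *\<^sub>R e l)"

text \<open>A product of Householder reflections which moves the span of \<open>u 0, \<dots>, u (m - 1)\<close> into the
  span of the orthonormal vectors \<open>e 0, \<dots>, e (m - 1)\<close>; it depends measurably on \<open>u\<close>.\<close>

primrec align :: "(nat \<Rightarrow> 'a::euclidean_space) \<Rightarrow> (nat \<Rightarrow> 'a) \<Rightarrow> nat \<Rightarrow> 'a \<Rightarrow> 'a" where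
  "align e u 0 x = x"
| "align e u (Suc i) x = reflection (sgn (perp e i (align e u i (u i))) - e i) (align e u i x)"

lemma orthogonal_transformation_align: "orthogonal_transformation (align e u i)"
proof (induction i)
  case 0
  have "align e u 0 = id" by auto
  then show ?case by (simp add: orthogonal_transformation_id)
next
  case (Suc i)
  have *: "align e u (Suc i) = reflection (sgn (perp e i (align e u i (u i))) - e i) \<circ> align e u i" by auto
  show ?case unfolding *
    by (intro orthogonal_transformation_compose orthogonal_transformation_reflection Suc)
qed

lemma measurable_align:
  fixes u :: "'w \<Rightarrow> nat \<Rightarrow> 'a::euclidean_space"
  assumes "\<And>l. l < i \<Longrightarrow> (\<lambda>\<omega>. u \<omega> l) \<in> borel_measurable M" "x \<in> borel_measurable M"
  shows "(\<lambda>\<omega>. align e (u \<omega>) i (x \<omega>)) \<in> borel_measurable M"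
  using assms
proof (induction i arbitrary: x)
  case (Suc i)
  have [measurable]: "(\<lambda>\<omega>. align e (u \<omega>) i (x \<omega>)) \<in> borel_measurable M"
    using Suc.prems by (intro Suc.IH) auto
  have [measurable]: "(\<lambda>\<omega>. align e (u \<omega>) i (u \<omega> i)) \<in> borel_measurable M"
    using Suc.prems by (intro Suc.IH) auto
  show ?case unfolding align.simps reflection_def perp_def by measurable
qed simp

text \<open>The vector of each new reflection is orthogonal to the span of the earlier
  \<open>e\<close>, so what is already aligned stays fixed, while the orthogonal part
  \<open>p\<close> of the next vector is turned into \<open>norm p\<close> times \<open>e i\<close>.
  If \<open>p = 0\<close> there is nothing to turn.\<close>

lemma align_in_span:
  fixes e :: "nat \<Rightarrow> 'a::euclidean_space"
  assumes e: "\<And>i j. i < m \<Longrightarrow> j < m \<Longrightarrow> e i \<bullet> e j = (if i = j then 1 else 0)"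
  shows "i \<le> m \<Longrightarrow> l < i \<Longrightarrow> align e u i (u l) \<in> span (e ` {..<i})"
proof (induction i arbitrary: l)
  case (Suc i)
  let ?y = "align e u i (u i)"
  define p where "p = perp e i ?y"
  let ?R = "reflection (sgn p - e i)"
  have ortho: "x \<bullet> p = 0" "x \<bullet> e i = 0" if x: "x \<in> span (e ` {..<i})" for x
  proof -
    have pe: "p \<bullet> e j = 0" if "j < i" for j
    proof -
      have "(\<Sum>l<i. (?y \<bullet> e l) *\<^sub>R e l) \<bullet> e j = (\<Sum>l<i. if l = j then ?y \<bullet> e l else 0)"
        unfolding inner_sum_left using that Suc.prems e by (intro sum.cong) auto
      then show ?thesis using that by (simp add: p_def perp_def inner_diff_left)
    qed
    have "span (e ` {..<i}) \<subseteq> {x. p \<bullet> x = 0}" "span (e ` {..<i}) \<subseteq> {x. e i \<bullet> x = 0}"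
      using pe Suc.prems e by (intro span_minimal subspace_hyperplane; auto)+
    then show "x \<bullet> p = 0" "x \<bullet> e i = 0" using x by (auto simp: inner_commute)
  qed
  have fix_span: "?R x = x" if "x \<in> span (e ` {..<i})" for x
    using ortho[OF that] by (intro reflection_orthogonal) (simp add: inner_diff_left inner_diff_right sgn_div_norm inner_commute)
  have mono: "span (e ` {..<i}) \<subseteq> span (e ` {..<Suc i})"
    by (intro span_mono) auto
  have linR: "linear ?R"
    using orthogonal_transformation_reflection orthogonal_transformation_linear by blast
  show ?case
  proof (cases "l = i")
    case False
    then have "align e u i (u l) \<in> span (e ` {..<i})" using Suc by auto
    then show ?thesis using fix_span mono by (auto simp: p_def[symmetric])
  next
    case True
    have s: "(\<Sum>l<i. (?y \<bullet> e l) *\<^sub>R e l) \<in> span (e ` {..<i})"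
      by (intro span_sum span_scale span_base) auto
    have y: "?y = (\<Sum>l<i. (?y \<bullet> e l) *\<^sub>R e l) + p" by (simp add: p_def perp_def)
    have "?R p = norm p *\<^sub>R e i"
    proof (cases "p = 0")
      case False
      have "norm (e i) = 1" using e[of i i] Suc.prems by (simp add: norm_eq_1)
      then have "?R (sgn p) = e i" using False by (intro reflection_swap) (simp add: norm_sgn)
      then have "norm p *\<^sub>R e i = ?R (norm p *\<^sub>R sgn p)" by (simp add: linear_scale[OF linR])
      then show ?thesis by (simp add: sgn_mult_norm)
    qed (simp add: reflection_def)
    then have "?R ?y = (\<Sum>l<i. (?y \<bullet> e l) *\<^sub>R e l) + norm p *\<^sub>R e i"
      by (subst y) (simp add: linear_add[OF linR] fix_span[OF s])
    also have "\<dots> \<in> span (e ` {..<Suc i})"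
      by (intro span_add[OF subsetD[OF mono s]] span_scale span_base) auto
    finally show ?thesis using True by (simp add: p_def[symmetric])
  qed
qed simp

text \<open>\<open>align\<close> is injective, so the image has dimension \<open>m\<close>, and the
  inclusion of \<open>align_in_span\<close> becomes an equality.\<close>

lemma image_align_span:
  fixes e :: "nat \<Rightarrow> 'a::euclidean_space"
  assumes e: "\<And>i j. i < m \<Longrightarrow> j < m \<Longrightarrow> e i \<bullet> e j = (if i = j then 1 else 0)"
    and u: "dim (span (u ` {..<m})) = m"
  shows "align e u m ` span (u ` {..<m}) = span (e ` {..<m})"
proof -
  let ?A = "align e u m"
  have lin: "linear ?A" and inj: "inj ?A"
    using orthogonal_transformation_align orthogonal_transformation_linear orthogonal_transformation_inj by blast+
  have img: "?A ` span (u ` {..<m}) = span (?A ` u ` {..<m})" by (rule linear_span_image[OF lin, symmetric])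
  have "?A ` span (u ` {..<m}) \<subseteq> span (e ` {..<m})"
    unfolding img using align_in_span[OF e order_refl] by (intro span_minimal) auto
  moreover have "dim (?A ` span (u ` {..<m})) = m"
    using u inj dim_image_eq[OF lin, of "span (u ` {..<m})"] by (simp add: inj_on_subset)
  moreover have "dim (span (e ` {..<m})) \<le> m"
    using dim_le_card'[of "e ` {..<m}"] card_image_le[of "{..<m}" e] by (simp add: dim_span)
  moreover have "subspace (?A ` span (u ` {..<m}))" by (simp add: img subspace_span)
  ultimately show ?thesis by (intro subspace_dim_equal) auto
qed

lemma coisometryI:
  assumes "linear T" "\<And>x z. T x \<bullet> z = x \<bullet> S z" "\<And>z. T (S z) = z"
  shows "coisometry T"
proof -
  have "adjoint T = S" using assms(2) by (intro adjoint_unique) auto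
  then show ?thesis using assms by (simp add: coisometry_def)
qed

lemma coisometry_compose_orthogonal:
  fixes T :: "'a::euclidean_space \<Rightarrow> 'b::euclidean_space" and A :: "'a \<Rightarrow> 'a"
  assumes T: "coisometry T" and A: "orthogonal_transformation A"
  shows "coisometry (\<lambda>x. T (A x))"
proof (rule coisometryI[where S="\<lambda>z. inv A (adjoint T z)"])
  have linT: "linear T" and TS: "T (adjoint T z) = z" for z using T by (auto simp: coisometry_def)
  have linA: "linear A" and bij: "bij A" using A orthogonal_transformation_linear orthogonal_transformation_bij by blast+
  show "linear (\<lambda>x. T (A x))" using linear_compose[OF linA linT] by (simp add: comp_def)
  have AA: "A (inv A z) = z" for z using bij by (simp add: bij_is_surj surj_f_inv_f)
  then show "T (A (inv A (adjoint T z))) = z" for z by (simp add: TS)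
  show "T (A x) \<bullet> z = x \<bullet> inv A (adjoint T z)" for x z
  proof -
    have "T (A x) \<bullet> z = A x \<bullet> A (inv A (adjoint T z))" by (simp add: AA adjoint_works[OF linT])
    also have "\<dots> = x \<bullet> inv A (adjoint T z)" using A by (simp add: orthogonal_transformation_def)
    finally show ?thesis .
  qed
qed

text \<open>In an orthonormal basis of the first space, \<open>g\<close> reads the first
  \<open>m\<close> coordinates as coordinates in an orthonormal basis of \<open>W\<close>, and
  \<open>T\<close> reads the others as coordinates of the second space. Together they preserve
  norms.\<close>

lemma orthonormal_splitting:
  fixes W :: "'c::euclidean_space set"
  assumes m: "m < DIM('a::euclidean_space)" "DIM('b::euclidean_space) = DIM('a) - m" and W: "subspace W" "dim W = m"
  obtains e :: "nat \<Rightarrow> 'a::euclidean_space" and T :: "'a \<Rightarrow> 'b::euclidean_space" and g :: "'a \<Rightarrow> 'c"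
  where "\<And>i j. i < m \<Longrightarrow> j < m \<Longrightarrow> e i \<bullet> e j = (if i = j then 1 else 0)" "coisometry T" "linear g"
    "\<And>x. x \<in> span (e ` {..<m}) \<Longrightarrow> T x = 0" "g ` span (e ` {..<m}) = W" "\<And>x. g x \<in> W"
    "\<And>x. (norm (g x))\<^sup>2 + (norm (T x))\<^sup>2 = (norm x)\<^sup>2"
proof -
  let ?d = "DIM('a)" and ?q = "DIM('b)"
  obtain e :: "nat \<Rightarrow> 'a" where e: "bij_betw e {0..<?d} Basis"
    using ex_bij_betw_nat_finite[of "Basis :: 'a set"] by auto
  obtain b :: "nat \<Rightarrow> 'b" where b: "bij_betw b {0..<?q} Basis"
    using ex_bij_betw_nat_finite[of "Basis :: 'b set"] by auto
  obtain B where B: "B \<subseteq> W" "pairwise orthogonal B" "\<And>x. x \<in> B \<Longrightarrow> norm x = 1" "independent B" "card B = dim W" "span B = W"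
    using orthonormal_basis_subspace[OF W(1)] by blast
  have "finite B" using B(4) independent_imp_finite by blast
  then obtain w :: "nat \<Rightarrow> 'c" where w: "bij_betw w {0..<m} B"
    using ex_bij_betw_nat_finite[of B] B(5) W(2) by auto
  have ee: "e i \<bullet> e j = (if i = j then 1 else 0)" if "i < ?d" "j < ?d" for i j
  proof -
    have "e i \<in> Basis" "e j \<in> Basis" using e that by (auto simp: bij_betw_def)
    moreover have "e i = e j \<longleftrightarrow> i = j" using e that by (auto simp: bij_betw_def inj_on_def)
    ultimately show ?thesis by (simp add: inner_Basis)
  qed
  have bb: "b i \<bullet> b j = (if i = j then 1 else 0)" if "i < ?q" "j < ?q" for i j
  proof -
    have "b i \<in> Basis" "b j \<in> Basis" using b that by (auto simp: bij_betw_def)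
    moreover have "b i = b j \<longleftrightarrow> i = j" using b that by (auto simp: bij_betw_def inj_on_def)
    ultimately show ?thesis by (simp add: inner_Basis)
  qed
  have ww: "w i \<bullet> w j = (if i = j then 1 else 0)" if "i < m" "j < m" for i j
  proof -
    have "w i \<in> B" "w j \<in> B" using w that by (auto simp: bij_betw_def)
    moreover have "w i = w j \<longleftrightarrow> i = j" using w that by (auto simp: bij_betw_def inj_on_def)
    ultimately show ?thesis
      using B(2,3) by (auto simp: pairwise_def orthogonal_def norm_eq_1[symmetric])
  qed
  have expand: "z = (\<Sum>i<?q. (z \<bullet> b i) *\<^sub>R b i)" for z
    using euclidean_representation[of z] sum.reindex_bij_betw[OF b, of "\<lambda>c. (z \<bullet> c) *\<^sub>R c"]
    by (simp add: atLeast0LessThan)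
  define T where "T x = (\<Sum>i<?q. (x \<bullet> e (m + i)) *\<^sub>R b i)" for x
  define g where "g x = (\<Sum>i<m. (x \<bullet> e i) *\<^sub>R w i)" for x
  have linT: "linear T" and ling: "linear g"
    unfolding T_def g_def
    by (auto intro!: linearI simp: inner_add_left scaleR_left_distrib sum.distrib scaleR_sum_right)
  have "coisometry T"
  proof (rule coisometryI[OF linT, where S="\<lambda>z. \<Sum>i<?q. (z \<bullet> b i) *\<^sub>R e (m + i)"])
    show "T x \<bullet> z = x \<bullet> (\<Sum>i<?q. (z \<bullet> b i) *\<^sub>R e (m + i))" for x z
      unfolding T_def inner_sum_left inner_sum_right by (intro sum.cong) (auto simp: inner_commute)
    show "T (\<Sum>i<?q. (z \<bullet> b i) *\<^sub>R e (m + i)) = z" for z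
    proof -
      have "(\<Sum>i<?q. (z \<bullet> b i) *\<^sub>R e (m + i)) \<bullet> e (m + j) = z \<bullet> b j" if "j < ?q" for j
      proof -
        have "(\<Sum>i<?q. (z \<bullet> b i) *\<^sub>R e (m + i)) \<bullet> e (m + j) = (\<Sum>i<?q. if i = j then z \<bullet> b i else 0)"
          unfolding inner_sum_left using that m by (intro sum.cong) (auto simp: ee)
        then show ?thesis using that by simp
      qed
      then show ?thesis unfolding T_def by (subst (2) expand) (auto intro!: sum.cong)
    qed
  qed
  moreover have "T x = 0" if "x \<in> span (e ` {..<m})" for x
  proof -
    have "span (e ` {..<m}) \<subseteq> {x. T x = 0}"
      using m by (intro span_minimal linear_subspace_kernel linT) (auto simp: T_def ee)
    then show ?thesis using that by auto
  qed
  moreover have "g ` span (e ` {..<m}) = W"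
  proof -
    have "g (e i) = w i" if "i < m" for i
    proof -
      have "g (e i) = (\<Sum>l<m. if l = i then w l else 0)"
        unfolding g_def using that m by (intro sum.cong) (auto simp: ee)
      then show ?thesis using that by simp
    qed
    then have "g ` e ` {..<m} = B" using w by (force simp: bij_betw_def atLeast0LessThan image_image)
    then show ?thesis using linear_span_image[OF ling, of "e ` {..<m}"] B(6) by simp
  qed
  moreover have "g x \<in> W" for x
    unfolding g_def using W(1) w B(1) by (intro subspace_sum subspace_scale) (auto simp: bij_betw_def)
  moreover have "(norm (g x))\<^sup>2 + (norm (T x))\<^sup>2 = (norm x)\<^sup>2" for x
  proof -
    have "(norm (g x))\<^sup>2 = (\<Sum>i<m. (norm ((x \<bullet> e i) *\<^sub>R w i))\<^sup>2)"
      unfolding g_def by (rule norm_sum_Pythagorean) (auto simp: pairwise_def orthogonal_def ww)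
    also have "\<dots> = (\<Sum>i<m. (x \<bullet> e i)\<^sup>2)"
      using ww by (intro sum.cong) (auto simp: norm_eq_sqrt_inner)
    finally have g: "(norm (g x))\<^sup>2 = (\<Sum>i<m. (x \<bullet> e i)\<^sup>2)" .
    have "(norm (T x))\<^sup>2 = (\<Sum>i<?q. (norm ((x \<bullet> e (m + i)) *\<^sub>R b i))\<^sup>2)"
      unfolding T_def by (rule norm_sum_Pythagorean) (auto simp: pairwise_def orthogonal_def bb)
    also have "\<dots> = (\<Sum>i<?q. (x \<bullet> e (m + i))\<^sup>2)"
      using bb by (intro sum.cong) (auto simp: norm_eq_sqrt_inner)
    finally have T: "(norm (T x))\<^sup>2 = (\<Sum>i<?q. (x \<bullet> e (m + i))\<^sup>2)" .
    have split: "(\<Sum>i<m + q. h i) = (\<Sum>i<m. h i) + (\<Sum>i<q. h (m + i))" for q and h :: "nat \<Rightarrow> real"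
      by (induction q) (auto simp: add.assoc)
    have "(norm x)\<^sup>2 = (\<Sum>i<?d. (x \<bullet> e i)\<^sup>2)"
      using sum.reindex_bij_betw[OF e, of "\<lambda>c. (x \<bullet> c)\<^sup>2"]
      by (simp add: norm_eq_sqrt_inner euclidean_inner[of x x] power2_eq_square atLeast0LessThan sum_nonneg)
    also have "\<dots> = (\<Sum>i<m + ?q. (x \<bullet> e i)\<^sup>2)" using m by simp
    also have "\<dots> = (\<Sum>i<m. (x \<bullet> e i)\<^sup>2) + (\<Sum>i<?q. (x \<bullet> e (m + i))\<^sup>2)"
      by (rule split)
    finally show ?thesis using g T by simp
  qed
  ultimately show ?thesis using ling ee m by (intro that[of e T g]) auto
qed

text \<open>After alignment \<open>T\<close> kills the linear part and \<open>g\<close> maps it onto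
  \<open>W\<close>. So the second component sees only the generators, and the first can be adjusted
  freely by vectors of the span.\<close>

lemma isometric_cones_ruled_cone:
  fixes e u :: "nat \<Rightarrow> 'a::euclidean_space" and T :: "'a \<Rightarrow> 'b::euclidean_space" and g :: "'a \<Rightarrow> 'c::euclidean_space"
  assumes e: "\<And>i j. i < m \<Longrightarrow> j < m \<Longrightarrow> e i \<bullet> e j = (if i = j then 1 else 0)" and T: "coisometry T" and g: "linear g"
    and split: "\<And>x. x \<in> span (e ` {..<m}) \<Longrightarrow> T x = 0" "g ` span (e ` {..<m}) = W" "\<And>x. g x \<in> W"
    "\<And>x. (norm (g x))\<^sup>2 + (norm (T x))\<^sup>2 = (norm x)\<^sup>2" and W: "subspace W"
    and u: "dim (span (u ` {..<m})) = m" and J: "finite J"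
  shows "isometric_cones (ruled_cone {..<m} u J v) (W \<times> pos J (\<lambda>j. T (align e u m (v j))))"
proof -
  let ?A = "align e u m"
  have linA: "linear ?A" and normA: "norm (?A x) = norm x" for x
    using orthogonal_transformation_align[of e u m] by (auto simp: orthogonal_transformation)
  have linT: "linear T" using T by (simp add: coisometry_def)
  define f where "f x = (g (?A x), T (?A x))" for x
  have linf: "linear f"
    unfolding f_def by (rule linearI) (auto simp: linear_add linear_scale g linT linA)
  have "norm (f x) = norm x" for x
    using split(4)[of "?A x"] by (simp add: f_def norm_Pair normA)
  moreover have "f ` ruled_cone {..<m} u J v = W \<times> pos J (\<lambda>j. T (?A (v j)))"
  proof
    have sum: "(\<Sum>j\<in>J. c j *\<^sub>R T (?A (v j))) = T (?A (\<Sum>j\<in>J. c j *\<^sub>R v j))" for c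
      by (simp add: linear_sum linear_scale linT linA)
    show "f ` ruled_cone {..<m} u J v \<subseteq> W \<times> pos J (\<lambda>j. T (?A (v j)))"
    proof
      fix z assume "z \<in> f ` ruled_cone {..<m} u J v"
      then obtain x c where x: "x \<in> span (u ` {..<m})" and c: "\<forall>j\<in>J. 0 \<le> c j" and z: "z = f (x + (\<Sum>j\<in>J. c j *\<^sub>R v j))"
        unfolding ruled_cone_def pos_def by auto
      have "T (?A x) = 0" using image_align_span[OF e u] x by (intro split(1)) auto
      then have "snd z = (\<Sum>j\<in>J. c j *\<^sub>R T (?A (v j)))"
        unfolding sum by (simp add: z f_def linear_add linT linA)
      then show "z \<in> W \<times> pos J (\<lambda>j. T (?A (v j)))"
        using c split(3) unfolding pos_def mem_Times_iff by (auto simp: z f_def)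
    qed
    show "W \<times> pos J (\<lambda>j. T (?A (v j))) \<subseteq> f ` ruled_cone {..<m} u J v"
    proof
      fix z assume "z \<in> W \<times> pos J (\<lambda>j. T (?A (v j)))"
      then obtain c where c: "\<forall>j\<in>J. 0 \<le> c j" and z: "fst z \<in> W" "snd z = (\<Sum>j\<in>J. c j *\<^sub>R T (?A (v j)))"
        unfolding pos_def by auto
      let ?y = "\<Sum>j\<in>J. c j *\<^sub>R v j"
      \<comment> \<open>The generators already contribute \<open>g (?A ?y)\<close> to the first
        component; a vector of the span supplies the rest without changing the second.\<close>
      have "fst z - g (?A ?y) \<in> W" using z split(3) W by (intro subspace_diff) auto
      then obtain x where x: "x \<in> span (u ` {..<m})" "g (?A x) = fst z - g (?A ?y)"
        using split(2) image_align_span[OF e u] by (metis (no_types, lifting) imageE)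
      have "T (?A x) = 0" using image_align_span[OF e u] x by (intro split(1)) auto
      then have "f (x + ?y) = z"
        using x z unfolding sum by (simp add: f_def linear_add linT linA g prod_eq_iff)
      moreover have "x + ?y \<in> ruled_cone {..<m} u J v"
        using x c unfolding ruled_cone_def pos_def by blast
      ultimately show "z \<in> f ` ruled_cone {..<m} u J v" by blast
    qed
  qed
  ultimately show ?thesis using linf unfolding isometric_cones_def by blast
qed

section \<open>Tangent cones in general position\<close>

text \<open>Coefficients are indexed by \<open>I\<close> rather than by points, so coinciding points
  need no special treatment.\<close>

lemma convex_hull_family:
  fixes x :: "'i \<Rightarrow> 'a::real_vector"
  assumes I: "finite I"
  shows "convex hull (x ` I) = {\<Sum>i\<in>I. a i *\<^sub>R x i | a. (\<forall>i\<in>I. 0 \<le> a i) \<and> sum a I = 1}" (is "_ = ?R")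
proof
  have "x i \<in> ?R" if "i \<in> I" for i
    using that I
    by (intro CollectI exI[of _ "\<lambda>j. if j = i then 1 else 0"])
      (auto simp: if_distrib[of "\<lambda>c. c *\<^sub>R _"] cong: if_cong)
  moreover have "convex ?R"
  proof (rule convexI)
    fix y z and s t :: real assume "y \<in> ?R" "z \<in> ?R" and st: "0 \<le> s" "0 \<le> t" "s + t = 1"
    then obtain a b where a: "y = (\<Sum>i\<in>I. a i *\<^sub>R x i)" "\<forall>i\<in>I. 0 \<le> a i" "sum a I = 1"
      and b: "z = (\<Sum>i\<in>I. b i *\<^sub>R x i)" "\<forall>i\<in>I. 0 \<le> b i" "sum b I = 1" by blast
    then show "s *\<^sub>R y + t *\<^sub>R z \<in> ?R" using st
      by (intro CollectI exI[of _ "\<lambda>i. s * a i + t * b i"])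
        (auto simp: scaleR_left_distrib sum.distrib scaleR_sum_right sum_distrib_left[symmetric])
  qed
  ultimately show "convex hull (x ` I) \<subseteq> ?R" by (intro hull_minimal) auto
  show "?R \<subseteq> convex hull (x ` I)"
    using I by (auto intro!: convex_sum intro: hull_inc)
qed

text \<open>Homogenization: the cone over the lifted points meets height 1 in the convex hull.
  Membership in a hull becomes membership in a random cone, for which \<open>pred_mem_cone\<close>
  gives measurability.\<close>

lemma mem_convex_hull_iff_pos:
  assumes I: "finite I"
  shows "y \<in> convex hull (x ` I) \<longleftrightarrow> (y, 1::real) \<in> pos I (\<lambda>i. (x i, 1))"
  unfolding convex_hull_family[OF I] pos_def
  by (auto simp: prod_eq_iff fst_sum snd_sum)

lemma independent_family:
  fixes u :: "'i \<Rightarrow> 'a::real_vector"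
  assumes avoid: "\<And>i. i \<in> J \<Longrightarrow> u i \<notin> span (u ` (J - {i}))"
  shows "inj_on u J" "independent (u ` J)"
proof -
  show "inj_on u J"
  proof (rule inj_onI, rule ccontr)
    fix i l assume *: "i \<in> J" "l \<in> J" "u i = u l" "i \<noteq> l"
    then have "u l \<in> span (u ` (J - {i}))" by (intro span_base imageI) auto
    then show False using avoid[OF *(1)] *(3) by simp
  qed
  show "independent (u ` J)"
    unfolding dependent_def
  proof clarify
    fix i assume i: "i \<in> J" "u i \<in> span (u ` J - {u i})"
    have "u ` J - {u i} \<subseteq> u ` (J - {i})" by auto
    from span_mono[OF this] show False using avoid[OF i(1)] i(2) by auto
  qed
qed

locale vertex_family =
  fixes I K :: "'i set" and x :: "'i \<Rightarrow> 'a::euclidean_space"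
  assumes I: "finite I" and K: "K \<subseteq> I" "K \<noteq> {}"
begin

abbreviation F where "F \<equiv> convex hull (x ` K)"
abbreviation P where "P \<equiv> convex hull (x ` I)"
text \<open>The barycentre lies in the relative interior even if vertices coincide or are dependent,
  and it depends measurably on the vertices.\<close>

definition v where "v = (\<Sum>i\<in>K. (1 / card K) *\<^sub>R x i)"
abbreviation C where "C \<equiv> pos I (\<lambda>i. x i - v)"

lemma finite_K: "finite K" using I K finite_subset by blast

lemma card_K: "card K > 0" using finite_K K by (simp add: card_gt_0_iff)

lemma sum_K: "(\<Sum>i\<in>K. x i - v) = 0"
  using card_K by (simp add: v_def sum_subtractf scaleR_sum_right[symmetric] sum_constant_scaleR)

lemma F_subset_P: "F \<subseteq> P" using K by (intro hull_mono) auto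

text \<open>The segment from \<open>y\<close> to the barycentre can be prolonged by the factor
  \<open>1 + 1 / card K\<close>: the barycentre has weights \<open>1 / card K\<close>, and those of
  \<open>y\<close> are at most 1.\<close>

lemma v_in_rel_interior: "v \<in> rel_interior F"
proof -
  have "\<exists>e>1. (1 - e) *\<^sub>R y + e *\<^sub>R v \<in> F" if y: "y \<in> F" for y
  proof -
    let ?k = "real (card K)"
    obtain a where a: "y = (\<Sum>i\<in>K. a i *\<^sub>R x i)" "\<forall>i\<in>K. 0 \<le> a i" "sum a K = 1"
      using y unfolding convex_hull_family[OF finite_K] by blast
    have a1: "a i \<le> 1" if "i \<in> K" for i
      using a that member_le_sum[of i K a] finite_K by auto
    have "(1 - (1 + 1 / ?k)) *\<^sub>R y + (1 + 1 / ?k) *\<^sub>R v = (\<Sum>i\<in>K. ((1 + 1 / ?k) / ?k - a i / ?k) *\<^sub>R x i)"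
      unfolding a(1) v_def scaleR_sum_right sum.distrib[symmetric]
      by (intro sum.cong refl) (simp add: algebra_simps add_divide_distrib)
    moreover have "0 \<le> (1 + 1 / ?k) / ?k - a i / ?k" if "i \<in> K" for i
      using a1[OF that] card_K by (simp add: diff_divide_distrib[symmetric] add_increasing2 algebra_simps)
    moreover have "(\<Sum>i\<in>K. (1 + 1 / ?k) / ?k - a i / ?k) = 1"
    proof -
      have "(\<Sum>i\<in>K. (1 + 1 / ?k) / ?k - a i / ?k) = ?k * ((1 + 1 / ?k) / ?k) - sum a K / ?k"
        by (simp only: sum_subtractf sum_divide_distrib sum_constant)
      then show ?thesis using card_K by (simp add: a(3))
    qed
    ultimately have "(1 - (1 + 1 / ?k)) *\<^sub>R y + (1 + 1 / ?k) *\<^sub>R v \<in> F"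
      unfolding convex_hull_family[OF finite_K]
      by (intro CollectI exI[of _ "\<lambda>i. (1 + 1 / ?k) / ?k - a i / ?k"]) auto
    then show ?thesis using card_K by (intro exI[of _ "1 + 1 / ?k"]) auto
  qed
  moreover have "F \<noteq> {}" using K by simp
  ultimately show ?thesis by (simp add: convex_rel_interior_iff)
qed

lemma v_in_F: "v \<in> F" using v_in_rel_interior rel_interior_subset by blast

text \<open>Weights with sum 1 allow \<open>v\<close> to be subtracted inside the combination.
  Conversely \<open>\<epsilon>\<close> is the inverse of the sum of the coefficients; if that sum is
  0, then \<open>y = 0\<close>.\<close>

lemma tangent_cone_of_face:
  assumes "F face_of P" shows "tangent_cone F P = C"
proof -
  have "tangent_cone F P = {y. \<exists>\<epsilon>>0. v + \<epsilon> *\<^sub>R y \<in> P}"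
    using assms v_in_rel_interior by (intro tangent_cone_eq) auto
  also have "\<dots> = C"
  proof
    show "{y. \<exists>\<epsilon>>0. v + \<epsilon> *\<^sub>R y \<in> P} \<subseteq> C"
    proof
      fix y assume "y \<in> {y. \<exists>\<epsilon>>0. v + \<epsilon> *\<^sub>R y \<in> P}"
      then obtain \<epsilon> a where \<epsilon>: "\<epsilon> > 0" and a: "v + \<epsilon> *\<^sub>R y = (\<Sum>i\<in>I. a i *\<^sub>R x i)" "\<forall>i\<in>I. 0 \<le> a i" "sum a I = 1"
        unfolding convex_hull_family[OF I] by blast
      have "\<epsilon> *\<^sub>R y = (\<Sum>i\<in>I. a i *\<^sub>R x i) - sum a I *\<^sub>R v" using a(1,3) by (simp add: algebra_simps)
      also have "\<dots> = (\<Sum>i\<in>I. a i *\<^sub>R (x i - v))" by (simp add: scaleR_diff_right sum_subtractf scaleR_left.sum)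
      finally have "(1 / \<epsilon>) *\<^sub>R (\<epsilon> *\<^sub>R y) = (\<Sum>i\<in>I. (a i / \<epsilon>) *\<^sub>R (x i - v))" by (simp add: scaleR_sum_right)
      then show "y \<in> C" using \<epsilon> a(2) unfolding pos_def by (auto intro!: exI[of _ "\<lambda>i. a i / \<epsilon>"])
    qed
    show "C \<subseteq> {y. \<exists>\<epsilon>>0. v + \<epsilon> *\<^sub>R y \<in> P}"
    proof
      fix y assume "y \<in> C"
      then obtain c where c: "\<forall>i\<in>I. 0 \<le> c i" "y = (\<Sum>i\<in>I. c i *\<^sub>R (x i - v))" unfolding pos_def by auto
      show "y \<in> {y. \<exists>\<epsilon>>0. v + \<epsilon> *\<^sub>R y \<in> P}"
      proof (cases "sum c I = 0")
        case True
        then have "c i = 0" if "i \<in> I" for i using that c(1) I by (simp add: sum_nonneg_eq_0_iff)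
        then have "y = 0" using c(2) by simp
        then show ?thesis using v_in_F F_subset_P by (auto intro!: exI[of _ 1])
      next
        case False
        then have s: "sum c I > 0" using sum_nonneg[of I c] c(1) by fastforce
        have "v + (1 / sum c I) *\<^sub>R y = v + (1 / sum c I) *\<^sub>R ((\<Sum>i\<in>I. c i *\<^sub>R x i) - sum c I *\<^sub>R v)"
          by (simp add: c(2) scaleR_diff_right sum_subtractf scaleR_left.sum)
        also have "\<dots> = (\<Sum>i\<in>I. (c i / sum c I) *\<^sub>R x i)"
          using s by (simp add: scaleR_diff_right scaleR_sum_right)
        also have "\<dots> \<in> P"
          using s c(1) unfolding convex_hull_family[OF I]
          by (intro CollectI exI[of _ "\<lambda>i. c i / sum c I"]) (auto simp: sum_divide_distrib[symmetric])
        finally show ?thesis using s by (auto intro!: exI[of _ "1 / sum c I"])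
      qed
    qed
  qed
  finally show ?thesis .
qed

text \<open>If \<open>v - x j\<close> is in \<open>C\<close>, then \<open>v\<close> lies between
  \<open>x j\<close> and a point of \<open>P\<close>, unless \<open>x j = v\<close>. Conversely, a
  segment of \<open>P\<close> through a point of \<open>F\<close> and a segment of \<open>F\<close>
  through \<open>v\<close> combine to a nonnegative relation among the \<open>x i - v\<close> in
  which every vertex used by an endpoint has positive weight. This finite test makes being a face a
  measurable event.\<close>

lemma face_of_iff: "F face_of P \<longleftrightarrow> (\<forall>j\<in>I. v - x j \<in> C \<longrightarrow> x j \<in> F)"
proof
  assume face: "F face_of P"
  show "\<forall>j\<in>I. v - x j \<in> C \<longrightarrow> x j \<in> F"
  proof (intro ballI impI)
    fix j assume j: "j \<in> I" "v - x j \<in> C"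
    then have "v - x j \<in> tangent_cone F P" using tangent_cone_of_face[OF face] by simp
    then obtain \<epsilon> where \<epsilon>: "\<epsilon> > 0" "v + \<epsilon> *\<^sub>R (v - x j) \<in> P"
      using tangent_cone_eq[OF convex_convex_hull face v_in_rel_interior] by auto
    show "x j \<in> F"
    proof (cases "x j = v")
      case False
      let ?w = "v + \<epsilon> *\<^sub>R (v - x j)"
      have "?w - x j = (1 + \<epsilon>) *\<^sub>R (v - x j)" by (simp add: algebra_simps)
      then have "x j \<noteq> ?w" using False \<epsilon> by auto
      moreover have "v = (1 - 1 / (1 + \<epsilon>)) *\<^sub>R x j + (1 / (1 + \<epsilon>)) *\<^sub>R ?w"
      proof -
        have "(1 - 1 / (1 + \<epsilon>)) *\<^sub>R x j + (1 / (1 + \<epsilon>)) *\<^sub>R ?w = x j + (1 / (1 + \<epsilon>)) *\<^sub>R (?w - x j)"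
          by (simp add: algebra_simps)
        also have "\<dots> = v" unfolding \<open>?w - x j = _\<close> using \<epsilon> by simp
        finally show ?thesis ..
      qed
      ultimately have "v \<in> open_segment (x j) ?w"
        using \<epsilon> unfolding in_segment by (intro conjI exI[of _ "1 / (1 + \<epsilon>)"]) auto
      moreover have "x j \<in> P" using j by (simp add: hull_inc)
      ultimately show ?thesis using face v_in_F \<epsilon>(2) unfolding face_of_def by blast
    qed (use v_in_F in simp)
  qed
next
  assume R: "\<forall>j\<in>I. v - x j \<in> C \<longrightarrow> x j \<in> F"
  have main: "a \<in> F" if a: "a \<in> P" "b \<in> P" and w: "w \<in> F" "w \<in> open_segment a b" for a b w
  proof -
    obtain t where t: "0 < t" "t < 1" "w = (1 - t) *\<^sub>R a + t *\<^sub>R b" using w(2) by (auto simp: in_segment)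
    have "F \<noteq> {}" using K by simp
    then obtain e where e: "e > 1" "(1 - e) *\<^sub>R w + e *\<^sub>R v \<in> F"
      using v_in_rel_interior w(1) convex_rel_interior_iff[of F v] by auto
    \<comment> \<open>\<open>f\<close> lies in \<open>F\<close> beyond \<open>v\<close> as seen from
      \<open>w\<close>, so \<open>e *\<^sub>R v = f + (e - 1) *\<^sub>R w\<close>; expanding
      \<open>f\<close> and \<open>w\<close> in vertices gives the coefficients \<open>c\<close> with
      sum \<open>e\<close>.\<close>
    define f where "f = (1 - e) *\<^sub>R w + e *\<^sub>R v"
    have fP: "f \<in> P" using e(2) F_subset_P unfolding f_def by blast
    obtain \<alpha> where \<alpha>: "a = (\<Sum>i\<in>I. \<alpha> i *\<^sub>R x i)" "\<forall>i\<in>I. 0 \<le> \<alpha> i" "sum \<alpha> I = 1"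
      using a(1) unfolding convex_hull_family[OF I] by blast
    obtain \<eta> where \<eta>: "b = (\<Sum>i\<in>I. \<eta> i *\<^sub>R x i)" "\<forall>i\<in>I. 0 \<le> \<eta> i" "sum \<eta> I = 1"
      using a(2) unfolding convex_hull_family[OF I] by blast
    obtain \<phi> where \<phi>: "f = (\<Sum>i\<in>I. \<phi> i *\<^sub>R x i)" "\<forall>i\<in>I. 0 \<le> \<phi> i" "sum \<phi> I = 1"
      using fP unfolding convex_hull_family[OF I] by blast
    define c where "c i = \<phi> i + (e - 1) * ((1 - t) * \<alpha> i + t * \<eta> i)" for i
    have c0: "0 \<le> c i" if "i \<in> I" for i
      using that \<phi>(2) \<alpha>(2) \<eta>(2) e t by (auto simp: c_def)
    have "(\<Sum>i\<in>I. c i *\<^sub>R x i) = f + (e - 1) *\<^sub>R w"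
      unfolding \<phi>(1) t(3) \<alpha>(1) \<eta>(1) c_def
      by (simp add: scaleR_left_distrib sum.distrib scaleR_right_distrib scaleR_sum_right mult.assoc distrib_left)
    also have "\<dots> = e *\<^sub>R v" by (simp add: f_def algebra_simps)
    finally have cx: "(\<Sum>i\<in>I. c i *\<^sub>R x i) = e *\<^sub>R v" .
    have "sum c I = sum \<phi> I + (e - 1) * ((1 - t) * sum \<alpha> I + t * sum \<eta> I)"
      by (simp add: c_def sum.distrib sum_distrib_left distrib_left mult.assoc)
    then have ce: "sum c I = e" by (simp add: \<phi>(3) \<alpha>(3) \<eta>(3))
    have 0: "(\<Sum>i\<in>I. c i *\<^sub>R (x i - v)) = 0"
      using cx ce by (simp add: scaleR_diff_right sum_subtractf scaleR_left.sum[symmetric])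
    have "x j \<in> F" if j: "j \<in> I" "\<alpha> j \<noteq> 0" for j
    proof -
      have "(1 - t) * \<alpha> j > 0" using j \<alpha>(2) t by (intro mult_pos_pos) (auto simp: less_le)
      moreover have "t * \<eta> j \<ge> 0" using j \<eta>(2) t by auto
      ultimately have "(e - 1) * ((1 - t) * \<alpha> j + t * \<eta> j) > 0" using e by (intro mult_pos_pos) auto
      then have cj: "c j > 0" using \<phi>(2) j by (simp add: c_def add_nonneg_pos)
      have "(\<Sum>i\<in>I. c i *\<^sub>R (x i - v)) = c j *\<^sub>R (x j - v) + (\<Sum>i\<in>I - {j}. c i *\<^sub>R (x i - v))"
        using I j by (intro sum.remove) auto
      then have "c j *\<^sub>R (v - x j) = (\<Sum>i\<in>I - {j}. c i *\<^sub>R (x i - v))"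
        using 0 by (simp add: algebra_simps)
      then have "(1 / c j) *\<^sub>R (c j *\<^sub>R (v - x j)) = (\<Sum>i\<in>I - {j}. (c i / c j) *\<^sub>R (x i - v))"
        by (simp add: scaleR_sum_right)
      then have "v - x j = (\<Sum>i\<in>I - {j}. (c i / c j) *\<^sub>R (x i - v))" using cj by simp
      also have "\<dots> = (\<Sum>i\<in>I. (if i = j then 0 else c i / c j) *\<^sub>R (x i - v))"
        using I by (intro sum.mono_neutral_cong_left) auto
      finally have "v - x j \<in> C"
        unfolding pos_def using c0 cj by (intro CollectI exI[of _ "\<lambda>i. if i = j then 0 else c i / c j"]) auto
      then show ?thesis using R j by blast
    qed
    moreover have "a = (\<Sum>i\<in>{i\<in>I. \<alpha> i \<noteq> 0}. \<alpha> i *\<^sub>R x i)"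
      unfolding \<alpha>(1) using I by (intro sum.mono_neutral_right) auto
    moreover have "sum \<alpha> {i\<in>I. \<alpha> i \<noteq> 0} = sum \<alpha> I"
      using I by (intro sum.mono_neutral_left) auto
    ultimately show ?thesis using I \<alpha>(2,3) by (auto intro!: convex_sum)
  qed
  show "F face_of P"
    unfolding face_of_def
  proof (intro conjI ballI impI)
    show "F \<subseteq> P" by (rule F_subset_P)
    fix a b w assume "a \<in> P" "b \<in> P" "w \<in> F" "w \<in> open_segment a b"
    then show "a \<in> F" "b \<in> F" using main[of a b w] main[of b a w] by (auto simp: open_segment_commute)
  qed simp
qed

text \<open>The vectors \<open>x i - v\<close> over \<open>K\<close> sum to zero, so a large
  constant can be added to their coefficients: on \<open>K\<close> nonnegativity is no restriction.
  Modulo their span, \<open>v\<close> may be replaced by \<open>x k\<close>.\<close>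

lemma C_eq_ruled_cone:
  assumes k: "k \<in> K"
  shows "C = ruled_cone (K - {k}) (\<lambda>i. x i - x k) (I - K) (\<lambda>j. x j - x k)"
proof -
  have "C = ruled_cone K (\<lambda>i. x i - v) (I - K) (\<lambda>j. x j - v)"
  proof
    show "C \<subseteq> ruled_cone K (\<lambda>i. x i - v) (I - K) (\<lambda>j. x j - v)"
    proof
      fix y assume "y \<in> C"
      then obtain c where c: "\<forall>i\<in>I. 0 \<le> c i" and y: "y = (\<Sum>i\<in>I. c i *\<^sub>R (x i - v))" unfolding pos_def by auto
      have "y = (\<Sum>i\<in>K. c i *\<^sub>R (x i - v)) + (\<Sum>i\<in>I - K. c i *\<^sub>R (x i - v))"
        unfolding y using sum.subset_diff[OF K(1) I] by (simp add: add.commute)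
      moreover have "(\<Sum>i\<in>K. c i *\<^sub>R (x i - v)) \<in> span ((\<lambda>i. x i - v) ` K)"
        by (intro span_sum span_scale span_base imageI)
      moreover have "(\<Sum>i\<in>I - K. c i *\<^sub>R (x i - v)) \<in> pos (I - K) (\<lambda>j. x j - v)"
        using c unfolding pos_def by auto
      ultimately show "y \<in> ruled_cone K (\<lambda>i. x i - v) (I - K) (\<lambda>j. x j - v)"
        unfolding ruled_cone_def by blast
    qed
    show "ruled_cone K (\<lambda>i. x i - v) (I - K) (\<lambda>j. x j - v) \<subseteq> C"
    proof
      fix y assume "y \<in> ruled_cone K (\<lambda>i. x i - v) (I - K) (\<lambda>j. x j - v)"
      then obtain a c where c: "\<forall>j\<in>I - K. 0 \<le> c j"
        and y: "y = (\<Sum>i\<in>K. a i *\<^sub>R (x i - v)) + (\<Sum>j\<in>I - K. c j *\<^sub>R (x j - v))"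
        unfolding ruled_cone_def span_family[OF finite_K] pos_def by auto
      define t where "t = (\<Sum>i\<in>K. \<bar>a i\<bar>)"
      have t: "0 \<le> a i + t" if "i \<in> K" for i
        using member_le_sum[of i K "\<lambda>i. \<bar>a i\<bar>"] finite_K that by (simp add: t_def)
      define c' where "c' i = (if i \<in> K then a i + t else c i)" for i
      have "(\<Sum>i\<in>K. (a i + t) *\<^sub>R (x i - v)) = (\<Sum>i\<in>K. a i *\<^sub>R (x i - v)) + t *\<^sub>R (\<Sum>i\<in>K. x i - v)"
        by (simp add: scaleR_left_distrib sum.distrib scaleR_sum_right)
      then have "(\<Sum>i\<in>K. c' i *\<^sub>R (x i - v)) = (\<Sum>i\<in>K. a i *\<^sub>R (x i - v))"
        using sum_K by (simp add: c'_def)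
      moreover have "(\<Sum>i\<in>I - K. c' i *\<^sub>R (x i - v)) = (\<Sum>j\<in>I - K. c j *\<^sub>R (x j - v))"
        by (intro sum.cong) (auto simp: c'_def)
      ultimately have "y = (\<Sum>i\<in>I. c' i *\<^sub>R (x i - v))"
        unfolding y using sum.subset_diff[OF K(1) I, of "\<lambda>i. c' i *\<^sub>R (x i - v)"] by (simp add: add.commute)
      then show "y \<in> C" using t c unfolding pos_def by (intro CollectI exI[of _ c']) (auto simp: c'_def)
    qed
  qed
  also have "\<dots> = ruled_cone (K - {k}) (\<lambda>i. x i - x k) (I - K) (\<lambda>j. x j - x k)"
  proof (rule ruled_cone_cong)
    let ?S = "span ((\<lambda>i. x i - x k) ` (K - {k}))" and ?T = "span ((\<lambda>i. x i - v) ` K)"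
    have S: "x i - x k \<in> ?S" if "i \<in> K" for i
      using that by (cases "i = k") (auto simp: span_0 intro: span_base)
    have "(\<Sum>i\<in>K. (1 / card K) *\<^sub>R (x i - x k)) \<in> ?S"
      using S by (intro span_sum span_scale) auto
    also have "(\<Sum>i\<in>K. (1 / card K) *\<^sub>R (x i - x k)) = v - x k"
      using card_K by (simp add: v_def scaleR_diff_right sum_subtractf sum_constant_scaleR)
    finally have v: "v - x k \<in> ?S" .
    have "x i - v \<in> ?S" if "i \<in> K" for i
      using span_diff[OF S[OF that] v] by simp
    moreover have "x i - x k \<in> ?T" if "i \<in> K" for i
      using span_diff[OF span_base span_base, of "x i - v" "(\<lambda>i. x i - v) ` K" "x k - v"] that k by simp
    ultimately show "?T = ?S" unfolding span_eq by auto
    show "x j - v - (x j - x k) \<in> ?S" for j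
      using span_neg[OF v] by simp
  qed (use I in auto)
  finally show ?thesis .
qed

text \<open>General position is expressed as linear independence of the lifted points \<open>(x i, 1)\<close>. If \<open>F\<close>
  is not a face, the vectors \<open>x i - v\<close> satisfy a nontrivial relation with nonnegative coefficients;
  by general position its support spans, and a large multiple of it makes all coefficients of any
  linear combination nonnegative.\<close>

lemma not_face_C_UNIV:
  assumes gp: "\<And>J j. J \<subseteq> I \<Longrightarrow> card J \<le> DIM('a) \<Longrightarrow> j \<in> I - J \<Longrightarrow> (x j, 1::real) \<notin> span ((\<lambda>i. (x i, 1)) ` J)"
    and not_face: "\<not> F face_of P"
  shows "C = UNIV"
proof -
  let ?X = "\<lambda>i. (x i, 1::real)"
  obtain j where j: "j \<in> I" "v - x j \<in> C" "x j \<notin> F" using not_face face_of_iff by blast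
  have jK: "j \<notin> K" using j(3) by (auto intro: hull_inc)
  obtain c0 where c0: "\<forall>i\<in>I. 0 \<le> c0 i" "v - x j = (\<Sum>i\<in>I. c0 i *\<^sub>R (x i - v))" using j(2) unfolding pos_def by auto
  \<comment> \<open>This relation is positive at \<open>j\<close> and on all of \<open>K\<close>: to
    the expansion \<open>c0\<close> of \<open>v - x j\<close> the vector \<open>x j - v\<close> and
    the vanishing sum over \<open>K\<close> are added.\<close>
  define c where "c i = c0 i + (if i = j then 1 else 0) + (if i \<in> K then 1 else 0)" for i
  have c: "0 \<le> c i" if "i \<in> I" for i using c0(1) that by (auto simp: c_def)
  have cj: "c j > 0" using c0(1) j(1) by (auto simp: c_def add_nonneg_pos)
  have "(\<Sum>i\<in>I. c i *\<^sub>R (x i - v)) = (v - x j) + (x j - v) + (\<Sum>i\<in>K. x i - v)"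
  proof -
    have "(\<Sum>i\<in>I. (if i = j then 1 else 0) *\<^sub>R (x i - v)) = x j - v"
      using I j(1) by (simp add: if_distrib[of "\<lambda>c. c *\<^sub>R _"] cong: if_cong)
    moreover have "(\<Sum>i\<in>I. (if i \<in> K then 1 else 0) *\<^sub>R (x i - v)) = (\<Sum>i\<in>K. x i - v)"
      using I K(1) by (intro sum.mono_neutral_cong_right) auto
    ultimately show ?thesis by (simp add: c_def scaleR_left_distrib sum.distrib c0(2)[symmetric])
  qed
  then have rel: "(\<Sum>i\<in>I. c i *\<^sub>R (x i - v)) = 0" using sum_K by simp
  define J0 where "J0 = {i\<in>I. c i > 0}"
  have J0: "finite J0" "J0 \<subseteq> I" "j \<in> J0" using I j(1) cj by (auto simp: J0_def)
  have KJ0: "K \<subseteq> J0 - {j}" using K(1) jK c0(1) by (auto simp: J0_def c_def add_nonneg_pos)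
  have "?X j \<in> span (?X ` (J0 - {j}))"
  proof -
    let ?S = "span (?X ` (J0 - {j}))"
    have "(\<Sum>i\<in>I. c i *\<^sub>R ?X i) = sum c I *\<^sub>R (v, 1)"
      using rel by (simp add: prod_eq_iff fst_sum snd_sum scaleR_diff_right sum_subtractf scaleR_left.sum)
    moreover have "(v, 1) = (\<Sum>i\<in>K. (1 / card K) *\<^sub>R ?X i)"
      using card_K by (simp add: prod_eq_iff fst_sum snd_sum v_def)
    moreover have "(\<Sum>i\<in>K. (1 / card K) *\<^sub>R ?X i) \<in> ?S"
      using KJ0 by (intro span_sum span_scale span_base) auto
    ultimately have total: "(\<Sum>i\<in>I. c i *\<^sub>R ?X i) \<in> ?S" by (simp only: span_scale)
    have "(\<Sum>i\<in>I. c i *\<^sub>R ?X i) = (\<Sum>i\<in>J0. c i *\<^sub>R ?X i)"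
      using I c by (intro sum.mono_neutral_right) (auto simp: J0_def less_le zero_prod_def)
    also have "\<dots> = c j *\<^sub>R ?X j + (\<Sum>i\<in>J0 - {j}. c i *\<^sub>R ?X i)"
      using J0 by (intro sum.remove) auto
    finally have "c j *\<^sub>R ?X j = (\<Sum>i\<in>I. c i *\<^sub>R ?X i) - (\<Sum>i\<in>J0 - {j}. c i *\<^sub>R ?X i)"
      by (simp only: add_diff_cancel_right')
    moreover have "(\<Sum>i\<in>J0 - {j}. c i *\<^sub>R ?X i) \<in> ?S"
      by (intro span_sum span_scale span_base imageI)
    ultimately have "c j *\<^sub>R ?X j \<in> ?S" using total by (simp only: span_diff)
    then have "(1 / c j) *\<^sub>R (c j *\<^sub>R ?X j) \<in> ?S" by (rule span_scale)
    then show ?thesis using cj by simp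
  qed
  \<comment> \<open>At most d other lifted points cannot span the lifted \<open>x j\<close> in
    general position. So the support contains d + 1 of them, which form a basis of the lifted
    space.\<close>
  then have "\<not> card (J0 - {j}) \<le> DIM('a)"
    using gp[of "J0 - {j}" j] J0(2) j(1) by auto
  then obtain J1 where J1: "J1 \<subseteq> J0 - {j}" "card J1 = Suc DIM('a)" "finite J1"
    using obtain_subset_with_card_n[of "Suc DIM('a)" "J0 - {j}"] by auto
  have avoid: "?X i \<notin> span (?X ` (J1 - {i}))" if "i \<in> J1" for i
    using that J1 J0(2) by (intro gp) auto
  have inj: "inj_on ?X J1" using avoid by (rule independent_family(1))
  have "independent (?X ` J1)" using avoid by (rule independent_family(2))
  moreover have "card (?X ` J1) = DIM('a \<times> real)" using card_image[OF inj] J1 by simp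
  ultimately have "dim (?X ` J1) = DIM('a \<times> real)" using dim_eq_card_independent by metis
  then have full: "span (?X ` J1) = UNIV" using dim_eq_full by blast
  have "y \<in> C" for y
  proof -
    \<comment> \<open>The last coordinate 0 makes the coefficients sum to 0, so that
      \<open>v\<close> can be subtracted from every \<open>x i\<close>.\<close>
    have "(y, 0) \<in> span (?X ` J1)" using full by simp
    then obtain a where a: "(y, 0) = (\<Sum>i\<in>J1. a i *\<^sub>R ?X i)" unfolding span_family[OF J1(3)] by blast
    then have a0: "sum a J1 = 0" and "y = (\<Sum>i\<in>J1. a i *\<^sub>R x i)"
      by (simp_all add: prod_eq_iff fst_sum snd_sum)
    then have y: "y = (\<Sum>i\<in>J1. a i *\<^sub>R (x i - v))"
      by (simp add: scaleR_diff_right sum_subtractf scaleR_left.sum[symmetric])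
    define t where "t = (\<Sum>i\<in>J1. \<bar>a i\<bar> / c i)"
    have cpos: "c i > 0" if "i \<in> J1" for i using that J1(1) by (auto simp: J0_def)
    have t: "0 \<le> a i + t * c i" if "i \<in> J1" for i
    proof -
      have "\<bar>a i\<bar> / c i \<le> t"
        unfolding t_def using that cpos J1(3) by (intro member_le_sum) (auto intro!: divide_nonneg_pos)
      then have "\<bar>a i\<bar> \<le> t * c i" using cpos[OF that] by (simp add: field_simps)
      then show ?thesis by linarith
    qed
    have t0: "t \<ge> 0" unfolding t_def using cpos by (intro sum_nonneg divide_nonneg_pos) auto
    define c' where "c' i = (if i \<in> J1 then a i else 0) + t * c i" for i
    have "(\<Sum>i\<in>I. (if i \<in> J1 then a i else 0) *\<^sub>R (x i - v)) = y"
      unfolding y using I J1(1) J0(2) by (intro sum.mono_neutral_cong_right) auto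
    then have "(\<Sum>i\<in>I. c' i *\<^sub>R (x i - v)) = y + t *\<^sub>R (\<Sum>i\<in>I. c i *\<^sub>R (x i - v))"
      by (simp add: c'_def scaleR_left_distrib sum.distrib scaleR_sum_right)
    then have "y = (\<Sum>i\<in>I. c' i *\<^sub>R (x i - v))" using rel by simp
    moreover have "\<forall>i\<in>I. 0 \<le> c' i" using t t0 c by (auto simp: c'_def)
    ultimately show ?thesis unfolding pos_def by blast
  qed
  then show ?thesis by auto
qed

lemma tangent_cone_general_position:
  assumes "\<And>J j. J \<subseteq> I \<Longrightarrow> card J \<le> DIM('a) \<Longrightarrow> j \<in> I - J \<Longrightarrow> (x j, 1::real) \<notin> span ((\<lambda>i. (x i, 1)) ` J)"
    and k: "k \<in> K"
  shows "tangent_cone F P = ruled_cone (K - {k}) (\<lambda>i. x i - x k) (I - K) (\<lambda>j. x j - x k)"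
proof (cases "F face_of P")
  case True then show ?thesis using tangent_cone_of_face C_eq_ruled_cone[OF k] by simp
next
  case False
  then have "tangent_cone F P = UNIV" by (simp add: tangent_cone_def)
  then show ?thesis using not_face_C_UNIV[OF assms(1) False] C_eq_ruled_cone[OF k] by simp
qed

end

section \<open>Measurability of the tangent cone\<close>

text \<open>The hitting events of open sets generate the measurable structure. A closed set contains
  \<open>z\<close> iff it hits arbitrarily small balls around points near \<open>z\<close>, and
  countably many centres and radii suffice.\<close>

lemma pred_mem_cone:
  fixes C :: "'w \<Rightarrow> 'a::euclidean_space set"
  assumes C: "C \<in> measurable M cone_space" and z[measurable]: "z \<in> borel_measurable M"
  shows "Measurable.pred M (\<lambda>\<omega>. z \<omega> \<in> C \<omega>)"
proof -
  obtain D :: "'a set" where D: "countable D" "\<And>U. open U \<Longrightarrow> U \<noteq> {} \<Longrightarrow> \<exists>d\<in>D. d \<in> U"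
    by (rule countable_dense_setE) blast
  have closed: "closed (C \<omega>)" if "\<omega> \<in> space M" for \<omega>
    using measurable_space[OF C that] by (simp add: space_cone_space)
  have hit: "Measurable.pred M (\<lambda>\<omega>. C \<omega> \<inter> U \<noteq> {})" if "open U" for U
  proof -
    have hs: "{C :: 'a set. closed C \<and> convex_cone C \<and> C \<inter> U \<noteq> {}} \<in> sets cone_space"
      unfolding cone_space_def using that by (intro in_measure_of) auto
    have eq: "C -` {C. closed C \<and> convex_cone C \<and> C \<inter> U \<noteq> {}} \<inter> space M = {\<omega>\<in>space M. C \<omega> \<inter> U \<noteq> {}}"
      using measurable_space[OF C] by (auto simp: space_cone_space)
    show ?thesis unfolding pred_def eq[symmetric] by (rule measurable_sets[OF C hs])
  qed
  have "z \<omega> \<in> C \<omega> \<longleftrightarrow> (\<forall>n. \<exists>d\<in>D. dist (z \<omega>) d < inverse (real (Suc n)) \<and> C \<omega> \<inter> ball d (inverse (real (Suc n))) \<noteq> {})"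
    (is "_ \<longleftrightarrow> ?R") if "\<omega> \<in> space M" for \<omega>
  proof
    assume z: "z \<omega> \<in> C \<omega>"
    show ?R
    proof
      fix n
      obtain d where "d \<in> D" "d \<in> ball (z \<omega>) (inverse (real (Suc n)))"
        using D(2)[of "ball (z \<omega>) (inverse (real (Suc n)))"] by auto
      then show "\<exists>d\<in>D. dist (z \<omega>) d < inverse (real (Suc n)) \<and> C \<omega> \<inter> ball d (inverse (real (Suc n))) \<noteq> {}"
        using z by (intro bexI[of _ d]) (auto simp: dist_commute)
    qed
  next
    assume R: ?R
    have "z \<omega> \<in> closure (C \<omega>)"
      unfolding closure_approachable
    proof (intro allI impI)
      fix e :: real assume "e > 0"
      then obtain n where n: "inverse (real (Suc n)) < e / 2" using reals_Archimedean[of "e / 2"] by auto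
      from R obtain d y where "dist (z \<omega>) d < inverse (real (Suc n))" "y \<in> C \<omega>" "dist d y < inverse (real (Suc n))" by fastforce
      then have "dist y (z \<omega>) < e"
        using n dist_triangle[of y "z \<omega>" d] by (simp add: dist_commute)
      then show "\<exists>y\<in>C \<omega>. dist y (z \<omega>) < e" using \<open>y \<in> C \<omega>\<close> by blast
    qed
    then show "z \<omega> \<in> C \<omega>" using closed[OF that] by simp
  qed
  moreover have "Measurable.pred M (\<lambda>\<omega>. \<forall>n. \<exists>d\<in>D. dist (z \<omega>) d < inverse (real (Suc n)) \<and> C \<omega> \<inter> ball d (inverse (real (Suc n))) \<noteq> {})"
  proof (intro pred_intros_countable)
    fix n
    have [measurable]: "Measurable.pred M (\<lambda>\<omega>. C \<omega> \<inter> ball d r \<noteq> {})" for d r by (rule hit) simp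
    have P: "Measurable.pred M (\<lambda>\<omega>. dist (z \<omega>) d < inverse (real (Suc n)) \<and> C \<omega> \<inter> ball d (inverse (real (Suc n))) \<noteq> {})" for d
      by measurable
    show "Measurable.pred M (\<lambda>\<omega>. \<exists>d\<in>D. dist (z \<omega>) d < inverse (real (Suc n)) \<and> C \<omega> \<inter> ball d (inverse (real (Suc n))) \<noteq> {})"
      using D(1) P unfolding pred_def by (intro sets.sets_Collect_countable_Ex') auto
  qed
  ultimately show ?thesis by (simp cong: measurable_cong)
qed

text \<open>By \<open>face_of_iff\<close> the case distinction in the tangent cone is decided by
  finitely many memberships in random cones; in the case of a face the cone is the positive hull
  seen from the barycentre.\<close>

lemma measurable_tangent_cone:
  fixes x :: "'w \<Rightarrow> 'i \<Rightarrow> 'a::euclidean_space"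
  assumes I: "finite I" and K: "K \<subseteq> I" "K \<noteq> {}"
    and x[measurable]: "\<And>i. i \<in> I \<Longrightarrow> (\<lambda>\<omega>. x \<omega> i) \<in> borel_measurable M"
  shows "(\<lambda>\<omega>. tangent_cone (convex hull (x \<omega> ` K)) (convex hull (x \<omega> ` I))) \<in> measurable M cone_space"
proof -
  interpret V: vertex_family I K "x \<omega>" for \<omega> using I K by unfold_locales
  have fK: "finite K" using I K finite_subset by blast
  have xK: "(\<lambda>\<omega>. x \<omega> i) \<in> borel_measurable M" if "i \<in> K" for i using that K x by auto
  have v[measurable]: "(\<lambda>\<omega>. V.v \<omega>) \<in> borel_measurable M"
    unfolding V.v_def using xK by (intro borel_measurable_sum borel_measurable_scaleR) auto
  have C: "(\<lambda>\<omega>. pos I (\<lambda>i. x \<omega> i - V.v \<omega>)) \<in> measurable M cone_space"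
    using I by (intro measurable_pos) measurable
  have L: "(\<lambda>\<omega>. pos K (\<lambda>i. (x \<omega> i, 1::real))) \<in> measurable M cone_space"
  proof (rule measurable_pos[OF fK])
    fix i assume "i \<in> K"
    then show "(\<lambda>\<omega>. (x \<omega> i, 1::real)) \<in> borel_measurable M"
      unfolding borel_prod[symmetric] using xK by (intro measurable_Pair) auto
  qed
  have face: "Measurable.pred M (\<lambda>\<omega>. convex hull (x \<omega> ` K) face_of convex hull (x \<omega> ` I))"
    unfolding V.face_of_iff mem_convex_hull_iff_pos[OF fK]
  proof (intro pred_intros_finite I pred_intros_logic pred_mem_cone C L)
    fix j assume j: "j \<in> I"
    show "(\<lambda>\<omega>. V.v \<omega> - x \<omega> j) \<in> borel_measurable M" using j by measurable
    show "(\<lambda>\<omega>. (x \<omega> j, 1::real)) \<in> borel_measurable M"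
      unfolding borel_prod[symmetric] using j by (intro measurable_Pair) auto
  qed
  have "UNIV \<in> space (cone_space :: 'a set measure)"
    by (simp add: space_cone_space convex_cone_def conic_def)
  then have "(\<lambda>\<omega>. if convex hull (x \<omega> ` K) face_of convex hull (x \<omega> ` I) then pos I (\<lambda>i. x \<omega> i - V.v \<omega>) else UNIV)
      \<in> measurable M cone_space"
    using C face unfolding pred_def by (intro measurable_If) auto
  also have "(\<lambda>\<omega>. if convex hull (x \<omega> ` K) face_of convex hull (x \<omega> ` I) then pos I (\<lambda>i. x \<omega> i - V.v \<omega>) else UNIV)
    = (\<lambda>\<omega>. tangent_cone (convex hull (x \<omega> ` K)) (convex hull (x \<omega> ` I)))"
  proof
    fix \<omega>
    show "(if convex hull (x \<omega> ` K) face_of convex hull (x \<omega> ` I) then pos I (\<lambda>i. x \<omega> i - V.v \<omega>) else UNIV)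
      = tangent_cone (convex hull (x \<omega> ` K)) (convex hull (x \<omega> ` I))"
      using V.tangent_cone_of_face[of \<omega>] by (simp add: tangent_cone_def)
  qed
  finally show ?thesis .
qed

section \<open>Independent points in general position\<close>

text \<open>Integrate coordinate \<open>j\<close> first: \<open>S\<close> depends on the others
  alone, so the inner integral vanishes.\<close>

lemma AE_PiM_avoid:
  fixes N :: "'i \<Rightarrow> 'a::euclidean_space measure"
  assumes N: "\<And>i. prob_space (N i)" and sets: "\<And>i. sets (N i) = sets borel"
    and I: "finite I" and j: "j \<in> I" and meas: "Measurable.pred (PiM I N) (\<lambda>\<omega>. \<omega> j \<in> S \<omega>)"
    and S: "\<And>\<omega> z. S (fun_upd \<omega> j z) = S \<omega>" and null: "\<And>\<omega>. AE z in N j. z \<notin> S \<omega>"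
  shows "AE \<omega> in PiM I N. \<omega> j \<notin> S \<omega>"
proof -
  interpret N: product_sigma_finite N
    using N by (intro product_sigma_finite.intro prob_space_imp_sigma_finite)
  define I' where "I' = I - {j}"
  have I': "finite I'" "j \<notin> I'" and II': "I = insert j I'" using I j by (auto simp: I'_def)
  define B where "B = {\<omega>\<in>space (PiM I N). \<omega> j \<in> S \<omega>}"
  have B: "B \<in> sets (PiM I N)" using meas by (simp add: B_def pred_def)
  have "emeasure (PiM I N) B = (\<integral>\<^sup>+\<omega>. indicator B \<omega> \<partial>PiM (insert j I') N)"
    using B by (simp add: II')
  also have "\<dots> = (\<integral>\<^sup>+\<omega>. (\<integral>\<^sup>+z. indicator B (fun_upd \<omega> j z) \<partial>N j) \<partial>PiM I' N)"
    using B I' by (intro N.product_nn_integral_insert) (auto simp: II')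
  also have "\<dots> = (\<integral>\<^sup>+\<omega>. 0 \<partial>PiM I' N)"
  proof (rule nn_integral_cong)
    fix \<omega>
    have "(\<integral>\<^sup>+z. indicator B (fun_upd \<omega> j z) \<partial>N j) = (\<integral>\<^sup>+z. 0 \<partial>N j)"
      using null[of \<omega>] by (intro nn_integral_cong_AE) (auto elim!: eventually_mono simp: B_def S indicator_def)
    then show "(\<integral>\<^sup>+z. indicator B (fun_upd \<omega> j z) \<partial>N j) = 0" by simp
  qed
  finally have "emeasure (PiM I N) B = 0" by simp
  then show ?thesis using B by (subst AE_iff_measurable[of B]) (auto simp: B_def)
qed

text \<open>Makes membership in a random span a case of \<open>pred_mem_cone\<close>.\<close>

lemma ruled_cone_span: "ruled_cone I a {} v = span (a ` I)"
  by (auto simp: ruled_cone_def pos_def)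

text \<open>At most d lifted points lie in a linear hyperplane of the (d + 1)-dimensional lifted
  space, with normal \<open>p\<close>. At height 1 it cuts out a hyperplane of the original space,
  which is null for each point, or nothing if \<open>fst p = 0\<close>.\<close>

lemma AE_general_position:
  fixes N :: "'i \<Rightarrow> 'a::euclidean_space measure"
  assumes N: "\<And>i. prob_space (N i)" "\<And>i. sets (N i) = sets borel" and I: "finite I"
    and null: "\<And>i a c. i \<in> I \<Longrightarrow> a \<noteq> 0 \<Longrightarrow> AE z in N i. z \<bullet> a \<noteq> c"
  shows "AE \<omega> in PiM I N. \<forall>J\<in>Pow I. \<forall>j\<in>I. card J \<le> DIM('a) \<longrightarrow> j \<notin> J \<longrightarrow> (\<omega> j, 1::real) \<notin> span ((\<lambda>i. (\<omega> i, 1)) ` J)"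
proof (intro AE_finite_allI I finite_Pow_iff[THEN iffD2])
  fix J j assume "J \<in> Pow I" and j: "j \<in> I"
  then have J: "J \<subseteq> I" "finite J" using I finite_subset by auto
  note [measurable_cong] = N(2)
  show "AE \<omega> in PiM I N. card J \<le> DIM('a) \<longrightarrow> j \<notin> J \<longrightarrow> (\<omega> j, 1::real) \<notin> span ((\<lambda>i. (\<omega> i, 1)) ` J)"
  proof (cases "card J \<le> DIM('a) \<and> j \<notin> J")
    case True
    have "AE \<omega> in PiM I N. \<omega> j \<notin> {z. (z, 1::real) \<in> span ((\<lambda>i. (\<omega> i, 1)) ` J)}"
    proof (rule AE_PiM_avoid[OF N I j])
      have comp: "(\<lambda>\<omega>. (\<omega> i, 1::real)) \<in> borel_measurable (PiM I N)" if "i \<in> I" for i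
        unfolding borel_prod[symmetric] using that by (intro measurable_Pair) auto
      have "Measurable.pred (PiM I N) (\<lambda>\<omega>. (\<omega> j, 1::real) \<in> ruled_cone J (\<lambda>i. (\<omega> i, 1)) {} (\<lambda>_::nat. 0))"
        using J comp j by (intro pred_mem_cone measurable_ruled_cone) auto
      then show "Measurable.pred (PiM I N) (\<lambda>\<omega>. \<omega> j \<in> {z. (z, 1::real) \<in> span ((\<lambda>i. (\<omega> i, 1)) ` J)})"
        by (simp add: ruled_cone_span)
      show "{y. (y, 1::real) \<in> span ((\<lambda>i. ((fun_upd \<omega> j z) i, 1)) ` J)} = {z. (z, 1::real) \<in> span ((\<lambda>i. (\<omega> i, 1)) ` J)}" for \<omega> z
      proof -
        have "(\<lambda>i. ((fun_upd \<omega> j z) i, 1::real)) ` J = (\<lambda>i. (\<omega> i, 1)) ` J"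
          using True by (intro image_cong) auto
        then show ?thesis by simp
      qed
      show "AE z in N j. z \<notin> {z. (z, 1::real) \<in> span ((\<lambda>i. (\<omega> i, 1)) ` J)}" for \<omega>
      proof -
        let ?A = "(\<lambda>i. (\<omega> i, 1::real)) ` J"
        have "dim ?A \<le> card J"
          using dim_le_card'[of ?A] card_image_le[OF J(2), of "\<lambda>i. (\<omega> i, 1::real)"] J(2) by auto
        then have "dim ?A < DIM('a \<times> real)" using True by simp
        then obtain p :: "'a \<times> real" where p: "p \<noteq> 0" "span ?A \<subseteq> {y. p \<bullet> y = 0}"
          using lowdim_subset_hyperplane by blast
        have eq: "z \<bullet> fst p = - snd p" if "(z, 1) \<in> span ?A" for z
          using p(2) that by (force simp: inner_prod_def inner_commute)
        show ?thesis
        proof (cases "fst p = 0")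
          case True
          then have "snd p \<noteq> 0" using p(1) by (auto simp: prod_eq_iff)
          then have "(z, 1) \<notin> span ?A" for z using eq[of z] True by auto
          then show ?thesis by simp
        next
          case False
          from null[OF j this, of "- snd p"] show ?thesis
            using eq by (auto elim!: eventually_mono)
        qed
      qed
    qed
    then show ?thesis by simp
  qed auto
qed

text \<open>The same argument without the lift: fewer than d vectors lie in a linear hyperplane. It
  is applied to the uniform directions.\<close>

lemma AE_linearly_independent:
  fixes N :: "'i \<Rightarrow> 'a::euclidean_space measure"
  assumes N: "\<And>i. prob_space (N i)" "\<And>i. sets (N i) = sets borel" and I: "finite I"
    and K: "K \<subseteq> I" "card K \<le> DIM('a)"
    and null: "\<And>i a. i \<in> K \<Longrightarrow> a \<noteq> 0 \<Longrightarrow> AE z in N i. z \<bullet> a \<noteq> 0"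
  shows "AE \<omega> in PiM I N. \<forall>k\<in>K. \<omega> k \<notin> span (\<omega> ` (K - {k}))"
proof (rule AE_finite_allI)
  show "finite K" using I K finite_subset by blast
  fix k assume k: "k \<in> K"
  note [measurable_cong] = N(2)
  show "AE \<omega> in PiM I N. \<omega> k \<notin> span (\<omega> ` (K - {k}))"
  proof (rule AE_PiM_avoid[OF N I])
    show "k \<in> I" using k K by auto
    have "(\<lambda>\<omega>. \<omega> i) \<in> borel_measurable (PiM I N)" if "i \<in> K" for i
      using that K by (auto intro: measurable_component_singleton)
    then have "Measurable.pred (PiM I N) (\<lambda>\<omega>. \<omega> k \<in> ruled_cone (K - {k}) \<omega> {} (\<lambda>_::nat. 0))"
      using \<open>finite K\<close> k by (intro pred_mem_cone measurable_ruled_cone) auto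
    then show "Measurable.pred (PiM I N) (\<lambda>\<omega>. \<omega> k \<in> span (\<omega> ` (K - {k})))"
      by (simp add: ruled_cone_span)
    show "span ((fun_upd \<omega> k z) ` (K - {k})) = span (\<omega> ` (K - {k}))" for \<omega> z
      by (intro arg_cong[where f=span] image_cong) auto
    show "AE z in N k. z \<notin> span (\<omega> ` (K - {k}))" for \<omega>
    proof -
      have "dim (\<omega> ` (K - {k})) \<le> card (K - {k})"
        using dim_le_card'[of "\<omega> ` (K - {k})"] card_image_le[of "K - {k}" \<omega>] \<open>finite K\<close> by auto
      also have "\<dots> < DIM('a)" using k K(2) \<open>finite K\<close> card_Diff1_less[of K k] by auto
      finally obtain p where p: "p \<noteq> 0" "span (\<omega> ` (K - {k})) \<subseteq> {y. p \<bullet> y = 0}"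
        using lowdim_subset_hyperplane by blast
      from null[OF k p(1)] show ?thesis using p(2) by (auto elim!: eventually_mono simp: inner_commute)
    qed
  qed
qed

text \<open>Separates the roles of the coordinates: those in \<open>A\<close> are held fixed,
  \<open>k\<close> is the base point, and \<open>B\<close> is integrated innermost.\<close>

lemma nn_integral_PiM_split:
  fixes N :: "'i \<Rightarrow> 'a::euclidean_space measure"
  assumes N: "\<And>i. prob_space (N i)" and I: "finite A" "finite B" "A \<inter> insert k B = {}" "k \<notin> B"
    and G: "G \<in> borel_measurable (PiM (A \<union> insert k B) N)"
  shows "(\<integral>\<^sup>+\<omega>. G \<omega> \<partial>PiM (A \<union> insert k B) N) =
    (\<integral>\<^sup>+a. (\<integral>\<^sup>+x. (\<integral>\<^sup>+b. G (merge A (insert k B) (a, b(k := x))) \<partial>PiM B N) \<partial>N k) \<partial>PiM A N)"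
proof -
  interpret N: product_sigma_finite N
    using N by (intro product_sigma_finite.intro prob_space_imp_sigma_finite)
  have "(\<integral>\<^sup>+\<omega>. G \<omega> \<partial>PiM (A \<union> insert k B) N) =
      (\<integral>\<^sup>+a. (\<integral>\<^sup>+b. G (merge A (insert k B) (a, b)) \<partial>PiM (insert k B) N) \<partial>PiM A N)"
    using I G by (intro N.product_nn_integral_fold) auto
  also have "\<dots> = (\<integral>\<^sup>+a. (\<integral>\<^sup>+x. (\<integral>\<^sup>+b. G (merge A (insert k B) (a, b(k := x))) \<partial>PiM B N) \<partial>N k) \<partial>PiM A N)"
  proof (rule nn_integral_cong)
    fix a assume a: "a \<in> space (PiM A N)"
    have "(\<lambda>b. merge A (insert k B) (a, b)) \<in> PiM (insert k B) N \<rightarrow>\<^sub>M PiM (A \<union> insert k B) N"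
      using a by (intro measurable_compose[OF measurable_Pair1' measurable_merge])
    then have "(\<lambda>b. G (merge A (insert k B) (a, b))) \<in> borel_measurable (PiM (insert k B) N)"
      by (rule measurable_compose[OF _ G])
    then show "(\<integral>\<^sup>+b. G (merge A (insert k B) (a, b)) \<partial>PiM (insert k B) N) =
        (\<integral>\<^sup>+x. (\<integral>\<^sup>+b. G (merge A (insert k B) (a, b(k := x))) \<partial>PiM B N) \<partial>N k)"
      using I by (intro N.product_nn_integral_insert_rev) auto
  qed
  finally show ?thesis .
qed

lemma ruled_cone_cong_fun:
  assumes "\<And>i. i \<in> I \<Longrightarrow> a i = b i" "\<And>j. j \<in> J \<Longrightarrow> v j = w j"
  shows "ruled_cone I a J v = ruled_cone I b J w"
proof -
  have "a ` I = b ` I" using assms(1) by (intro image_cong) auto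
  moreover have "pos J v = pos J w" using assms(2) by (simp add: pos_def)
  ultimately show ?thesis by (simp add: ruled_cone_def)
qed

lemma pos_cong: "(\<And>j. j \<in> J \<Longrightarrow> v j = w j) \<Longrightarrow> pos J v = pos J w"
  by (simp add: pos_def)

text \<open>\<open>W \<times> C\<close> hits an open set iff \<open>C\<close> hits the union of its
  sections over \<open>W\<close>, which is open.\<close>

lemma measurable_Times_cone:
  fixes W :: "'c::euclidean_space set"
  assumes W: "subspace W"
  shows "(\<lambda>C :: 'b::euclidean_space set. W \<times> C) \<in> measurable cone_space cone_space"
  unfolding cone_space_def[where ?'a="'c \<times> 'b"]
proof (rule measurable_measure_of)
  have "closed (W \<times> C) \<and> convex_cone (W \<times> C)" if "closed C" "convex_cone C" for C :: "'b set"
  proof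
    show "closed (W \<times> C)" using W that closed_subspace by (intro closed_Times) auto
    show "convex_cone (W \<times> C)"
      using that W subspace_add[OF W] subspace_scale[OF W] subspace_0[OF W]
      unfolding convex_cone_iff by (auto simp: zero_prod_def)
  qed
  then show "(\<lambda>C :: 'b set. W \<times> C) \<in> space cone_space \<rightarrow> {C. closed C \<and> convex_cone C}"
    by (auto simp: space_cone_space)
  fix A assume "A \<in> (\<lambda>U. {C. closed C \<and> convex_cone C \<and> C \<inter> U \<noteq> {}}) ` {U :: ('c \<times> 'b) set. open U}"
  then obtain U :: "('c \<times> 'b) set" where U: "open U" and A: "A = {C. closed C \<and> convex_cone C \<and> C \<inter> U \<noteq> {}}" by auto
  define U' where "U' = (\<Union>w\<in>W. (\<lambda>y. (w, y)) -` U)"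
  have "open U'"
    unfolding U'_def using U by (intro open_UN ballI open_vimage continuous_intros)
  have "(\<lambda>C :: 'b set. W \<times> C) -` A \<inter> space cone_space = {C. closed C \<and> convex_cone C \<and> C \<inter> U' \<noteq> {}}"
    using \<open>\<And>C. closed C \<Longrightarrow> convex_cone C \<Longrightarrow> closed (W \<times> C) \<and> convex_cone (W \<times> C)\<close>
    by (auto simp: A space_cone_space U'_def)
  also have "\<dots> \<in> sets cone_space"
    unfolding cone_space_def using \<open>open U'\<close> by (intro in_measure_of) auto
  finally show "(\<lambda>C :: 'b set. W \<times> C) -` A \<inter> space cone_space \<in> sets cone_space" .
qed auto

section \<open>The coupling\<close>

lemma measure_eqI_nn_integral:
  assumes "sets M = sets N" "\<And>A. A \<in> sets N \<Longrightarrow> (\<integral>\<^sup>+x. indicator A x \<partial>M) = (\<integral>\<^sup>+x. indicator A x \<partial>N)"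
  shows "M = N"
  using assms by (intro measure_eqI) auto

text \<open>The law of independent points is pushed forward coordinate by coordinate. The hypothesis
  \<open>restrict\<close> identifies \<open>h\<close> at \<open>compose J S y\<close>, which is
  \<open>undefined\<close> off \<open>J\<close>, with \<open>h\<close> at the plain
  composition.\<close>

lemma nn_integral_coisometry_beta_points:
  fixes S :: "'a::euclidean_space \<Rightarrow> 'b::euclidean_space" and h :: "'b \<Rightarrow> ('j \<Rightarrow> 'b) \<Rightarrow> ennreal"
  defines "\<delta> \<equiv> (real DIM('a) - real DIM('b)) / 2"
  assumes S: "coisometry S" and \<beta>: "\<beta>0 \<ge> -1" "\<And>j. j \<in> J \<Longrightarrow> \<beta> j \<ge> -1" and J: "finite J"
    and h: "(\<lambda>(z, Z). h z Z) \<in> borel_measurable (borel \<Otimes>\<^sub>M PiM J (\<lambda>_. borel))"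
    and restrict: "\<And>z Z. h z (restrict Z J) = h z Z"
  shows "(\<integral>\<^sup>+x. (\<integral>\<^sup>+y. h (S x) (\<lambda>j. S (y j)) \<partial>PiM J (\<lambda>j. beta_distr (\<beta> j))) \<partial>beta_distr \<beta>0) =
    (\<integral>\<^sup>+p. h (fst p) (snd p) \<partial>(beta_distr (\<beta>0 + \<delta>) \<Otimes>\<^sub>M PiM J (\<lambda>j. beta_distr (\<beta> j + \<delta>))))"
proof -
  note measurable_coisometry[OF S, measurable]
  have \<delta>: "\<delta> \<ge> 0"
    unfolding \<delta>_def using coisometry_DIM_le[OF S] by (intro divide_nonneg_nonneg) auto
  have \<beta>\<delta>: "\<beta> j + \<delta> \<ge> -1" if "j \<in> J" for j using \<beta>(2)[OF that] \<delta> by linarith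
  have distr: "distr (beta_distr b) borel S = beta_distr (b + \<delta>)" if "b \<ge> -1" for b
    unfolding \<delta>_def using S that by (rule distr_coisometry_beta_distr)
  have PiM: "PiM J (\<lambda>j. beta_distr (\<beta> j + \<delta>)) = distr (PiM J (\<lambda>j. beta_distr (\<beta> j))) (PiM J (\<lambda>j. beta_distr (\<beta> j + \<delta>))) (compose J S)"
  proof -
    have "PiM J (\<lambda>j. beta_distr (\<beta> j + \<delta>)) = PiM J (\<lambda>j. distr (beta_distr (\<beta> j)) (beta_distr (\<beta> j + \<delta>)) S)"
      using distr \<beta>(2) by (intro PiM_cong refl) (metis distr_cong sets_beta_distr)
    also have "\<dots> = distr (PiM J (\<lambda>j. beta_distr (\<beta> j))) (PiM J (\<lambda>j. beta_distr (\<beta> j + \<delta>))) (compose J S)"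
      using \<beta>(2) \<beta>\<delta> J by (intro distr_PiM_finite_prob_space'[symmetric] prob_space_beta_distr) auto
    finally show ?thesis .
  qed
  interpret P: prob_space "PiM J (\<lambda>j. beta_distr (\<beta> j + \<delta>)) :: ('j \<Rightarrow> 'b) measure"
    using \<beta>\<delta> by (intro prob_space_PiM prob_space_beta_distr)
  have sets[measurable_cong]: "sets (PiM J (\<lambda>j. beta_distr (c j) :: 'b measure)) = sets (PiM J (\<lambda>_. borel))" for c
    by (intro sets_PiM_cong) auto
  have sets'[measurable_cong]: "sets (PiM J (\<lambda>j. beta_distr (c j) :: 'a measure)) = sets (PiM J (\<lambda>_. borel))" for c
    by (intro sets_PiM_cong) auto
  have h'[measurable]: "(\<lambda>p. h (fst p) (snd p)) \<in> borel_measurable (borel \<Otimes>\<^sub>M PiM J (\<lambda>_. borel))"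
    using h by (simp add: case_prod_beta')
  have hz[measurable]: "h z \<in> borel_measurable (PiM J (\<lambda>_. borel))" for z
    using measurable_compose[OF measurable_Pair1'[of z borel] h'] by simp
  have comp[measurable]: "compose J S \<in> PiM J (\<lambda>_. borel) \<rightarrow>\<^sub>M PiM J (\<lambda>_. borel)"
    unfolding compose_def by measurable
  have inner: "(\<lambda>z. \<integral>\<^sup>+Z. h z Z \<partial>PiM J (\<lambda>j. beta_distr (\<beta> j + \<delta>))) \<in> borel_measurable borel"
    by (rule P.borel_measurable_nn_integral) (use h in \<open>simp cong: measurable_cong_sets sets_pair_measure_cong\<close>)
  have "(\<integral>\<^sup>+p. h (fst p) (snd p) \<partial>(beta_distr (\<beta>0 + \<delta>) \<Otimes>\<^sub>M PiM J (\<lambda>j. beta_distr (\<beta> j + \<delta>)))) =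
      (\<integral>\<^sup>+z. (\<integral>\<^sup>+Z. h z Z \<partial>PiM J (\<lambda>j. beta_distr (\<beta> j + \<delta>))) \<partial>beta_distr (\<beta>0 + \<delta>))"
    by (subst P.nn_integral_fst[symmetric]) auto
  also have "\<dots> = (\<integral>\<^sup>+x. (\<integral>\<^sup>+Z. h (S x) Z \<partial>PiM J (\<lambda>j. beta_distr (\<beta> j + \<delta>))) \<partial>beta_distr \<beta>0)"
    unfolding distr[OF \<beta>(1), symmetric] using inner by (intro nn_integral_distr) auto
  also have "\<dots> = (\<integral>\<^sup>+x. (\<integral>\<^sup>+y. h (S x) (compose J S y) \<partial>PiM J (\<lambda>j. beta_distr (\<beta> j))) \<partial>beta_distr \<beta>0)"
  proof (rule nn_integral_cong)
    fix x :: 'a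
    show "(\<integral>\<^sup>+Z. h (S x) Z \<partial>PiM J (\<lambda>j. beta_distr (\<beta> j + \<delta>))) = (\<integral>\<^sup>+y. h (S x) (compose J S y) \<partial>PiM J (\<lambda>j. beta_distr (\<beta> j)))"
      by (subst PiM, rule nn_integral_distr) measurable
  qed
  also have "\<dots> = (\<integral>\<^sup>+x. (\<integral>\<^sup>+y. h (S x) (\<lambda>j. S (y j)) \<partial>PiM J (\<lambda>j. beta_distr (\<beta> j))) \<partial>beta_distr \<beta>0)"
    unfolding compose_def using restrict[of _ "\<lambda>j. S (_ j)"] by simp
  finally show ?thesis ..
qed

lemma align_cong: "(\<And>l. l < i \<Longrightarrow> u l = u' l) \<Longrightarrow> align e u i x = align e u' i x"
  by (induction i arbitrary: x) auto

text \<open>\<open>merge_points\<close> with no directions yet, for fixed points with indices in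
  \<open>J\<close>. The index set is kept: afterwards \<open>k\<close> carries the merged point and
  \<open>K\<close> the directions.\<close>

lemma merge_points_PiM:
  fixes N :: "'i \<Rightarrow> 'a::euclidean_space measure" and g :: "'a set \<Rightarrow> ennreal"
  assumes g[measurable]: "g \<in> borel_measurable cone_space"
    and fin: "finite J" "finite K" and disj: "J \<inter> insert k K = {}" "k \<notin> K" and d: "K = {} \<or> 2 \<le> DIM('a)"
    and \<gamma>: "\<And>i. i \<in> insert k K \<Longrightarrow> \<gamma> i \<ge> real DIM('a) / 2 - 1"
    and N: "\<And>i. prob_space (N i)" "\<And>i. sets (N i) = sets borel" "\<And>i. i \<in> insert k K \<Longrightarrow> N i = beta_distr (\<gamma> i - real DIM('a) / 2)"
    and \<nu>: "\<And>i. prob_space (\<nu> i)" "\<And>i. sets (\<nu> i) = sets borel" "\<And>i. i \<in> K \<Longrightarrow> \<nu> i = uniform_sphere"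
      "\<nu> k = beta_distr ((\<Sum>i\<in>insert k K. \<gamma> i) - real DIM('a) / 2)" "\<And>j. j \<in> J \<Longrightarrow> \<nu> j = N j"
  shows "(\<integral>\<^sup>+\<omega>. g (ruled_cone K (\<lambda>i. \<omega> i - \<omega> k) J (\<lambda>j. \<omega> j - \<omega> k)) \<partial>PiM (J \<union> insert k K) N) =
    (\<integral>\<^sup>+\<omega>. g (ruled_cone K \<omega> J (\<lambda>j. \<omega> j - \<omega> k)) \<partial>PiM (J \<union> insert k K) \<nu>)"
proof -
  let ?I = "J \<union> insert k K"
  note [measurable_cong] = N(2) \<nu>(2)
  have J: "PiM J \<nu> = PiM J N" using \<nu>(5) by (intro PiM_cong) auto
  have K: "PiM K N = PiM K (\<lambda>i. beta_distr (\<gamma> i - real DIM('a) / 2))" "PiM K \<nu> = PiM K (\<lambda>_. uniform_sphere)"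
    using N(3) \<nu>(3) by (intro PiM_cong; simp)+
  have merge: "merge J (insert k K) (y, f(k := x)) i = (if i \<in> J then y i else if i = k then x else if i \<in> K then f i else undefined)" for x y f i
    using disj by (auto simp: merge_def)
  have "(\<integral>\<^sup>+\<omega>. g (ruled_cone K (\<lambda>i. \<omega> i - \<omega> k) J (\<lambda>j. \<omega> j - \<omega> k)) \<partial>PiM ?I N) =
    (\<integral>\<^sup>+y. (\<integral>\<^sup>+x. (\<integral>\<^sup>+f. g (ruled_cone K (\<lambda>i. f i - x) J (\<lambda>j. y j - x)) \<partial>PiM K N) \<partial>N k) \<partial>PiM J N)"
  proof (subst nn_integral_PiM_split[OF N(1) fin disj])
    show "(\<lambda>\<omega>. g (ruled_cone K (\<lambda>i. \<omega> i - \<omega> k) J (\<lambda>j. \<omega> j - \<omega> k))) \<in> borel_measurable (PiM ?I N)"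
      using fin by (intro measurable_compose[OF measurable_ruled_cone g]) auto
  qed (intro nn_integral_cong arg_cong[where f=g] ruled_cone_cong_fun, use disj in \<open>auto simp: merge\<close>)
  also have "\<dots> = (\<integral>\<^sup>+y. (\<integral>\<^sup>+x. (\<integral>\<^sup>+f. g (ruled_cone K f J (\<lambda>j. y j - x)) \<partial>PiM K \<nu>) \<partial>\<nu> k) \<partial>PiM J N)"
  proof (rule nn_integral_cong)
    fix y
    have "\<gamma> k + sum \<gamma> K = (\<Sum>i\<in>insert k K. \<gamma> i)" using fin disj by simp
    moreover have "(\<integral>\<^sup>+x. (\<integral>\<^sup>+f. g (ruled_cone ({} \<union> K) (\<lambda>i. if i \<in> {} then undefined else f i - x) J (\<lambda>j. y j - x)) \<partial>PiM K (\<lambda>i. beta_distr (\<gamma> i - real DIM('a) / 2))) \<partial>beta_distr (\<gamma> k - real DIM('a) / 2)) =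
      (\<integral>\<^sup>+x. (\<integral>\<^sup>+u. g (ruled_cone ({} \<union> K) (\<lambda>i. if i \<in> {} then undefined else u i) J (\<lambda>j. y j - x)) \<partial>PiM K (\<lambda>_. uniform_sphere)) \<partial>beta_distr (\<gamma> k + (\<Sum>i\<in>K. \<gamma> i) - real DIM('a) / 2))"
      using fin d \<gamma> by (intro merge_points g) auto
    ultimately show "(\<integral>\<^sup>+x. (\<integral>\<^sup>+f. g (ruled_cone K (\<lambda>i. f i - x) J (\<lambda>j. y j - x)) \<partial>PiM K N) \<partial>N k) =
        (\<integral>\<^sup>+x. (\<integral>\<^sup>+f. g (ruled_cone K f J (\<lambda>j. y j - x)) \<partial>PiM K \<nu>) \<partial>\<nu> k)"
      unfolding K \<nu>(4) N(3)[OF insertI1] by simp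
  qed
  also have "\<dots> = (\<integral>\<^sup>+\<omega>. g (ruled_cone K \<omega> J (\<lambda>j. \<omega> j - \<omega> k)) \<partial>PiM ?I \<nu>)"
  proof (subst nn_integral_PiM_split[OF \<nu>(1) fin disj])
    show "(\<lambda>\<omega>. g (ruled_cone K \<omega> J (\<lambda>j. \<omega> j - \<omega> k))) \<in> borel_measurable (PiM ?I \<nu>)"
      using fin by (intro measurable_compose[OF measurable_ruled_cone g]) auto
  qed (unfold J, intro nn_integral_cong arg_cong[where f=g] ruled_cone_cong_fun, use disj in \<open>auto simp: merge\<close>)
  finally show ?thesis .
qed

text \<open>For fixed directions \<open>u\<close> the map \<open>S\<close> below is a coisometry,
  and all coisometries have the same effect on beta laws. So the inner integral is constant in
  \<open>u\<close>, and the directions integrate out.\<close>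

lemma nn_integral_beta_cone:
  fixes \<nu> :: "'i \<Rightarrow> 'a::euclidean_space measure" and T :: "'a \<Rightarrow> 'b::euclidean_space"
  defines "\<delta> \<equiv> (real DIM('a) - real DIM('b)) / 2"
  assumes g[measurable]: "g \<in> borel_measurable cone_space" and T: "coisometry T"
    and fin: "finite K" "finite J" and disj: "K \<inter> insert k J = {}" "k \<notin> J" and \<kappa>: "\<And>l. l < m \<Longrightarrow> \<kappa> l \<in> K"
    and \<nu>: "\<And>i. prob_space (\<nu> i)" "\<And>i. sets (\<nu> i) = sets borel" "\<nu> k = beta_distr \<beta>0" "\<And>j. j \<in> J \<Longrightarrow> \<nu> j = beta_distr (\<beta> j)"
    and \<beta>: "\<beta>0 \<ge> -1" "\<And>j. j \<in> J \<Longrightarrow> \<beta> j \<ge> -1"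
  shows "(\<integral>\<^sup>+\<omega>. g (pos J (\<lambda>j. T (align e (\<lambda>l. \<omega> (\<kappa> l)) m (\<omega> j - \<omega> k)))) \<partial>PiM (K \<union> insert k J) \<nu>) =
    (\<integral>\<^sup>+C. g C \<partial>beta_cone (\<beta>0 + \<delta>) J (\<lambda>j. \<beta> j + \<delta>))"
proof -
  let ?I = "K \<union> insert k J"
  note [measurable_cong] = \<nu>(2)
  note measurable_coisometry[OF T, measurable]
  have merge: "merge K (insert k J) (u, y(k := x)) i = (if i \<in> K then u i else if i = k then x else if i \<in> J then y i else undefined)" for x y u i
    using disj by (auto simp: merge_def)
  interpret K: prob_space "PiM K \<nu>" using \<nu>(1) by (intro prob_space_PiM)
  have J: "PiM J \<nu> = PiM J (\<lambda>j. beta_distr (\<beta> j))" using \<nu>(4) by (intro PiM_cong) auto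
  have pos_measurable: "(\<lambda>(z, Z). g (pos J (\<lambda>j. Z j - z :: 'b))) \<in> borel_measurable (borel \<Otimes>\<^sub>M PiM J (\<lambda>_. borel))"
    using fin unfolding case_prod_beta' by (intro measurable_compose[OF measurable_pos g]) measurable
  have "(\<integral>\<^sup>+\<omega>. g (pos J (\<lambda>j. T (align e (\<lambda>l. \<omega> (\<kappa> l)) m (\<omega> j - \<omega> k)))) \<partial>PiM ?I \<nu>) =
    (\<integral>\<^sup>+u. (\<integral>\<^sup>+x. (\<integral>\<^sup>+y. g (pos J (\<lambda>j. T (align e (\<lambda>l. u (\<kappa> l)) m (y j - x)))) \<partial>PiM J \<nu>) \<partial>\<nu> k) \<partial>PiM K \<nu>)"
  proof (subst nn_integral_PiM_split[OF \<nu>(1) fin disj])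
    show "(\<lambda>\<omega>. g (pos J (\<lambda>j. T (align e (\<lambda>l. \<omega> (\<kappa> l)) m (\<omega> j - \<omega> k))))) \<in> borel_measurable (PiM ?I \<nu>)"
    proof (intro measurable_compose[OF measurable_pos g] fin)
      fix j assume j: "j \<in> J"
      have "(\<lambda>\<omega>. align e (\<lambda>l. \<omega> (\<kappa> l)) m (\<omega> j - \<omega> k)) \<in> borel_measurable (PiM ?I \<nu>)"
        using j \<kappa> by (intro measurable_align) auto
      then show "(\<lambda>\<omega>. T (align e (\<lambda>l. \<omega> (\<kappa> l)) m (\<omega> j - \<omega> k))) \<in> borel_measurable (PiM ?I \<nu>)"
        by measurable
    qed
  qed (intro nn_integral_cong arg_cong[where f=g] pos_cong arg_cong[where f=T],
      use disj \<kappa> in \<open>auto simp: merge intro!: align_cong\<close>)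
  also have "\<dots> = (\<integral>\<^sup>+u. (\<integral>\<^sup>+C. g C \<partial>beta_cone (\<beta>0 + \<delta>) J (\<lambda>j. \<beta> j + \<delta>)) \<partial>PiM K \<nu>)"
  proof (rule nn_integral_cong)
    fix u :: "'i \<Rightarrow> 'a"
    define S where "S = (\<lambda>x. T (align e (\<lambda>l. u (\<kappa> l)) m x))"
    have S: "coisometry S" unfolding S_def
      by (rule coisometry_compose_orthogonal[OF T orthogonal_transformation_align])
    then have "S (y - x) = S y - S x" for x y by (simp add: coisometry_def linear_diff)
    then have "(\<integral>\<^sup>+x. (\<integral>\<^sup>+y. g (pos J (\<lambda>j. S (y j - x))) \<partial>PiM J \<nu>) \<partial>\<nu> k) =
        (\<integral>\<^sup>+x. (\<integral>\<^sup>+y. g (pos J (\<lambda>j. S (y j) - S x)) \<partial>PiM J (\<lambda>j. beta_distr (\<beta> j))) \<partial>beta_distr \<beta>0)"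
      by (simp add: J \<nu>(3))
    also have "\<dots> = (\<integral>\<^sup>+p. g (pos J (\<lambda>j. snd p j - fst p)) \<partial>(beta_distr (\<beta>0 + \<delta>) \<Otimes>\<^sub>M PiM J (\<lambda>j. beta_distr (\<beta> j + \<delta>))))"
      unfolding \<delta>_def using S \<beta> fin(2) pos_measurable
      by (intro nn_integral_coisometry_beta_points[where h="\<lambda>z Z. g (pos J (\<lambda>j. Z j - z))"])
        (auto intro!: arg_cong[where f=g] pos_cong)
    also have "\<dots> = (\<integral>\<^sup>+C. g C \<partial>beta_cone (\<beta>0 + \<delta>) J (\<lambda>j. \<beta> j + \<delta>))"
      unfolding beta_cone_def by (subst nn_integral_distr[OF measurable_beta_cone[OF fin(2)]]) (auto simp: case_prod_beta')
    finally show "(\<integral>\<^sup>+x. (\<integral>\<^sup>+y. g (pos J (\<lambda>j. T (align e (\<lambda>l. u (\<kappa> l)) m (y j - x)))) \<partial>PiM J \<nu>) \<partial>\<nu> k) =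
        (\<integral>\<^sup>+C. g C \<partial>beta_cone (\<beta>0 + \<delta>) J (\<lambda>j. \<beta> j + \<delta>))"
      unfolding S_def .
  qed
  also have "\<dots> = (\<integral>\<^sup>+C. g C \<partial>beta_cone (\<beta>0 + \<delta>) J (\<lambda>j. \<beta> j + \<delta>))"
    using K.emeasure_space_1 by simp
  finally show ?thesis .
qed

theorem theorem6p1:
  fixes d n k :: nat
    and \<beta> \<gamma> :: "nat \<Rightarrow> real"
    and M :: "'w measure"
    and X :: "nat \<Rightarrow> 'w \<Rightarrow> 'a::euclidean_space"
    and K :: "nat set"
    and W :: "'c::euclidean_space set"
  assumes d: "DIM('a) = d"
    and n: "n \<ge> 2"
    and \<beta>: "\<And>i. i \<in> {1..n} \<Longrightarrow> \<beta> i \<ge> -1"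
    and \<beta>_1: "\<And>i. d = 1 \<Longrightarrow> i \<in> {1..n} \<Longrightarrow> \<beta> i \<noteq> -1"
    and M: "prob_space M"
    and X_indep: "prob_space.indep_vars M (\<lambda>_. borel) X {1..n}"
    and X_distr: "\<And>i. i \<in> {1..n} \<Longrightarrow> distr M borel (X i) = beta_distr (\<beta> i)"
    and \<gamma>: "\<And>i. i \<in> {1..n} \<Longrightarrow> \<gamma> i = \<beta> i + real d / 2"
    and k: "k \<in> {1..min d (n - 1)}"
    and K: "K \<subseteq> {1..n}" "card K = k"
    and dim_b: "DIM('b::euclidean_space) = d - k + 1"
    and W: "subspace W" "dim W = k - 1"
      \<comment> \<open>\<open>W\<close> plays the role of \<open>\<real>\<^sup>k\<^sup>-\<^sup>1\<close>, which is not a type of class \<open>euclidean_space\<close> for \<open>k = 1\<close>\<close>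
  shows "isometric_random_cones
     M (\<lambda>\<omega>. tangent_cone (convex hull ((\<lambda>i. X i \<omega>) ` K)) (convex hull ((\<lambda>i. X i \<omega>) ` {1..n})))
     (beta_cone ((\<Sum>i\<in>K. \<gamma> i) - real (d - k + 1) / 2) ({1..n} - K) (\<lambda>i. \<gamma> i - real (d - k + 1) / 2)
        :: 'b set measure)
     (\<lambda>C. W \<times> C)"
proof -
  interpret M: prob_space M by fact
  define I where "I = {1..n}"
  define J where "J = I - K"
  define m where "m = k - 1"
  let ?d = "real d"
  let ?\<sigma> = "uniform_sphere :: 'a measure"
  \<comment> \<open>The shift of the parameter under projection to the smaller space; it keeps the
    parameter plus half the dimension unchanged.\<close>
  define \<delta> where "\<delta> = (real DIM('a) - real DIM('b)) / 2"
  have kd: "1 \<le> k" "k \<le> d" using k by auto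
  have KI: "K \<subseteq> I" using K(1) by (simp add: I_def)
  have fin: "finite I" "finite K" "finite J" using KI finite_subset by (auto simp: I_def J_def)
  obtain k0 where k0: "k0 \<in> K" using K(2) kd by fastforce
  define K' where "K' = K - {k0}"
  have K': "finite K'" "k0 \<notin> K'" "insert k0 K' = K" "K' \<subseteq> I" "card K' = m"
    using fin k0 KI K(2) by (auto simp: K'_def m_def)
  have IJ: "I = J \<union> insert k0 K'" "I = K' \<union> insert k0 J" "J \<inter> insert k0 K' = {}" "K' \<inter> insert k0 J = {}" "k0 \<notin> J"
    using KI k0 by (auto simp: J_def K'_def)
  have \<delta>: "\<delta> = ?d / 2 - real (d - k + 1) / 2" using d dim_b by (simp add: \<delta>_def diff_divide_distrib)
  \<comment> \<open>In dimension one \<open>k = 1\<close>, so there is no vertex to merge.\<close>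
  have d2: "K' = {} \<or> 2 \<le> DIM('a)"
    using K' kd d by (cases "k = 1") (auto simp: m_def)
  have \<gamma>\<beta>: "\<gamma> i - ?d / 2 = \<beta> i" "\<gamma> i \<ge> ?d / 2 - 1" if "i \<in> I" for i
    using \<gamma>[of i] \<beta>[of i] that by (auto simp: I_def)
  \<comment> \<open>Parameter of the merged point, still in the original space.\<close>
  define \<beta>0 where "\<beta>0 = (\<Sum>i\<in>K. \<gamma> i) - ?d / 2"
  have \<beta>0: "\<beta>0 \<ge> -1"
  proof -
    have "(\<Sum>i\<in>K'. \<gamma> i) \<ge> 0"
    proof (cases "K' = {}")
      case False
      then have "?d / 2 \<ge> 1" using d2 d by simp
      then show ?thesis using \<gamma>\<beta>(2) K'(4) by (intro sum_nonneg) fastforce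
    qed simp
    moreover have "(\<Sum>i\<in>K. \<gamma> i) = \<gamma> k0 + (\<Sum>i\<in>K'. \<gamma> i)"
      using K' by (metis sum.insert)
    ultimately show ?thesis using \<gamma>\<beta>(2)[of k0] k0 KI by (auto simp: \<beta>0_def)
  qed
  have \<beta>I: "\<beta> i \<ge> -1" "DIM('a) = 1 \<longrightarrow> \<beta> i \<noteq> -1" if "i \<in> I" for i
    using \<beta> \<beta>_1 d that by (auto simp: I_def)

  \<comment> \<open>The product laws of the vertices and of the coupling\<close>
  define N :: "nat \<Rightarrow> 'a measure" where "N i = (if i \<in> I then beta_distr (\<beta> i) else uniform_sphere)" for i
  \<comment> \<open>The merged point sits at \<open>k0\<close>, the other vertices at
    \<open>J\<close>, and independent uniform directions take the place of the vertices in
    \<open>K'\<close>.\<close>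
  define \<nu> :: "nat \<Rightarrow> 'a measure"
    where "\<nu> i = (if i = k0 then beta_distr \<beta>0 else if i \<in> J then beta_distr (\<beta> i) else uniform_sphere)" for i
  have N: "prob_space (N i)" "sets (N i) = sets borel" for i
    using \<beta>I by (auto simp: N_def prob_space_beta_distr prob_space_uniform_sphere)
  have \<nu>: "prob_space (\<nu> i)" "sets (\<nu> i) = sets borel" for i
    using \<beta>I \<beta>0 by (auto simp: \<nu>_def J_def prob_space_beta_distr prob_space_uniform_sphere)
  note [measurable_cong] = N(2) \<nu>(2)
  define PN where "PN = PiM I N"
  define PL where "PL = PiM I \<nu>"

  \<comment> \<open>The law of the tangent cone as an image of the product law\<close>
  define \<tau> where "\<tau> x = tangent_cone (convex hull (x ` K)) (convex hull (x ` I))" for x :: "nat \<Rightarrow> 'a"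
  define TC where "TC \<omega> = tangent_cone (convex hull ((\<lambda>i. X i \<omega>) ` K)) (convex hull ((\<lambda>i. X i \<omega>) ` {1..n}))" for \<omega>
  have X: "X i \<in> borel_measurable M" if "i \<in> I" for i
    using X_indep that unfolding M.indep_vars_def by (auto simp: I_def)
  have TC: "TC \<in> measurable M cone_space"
    unfolding TC_def I_def[symmetric] using fin KI k0 X by (intro measurable_tangent_cone) auto
  have \<tau>: "\<tau> \<in> measurable PN cone_space"
    unfolding \<tau>_def PN_def using fin KI k0 by (intro measurable_tangent_cone) auto
  have law_X: "distr M PN (\<lambda>\<omega>. \<lambda>i\<in>I. X i \<omega>) = PN"
  proof -
    have "distr M (PiM I (\<lambda>_. borel)) (\<lambda>\<omega>. \<lambda>i\<in>I. X i \<omega>) = PiM I (\<lambda>i. distr M borel (X i))"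
      using X_indep X n by (subst M.indep_vars_iff_distr_eq_PiM'[symmetric]) (auto simp: I_def)
    also have "\<dots> = PN" unfolding PN_def using X_distr by (intro PiM_cong) (auto simp: N_def I_def)
    finally have "distr M (PiM I (\<lambda>_. borel)) (\<lambda>\<omega>. \<lambda>i\<in>I. X i \<omega>) = PN" .
    moreover have "sets PN = sets (PiM I (\<lambda>_. borel))"
      unfolding PN_def using N(2) by (intro sets_PiM_cong) auto
    ultimately show ?thesis by (metis distr_cong)
  qed
  have "distr M cone_space TC = distr (distr M PN (\<lambda>\<omega>. \<lambda>i\<in>I. X i \<omega>)) cone_space \<tau>"
  proof (subst distr_distr[OF \<tau>])
    show "(\<lambda>\<omega>. \<lambda>i\<in>I. X i \<omega>) \<in> measurable M PN"
      unfolding PN_def using X by (intro measurable_restrict) (simp add: measurable_cong_sets[OF refl N(2)])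
    have "(restrict (\<lambda>i. X i \<omega>) I) ` K = (\<lambda>i. X i \<omega>) ` K" "(restrict (\<lambda>i. X i \<omega>) I) ` I = (\<lambda>i. X i \<omega>) ` I" for \<omega>
      using KI by (auto intro!: image_cong)
    then show "distr M cone_space TC = distr M cone_space (\<tau> \<circ> (\<lambda>\<omega>. \<lambda>i\<in>I. X i \<omega>))"
      by (intro distr_cong refl) (simp add: TC_def \<tau>_def I_def)
  qed
  then have law_TC: "distr M cone_space TC = distr PN cone_space \<tau>" by (simp only: law_X)

  \<comment> \<open>General position of the vertices\<close>
  define R where "R x = ruled_cone K' (\<lambda>i. x i - x k0) J (\<lambda>j. x j - x k0)" for x :: "nat \<Rightarrow> 'a"
  have \<tau>_R: "AE x in PN. \<tau> x = R x"
  proof -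
    have "AE x in PN. \<forall>J\<in>Pow I. \<forall>j\<in>I. card J \<le> DIM('a) \<longrightarrow> j \<notin> J \<longrightarrow> (x j, 1::real) \<notin> span ((\<lambda>i. (x i, 1)) ` J)"
      unfolding PN_def
    proof (rule AE_general_position[OF N fin(1)])
      fix i c and a :: 'a assume i: "i \<in> I" and a: "a \<noteq> 0"
      have Ni: "N i = beta_distr (\<beta> i)" using i by (simp add: N_def)
      show "AE z in N i. z \<bullet> a \<noteq> c" unfolding Ni by (rule AE_beta_distr_hyperplane[OF \<beta>I[OF i] a])
    qed
    then show ?thesis
    proof eventually_elim
      case (elim x)
      interpret vertex_family I K x using fin KI k0 by unfold_locales auto
      show ?case unfolding \<tau>_def R_def J_def K'_def
        using elim k0 by (intro tangent_cone_general_position) auto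
    qed
  qed

  \<comment> \<open>The copy of the tangent cone on the coupling space\<close>
  define C where "C \<omega> = ruled_cone K' \<omega> J (\<lambda>j. \<omega> j - \<omega> k0)" for \<omega> :: "nat \<Rightarrow> 'a"
  have C: "C \<in> measurable PL cone_space"
    unfolding C_def PL_def using fin K' KI k0 by (intro measurable_ruled_cone) (auto simp: J_def)
  have law_C: "distr PL cone_space C = distr M cone_space TC"
  proof (rule measure_eqI_nn_integral)
    fix A assume "A \<in> sets (distr M cone_space TC)"
    then have A: "(indicator A :: 'a set \<Rightarrow> ennreal) \<in> borel_measurable cone_space" by simp
    have "(\<integral>\<^sup>+c. indicator A c \<partial>distr PL cone_space C) = (\<integral>\<^sup>+\<omega>. indicator A (C \<omega>) \<partial>PL)"
      using C A by (intro nn_integral_distr) simp_all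
    also have "\<dots> = (\<integral>\<^sup>+x. indicator A (R x) \<partial>PN)"
      unfolding C_def R_def PL_def PN_def IJ(1)
    proof (rule merge_points_PiM[symmetric, OF A fin(3) K'(1) IJ(3) K'(2) d2])
      show "\<nu> k0 = beta_distr ((\<Sum>i\<in>insert k0 K'. \<gamma> i) - real DIM('a) / 2)"
        using d by (simp add: \<nu>_def \<beta>0_def K')
      show "N i = beta_distr (\<gamma> i - real DIM('a) / 2)" "real DIM('a) / 2 - 1 \<le> \<gamma> i" if "i \<in> insert k0 K'" for i
        using that K' KI \<gamma>\<beta>[of i] d by (auto simp: N_def)
      show "\<nu> i = uniform_sphere" if "i \<in> K'" for i using that IJ(3) K'(2) by (auto simp: \<nu>_def)
      show "\<nu> j = N j" if "j \<in> J" for j using that IJ(5) by (auto simp: \<nu>_def N_def J_def)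
    qed (use N \<nu> in auto)
    also have "\<dots> = (\<integral>\<^sup>+x. indicator A (\<tau> x) \<partial>PN)"
      using \<tau>_R by (intro nn_integral_cong_AE) (auto elim!: eventually_mono)
    also have "\<dots> = (\<integral>\<^sup>+c. indicator A c \<partial>distr M cone_space TC)"
      unfolding law_TC using \<tau> A by (intro nn_integral_distr[symmetric]) simp_all
    finally show "(\<integral>\<^sup>+c. indicator A c \<partial>distr PL cone_space C) = (\<integral>\<^sup>+c. indicator A c \<partial>distr M cone_space TC)" .
  qed simp

  \<comment> \<open>The copy of the beta cone with its linear factor\<close>
  have "m < DIM('a)" "DIM('b) = DIM('a) - m" "dim W = m"
    using kd d dim_b W by (auto simp: m_def)
  then obtain e :: "nat \<Rightarrow> 'a" and T :: "'a \<Rightarrow> 'b" and h :: "'a \<Rightarrow> 'c"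
    where eTh: "\<And>i j. i < m \<Longrightarrow> j < m \<Longrightarrow> e i \<bullet> e j = (if i = j then 1 else 0)" "coisometry T" "linear h"
      "\<And>x. x \<in> span (e ` {..<m}) \<Longrightarrow> T x = 0" "h ` span (e ` {..<m}) = W" "\<And>x. h x \<in> W"
      "\<And>x. (norm (h x))\<^sup>2 + (norm (T x))\<^sup>2 = (norm x)\<^sup>2"
    using W(1) orthonormal_splitting[where ?'a='a and ?'b='b and ?'c='c] by blast
  \<comment> \<open>\<open>align\<close> expects vectors numbered from 0; \<open>\<kappa>\<close>
    numbers \<open>K'\<close> accordingly.\<close>
  obtain \<kappa> :: "nat \<Rightarrow> nat" where \<kappa>: "bij_betw \<kappa> {..<m} K'"
    using ex_bij_betw_nat_finite[OF K'(1)] K'(5) by (auto simp: atLeast0LessThan)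
  have \<kappa>K: "\<kappa> l \<in> K'" if "l < m" for l using \<kappa> that by (auto simp: bij_betw_def)
  define Q where "Q \<omega> = pos J (\<lambda>j. T (align e (\<lambda>l. \<omega> (\<kappa> l)) m (\<omega> j - \<omega> k0)))" for \<omega>
  define D where "D \<omega> = W \<times> Q \<omega>" for \<omega>
  note measurable_coisometry[OF eTh(2), measurable]
  have Q: "Q \<in> measurable PL cone_space"
    unfolding Q_def PL_def
  proof (rule measurable_pos[OF fin(3)])
    fix j assume j: "j \<in> J"
    have "(\<lambda>\<omega>. align e (\<lambda>l. \<omega> (\<kappa> l)) m (\<omega> j - \<omega> k0)) \<in> borel_measurable (PiM I \<nu>)"
      using j \<kappa>K IJ(1) by (intro measurable_align) auto
    then show "(\<lambda>\<omega>. T (align e (\<lambda>l. \<omega> (\<kappa> l)) m (\<omega> j - \<omega> k0))) \<in> borel_measurable (PiM I \<nu>)"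
      by measurable
  qed
  note times = measurable_Times_cone[OF W(1), where ?'b='b]
  have D: "D \<in> measurable PL cone_space"
    unfolding D_def by (rule measurable_compose[OF Q times])
  define BC where "BC = (beta_cone (\<beta>0 + \<delta>) J (\<lambda>j. \<beta> j + \<delta>) :: 'b set measure)"
  have sets_BC: "sets BC = sets cone_space" by (simp add: BC_def beta_cone_def)
  have law_D: "distr PL cone_space D = distr BC cone_space (\<lambda>C. W \<times> C)"
  proof (rule measure_eqI_nn_integral)
    fix A assume "A \<in> sets (distr BC cone_space (\<lambda>C. W \<times> C))"
    then have A: "(indicator A :: ('c \<times> 'b) set \<Rightarrow> ennreal) \<in> borel_measurable cone_space" by simp
    have "(\<integral>\<^sup>+c. indicator A c \<partial>distr PL cone_space D) = (\<integral>\<^sup>+\<omega>. indicator A (W \<times> Q \<omega>) \<partial>PL)"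
      unfolding D_def[symmetric] using D A by (intro nn_integral_distr) simp_all
    also have "\<dots> = (\<integral>\<^sup>+C. indicator A (W \<times> C) \<partial>BC)"
      unfolding Q_def PL_def BC_def IJ(2) \<delta>_def
    proof (rule nn_integral_beta_cone[OF measurable_compose[OF times A] eTh(2) K'(1) fin(3) IJ(4) IJ(5) \<kappa>K])
      show "\<nu> k0 = beta_distr \<beta>0" by (simp add: \<nu>_def)
      show "\<nu> j = beta_distr (\<beta> j)" "-1 \<le> \<beta> j" if "j \<in> J" for j using that IJ(5) \<beta>I by (auto simp: \<nu>_def J_def)
    qed (use \<nu> \<beta>0 in auto)
    also have "\<dots> = (\<integral>\<^sup>+c. indicator A c \<partial>distr BC cone_space (\<lambda>C. W \<times> C))"
      using times A by (intro nn_integral_distr[symmetric]) (auto simp: measurable_cong_sets[OF sets_BC refl])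
    finally show "(\<integral>\<^sup>+c. indicator A c \<partial>distr PL cone_space D) = (\<integral>\<^sup>+c. indicator A c \<partial>distr BC cone_space (\<lambda>C. W \<times> C))" .
  qed simp

  \<comment> \<open>Isometry of the two copies\<close>
  have isometric: "AE \<omega> in PL. isometric_cones (C \<omega>) (D \<omega>)"
  proof -
    have "AE \<omega> in PL. \<forall>k\<in>K'. \<omega> k \<notin> span (\<omega> ` (K' - {k}))"
      unfolding PL_def
    proof (rule AE_linearly_independent[OF \<nu> fin(1) K'(4)])
      show "card K' \<le> DIM('a)" using K'(5) kd d by (simp add: m_def)
      fix i and a :: 'a assume i: "i \<in> K'" "a \<noteq> 0"
      \<comment> \<open>Uniform directions are beta points with parameter -1; a nonempty
        \<open>K'\<close> forces dimension at least 2, so they almost surely avoid any given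
        hyperplane.\<close>
      have \<nu>i: "\<nu> i = beta_distr (-1)" using i IJ(3) K'(2) by (auto simp: \<nu>_def beta_distr_def)
      show "AE z in \<nu> i. z \<bullet> a \<noteq> 0"
        unfolding \<nu>i using d2 i by (intro AE_beta_distr_hyperplane) auto
    qed
    then show ?thesis
    proof eventually_elim
      case (elim \<omega>)
      let ?u = "\<lambda>l. \<omega> (\<kappa> l)"
      have img: "?u ` {..<m} = \<omega> ` K'" using \<kappa> by (auto simp: bij_betw_def image_image[symmetric])
      have "inj_on \<omega> K'" "independent (\<omega> ` K')"
        using independent_family[of K' \<omega>] elim by auto
      then have "dim (span (?u ` {..<m})) = m"
        using K'(5) by (simp add: img dim_span dim_eq_card_independent card_image)
      then have "isometric_cones (ruled_cone {..<m} ?u J (\<lambda>j. \<omega> j - \<omega> k0)) (W \<times> pos J (\<lambda>j. T (align e ?u m (\<omega> j - \<omega> k0))))"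
        using eTh W(1) fin(3) by (intro isometric_cones_ruled_cone[where g=h]) auto
      moreover have "ruled_cone {..<m} ?u J (\<lambda>j. \<omega> j - \<omega> k0) = C \<omega>"
        by (simp add: ruled_cone_def C_def img)
      ultimately show ?case by (simp add: D_def Q_def)
    qed
  qed

  \<comment> \<open>The common probability space\<close>
  define Z :: "(nat \<Rightarrow> 'c \<times> 'b) measure" where "Z = return (count_space UNIV) (\<lambda>_. 0)"
  interpret Z: prob_space Z unfolding Z_def by (rule prob_space_return) simp
  interpret PL: prob_space PL unfolding PL_def using \<nu> by (intro prob_space_PiM)
  \<comment> \<open>Both cones live on the first factor \<open>PL\<close>; the point mass
    \<open>Z\<close> completes it to the type of pairs of sequences that the definition of the
    coupling asks for.\<close>
  interpret L: pair_prob_space PL Z ..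
  have fst: "distr (PL \<Otimes>\<^sub>M Z) PL fst = PL" by (rule Z.distr_pair_fst)
  have "(\<Sum>i\<in>K. \<gamma> i) - real (d - k + 1) / 2 = \<beta>0 + \<delta>" by (simp add: \<beta>0_def \<delta>)
  moreover have "\<gamma> j - real (d - k + 1) / 2 = \<beta> j + \<delta>" if "j \<in> J" for j
    using \<gamma>\<beta>(1)[of j] that by (simp add: \<delta> J_def)
  ultimately have BC: "beta_cone ((\<Sum>i\<in>K. \<gamma> i) - real (d - k + 1) / 2) ({1..n} - K) (\<lambda>i. \<gamma> i - real (d - k + 1) / 2) = BC"
    unfolding BC_def I_def[symmetric] J_def[symmetric] beta_cone_def
    by (intro distr_cong arg_cong2[where f=pair_measure] PiM_cong) auto
  show ?thesis
    unfolding isometric_random_cones_def BC TC_def[symmetric]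
  proof (intro conjI exI[of _ "PL \<Otimes>\<^sub>M Z"] exI[of _ "\<lambda>p. C (fst p)"] exI[of _ "\<lambda>p. D (fst p)"])
    show "(\<lambda>\<omega>. TC \<omega>) \<in> measurable M cone_space" using TC by simp
    show "(\<lambda>C. W \<times> C) \<in> measurable BC cone_space"
      using times by (simp add: measurable_cong_sets[OF sets_BC refl])
    show "prob_space (PL \<Otimes>\<^sub>M Z)" by (rule L.prob_space_axioms)
    show "(\<lambda>p. C (fst p)) \<in> measurable (PL \<Otimes>\<^sub>M Z) cone_space" "(\<lambda>p. D (fst p)) \<in> measurable (PL \<Otimes>\<^sub>M Z) cone_space"
      using C D by (auto intro: measurable_compose[OF measurable_fst])
    show "distr (PL \<Otimes>\<^sub>M Z) cone_space (\<lambda>p. C (fst p)) = distr M cone_space (\<lambda>\<omega>. TC \<omega>)"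
      using distr_distr[OF C measurable_fst[of PL Z]] law_C by (simp add: fst comp_def)
    show "distr (PL \<Otimes>\<^sub>M Z) cone_space (\<lambda>p. D (fst p)) = distr BC cone_space (\<lambda>C. W \<times> C)"
      using distr_distr[OF D measurable_fst[of PL Z]] law_D by (simp add: fst comp_def)
    show "AE p in PL \<Otimes>\<^sub>M Z. isometric_cones (C (fst p)) (D (fst p))"
      by (rule AE_distrD[OF measurable_fst[of PL Z], where P="\<lambda>\<omega>. isometric_cones (C \<omega>) (D \<omega>)"])
        (unfold fst, rule isometric)
  qed
qed

end
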